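(* Let $P$ be a finite tree. Let $K_0\to K_1$ and $K_0 \to K_2$ be embeddings of models of $T_P^0$, where the field $K_0$ is algebraically closed. Then there exist a model $K_3$ of $T_P^0$ and embeddings of models of $T_P^0$ $K_1\to K_3$ and $K_2\to K_3$ such that the two composite maps $K_0\to K_1 \to K_3$ and $K_0\to K_2\to K_3$ agree. Furthermore, $K_3$ can be chosen to be an independent amalgamation of $K_1$ and $K_2$ over $K_0$, i.e. such that the induced ring homomorphism $K_1\otimes_{K_0}K_2\to K_3$ is injective.
   Context: A finite tree is a finite $\wedge$-semilattice $P$ with bottom element $\bot$ such that for every $x \in P$ the interval $[\bot,x]$ is totally ordered. A valuation ring on a field $K$ is a subring $\mathcal{O}$ with $x\in\mathcal{O}$ or $x^{-1}\in\mathcal{O}$ for each $x\in K^\times$ ($\mathcal{O}=K$ allowed). $T_P^0$ is the theory, in the language of rings with a unary predicate $\mathcal{O}_p$ for each $p\in P$, whose models are structures $(K,\mathcal{O}_p : p\in P)$ where $K$ is a field, each $\mathcal{O}_p$ is a valuation ring on $K$, $\mathcal{O}_\bot=K$, and $\mathcal{O}_p\supseteq\mathcal{O}_{p'}$ whenever $p<p'$. An embedding of models of $T_P^0$ is a field embedding $f:K\to L$ such that for each $p\in P$ the preimage under $f$ of $\mathcal{O}_p$ on $L$ is $\mathcal{O}_p$ on $K$. (Since $K_0$ is algebraically closed, $K_1\otimes_{K_0}K_2$ is an integral domain.) *)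

theory Defs
  imports "HOL-Algebra.Algebra"
begin

section \<open>Finite trees\<close>

class finite_tree = finite + semilattice_inf + order_bot +
  assumes below_total: "y \<le> x \<Longrightarrow> z \<le> x \<Longrightarrow> y \<le> z \<or> z \<le> y"


section \<open>Models of the theory of fields with a tree of valuation rings\<close>

definition valuation_ring :: "'a set \<Rightarrow> ('a, 'm) ring_scheme \<Rightarrow> bool"
  where "valuation_ring V K \<longleftrightarrow>
    subring V K \<and> (\<forall>x \<in> carrier K - {\<zero>\<^bsub>K\<^esub>}. x \<in> V \<or> inv\<^bsub>K\<^esub> x \<in> V)"

text \<open>A structure is a field \<^term>\<open>K\<close> together with the family \<^term>\<open>V\<close> of
  interpretations of the unary predicates indexed by the tree.\<close>

definition tree_valued_field ::
    "('a, 'm) ring_scheme \<Rightarrow> ('p::finite_tree \<Rightarrow> 'a set) \<Rightarrow> bool"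
  where "tree_valued_field K V \<longleftrightarrow>
    field K \<and>
    (\<forall>p. valuation_ring (V p) K) \<and>
    V bot = carrier K \<and>
    (\<forall>p q. p < q \<longrightarrow> V q \<subseteq> V p)"

definition tree_valued_embedding ::
    "('a, 'm) ring_scheme \<Rightarrow> ('p::finite_tree \<Rightarrow> 'a set) \<Rightarrow>
     ('b, 'n) ring_scheme \<Rightarrow> ('p \<Rightarrow> 'b set) \<Rightarrow> ('a \<Rightarrow> 'b) \<Rightarrow> bool"
  where "tree_valued_embedding K V L W f \<longleftrightarrow>
    f \<in> ring_hom K L \<and> inj_on f (carrier K) \<and>
    (\<forall>p. {x \<in> carrier K. f x \<in> W p} = V p)"


section \<open>Tensor products of commutative algebras\<close>

definition integral_monoid_ring :: "('a, 'm) monoid_scheme \<Rightarrow> ('a \<Rightarrow>\<^sub>0 int) ring"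
  where "integral_monoid_ring M =
    \<lparr>carrier = {c. Poly_Mapping.keys c \<subseteq> carrier M},
     monoid.mult = (\<lambda>c d. frag_extend (\<lambda>x. frag_extend (\<lambda>y. frag_of (x \<otimes>\<^bsub>M\<^esub> y)) d) c),
     one = frag_of \<one>\<^bsub>M\<^esub>,
     ring.zero = 0,
     ring.add = (+)\<rparr>"

text \<open>The ring homomorphisms \<^term>\<open>g1\<close> and \<^term>\<open>g2\<close> from \<^term>\<open>K0\<close> make
  \<^term>\<open>K1\<close> and \<^term>\<open>K2\<close> into \<^term>\<open>K0\<close>-algebras. The underlying group of the
  tensor product is the free abelian group on pairs modulo the subgroup generated by the
  bilinearity relations below. The product of a pair and a relation is again a relation, so in
  the integral monoid ring of the multiplicative monoid of pairs this subgroup is also the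
  ideal generated by the relations, and the quotient carries the multiplication given by
  multiplying both components.\<close>

definition tensor_relations ::
    "('a, 'k) ring_scheme \<Rightarrow> ('b, 'm) ring_scheme \<Rightarrow> ('c, 'n) ring_scheme \<Rightarrow>
     ('a \<Rightarrow> 'b) \<Rightarrow> ('a \<Rightarrow> 'c) \<Rightarrow> ('b \<times> 'c \<Rightarrow>\<^sub>0 int) set"
  where "tensor_relations K0 K1 K2 g1 g2 =
    {frag_of (a \<oplus>\<^bsub>K1\<^esub> a', b) - frag_of (a, b) - frag_of (a', b) | a a' b.
       a \<in> carrier K1 \<and> a' \<in> carrier K1 \<and> b \<in> carrier K2} \<union>
    {frag_of (a, b \<oplus>\<^bsub>K2\<^esub> b') - frag_of (a, b) - frag_of (a, b') | a b b'.
       a \<in> carrier K1 \<and> b \<in> carrier K2 \<and> b' \<in> carrier K2} \<union>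
    {frag_of (g1 r \<otimes>\<^bsub>K1\<^esub> a, b) - frag_of (a, g2 r \<otimes>\<^bsub>K2\<^esub> b) | r a b.
       r \<in> carrier K0 \<and> a \<in> carrier K1 \<and> b \<in> carrier K2}"

definition tensor_ideal ::
    "('a, 'k) ring_scheme \<Rightarrow> ('b, 'm) ring_scheme \<Rightarrow> ('c, 'n) ring_scheme \<Rightarrow>
     ('a \<Rightarrow> 'b) \<Rightarrow> ('a \<Rightarrow> 'c) \<Rightarrow> ('b \<times> 'c \<Rightarrow>\<^sub>0 int) set"
  where "tensor_ideal K0 K1 K2 g1 g2 =
    Idl\<^bsub>integral_monoid_ring (K1 \<times>\<times> K2)\<^esub> (tensor_relations K0 K1 K2 g1 g2)"

definition tensor_ring ::
    "('a, 'k) ring_scheme \<Rightarrow> ('b, 'm) ring_scheme \<Rightarrow> ('c, 'n) ring_scheme \<Rightarrow>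
     ('a \<Rightarrow> 'b) \<Rightarrow> ('a \<Rightarrow> 'c) \<Rightarrow> ('b \<times> 'c \<Rightarrow>\<^sub>0 int) set ring"
  where "tensor_ring K0 K1 K2 g1 g2 =
    integral_monoid_ring (K1 \<times>\<times> K2) Quot tensor_ideal K0 K1 K2 g1 g2"

definition pure_tensor ::
    "('a, 'k) ring_scheme \<Rightarrow> ('b, 'm) ring_scheme \<Rightarrow> ('c, 'n) ring_scheme \<Rightarrow>
     ('a \<Rightarrow> 'b) \<Rightarrow> ('a \<Rightarrow> 'c) \<Rightarrow> 'b \<Rightarrow> 'c \<Rightarrow> ('b \<times> 'c \<Rightarrow>\<^sub>0 int) set"
  where "pure_tensor K0 K1 K2 g1 g2 a b =
    tensor_ideal K0 K1 K2 g1 g2 +>\<^bsub>integral_monoid_ring (K1 \<times>\<times> K2)\<^esub> frag_of (a, b)"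

definition tensor_induced_hom ::
    "('a, 'k) ring_scheme \<Rightarrow> ('b, 'm) ring_scheme \<Rightarrow> ('c, 'n) ring_scheme \<Rightarrow>
     ('a \<Rightarrow> 'b) \<Rightarrow> ('a \<Rightarrow> 'c) \<Rightarrow>
     ('d, 'l) ring_scheme \<Rightarrow> ('b \<Rightarrow> 'd) \<Rightarrow> ('c \<Rightarrow> 'd) \<Rightarrow> (('b \<times> 'c \<Rightarrow>\<^sub>0 int) set \<Rightarrow> 'd) \<Rightarrow> bool"
  where "tensor_induced_hom K0 K1 K2 g1 g2 L f1 f2 h \<longleftrightarrow>
    h \<in> ring_hom (tensor_ring K0 K1 K2 g1 g2) L \<and>
    (\<forall>a \<in> carrier K1. \<forall>b \<in> carrier K2.
       h (pure_tensor K0 K1 K2 g1 g2 a b) = f1 a \<otimes>\<^bsub>L\<^esub> f2 b)"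

definition independent_amalgamation ::
    "('a, 'k) ring_scheme \<Rightarrow> ('b, 'm) ring_scheme \<Rightarrow> ('c, 'n) ring_scheme \<Rightarrow>
     ('a \<Rightarrow> 'b) \<Rightarrow> ('a \<Rightarrow> 'c) \<Rightarrow>
     ('d, 'l) ring_scheme \<Rightarrow> ('b \<Rightarrow> 'd) \<Rightarrow> ('c \<Rightarrow> 'd) \<Rightarrow> bool"
  where "independent_amalgamation K0 K1 K2 g1 g2 L f1 f2 \<longleftrightarrow>
    (\<exists>h. tensor_induced_hom K0 K1 K2 g1 g2 L f1 f2 h \<and>
         inj_on h (carrier (tensor_ring K0 K1 K2 g1 g2)))"

text \<open>HOL cannot quantify existentially over types, so the amalgam needs a fixed type. This is
  the type of the fraction field of the tensor product, with fractions represented as classes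
  of pairs (numerator, denominator).\<close>

type_synonym ('b, 'c) tensor_fraction =
  "(('b \<times> 'c \<Rightarrow>\<^sub>0 int) set \<times> ('b \<times> 'c \<Rightarrow>\<^sub>0 int) set) set"

end

theory Submission
  imports Defs
begin

text \<open>
  Write \<open>k\<close> for the image of \<open>K0\<close>. For a valuation ring \<open>W\<close> of \<open>K1\<close>, a minimal valuation ring \<open>U\<close> below \<open>W\<close>
  with the same trace on \<open>k\<close> is rational: its residue field is that of \<open>U \<inter> k\<close>. Otherwise the residue of
  some \<open>t\<close> would be transcendental, because \<open>k\<close> is algebraically closed, and Chevalley's theorem would
  shrink \<open>U\<close> by sending \<open>t\<close> to 0.

  Applied to \<open>W = K1\<close>, this gives a place of \<open>K1\<close> with values in \<open>k\<close>. Its base change to the tensor product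
  \<open>T\<close> is multiplicative and takes a nonzero value on a suitable multiple of every nonzero element.
  Hence \<open>T\<close> is a domain, and \<open>K3\<close> is its field of fractions.

  The valuation rings of \<open>K3\<close> are constructed along the tree, with the invariant that the residue fields
  of \<open>K1\<close> and \<open>K2\<close> are linearly disjoint over that of \<open>k\<close>. To pass from \<open>V\<close> to a successor with prescribed
  traces \<open>W1\<close> and \<open>W2\<close>, choose \<open>U\<close> rational below \<open>W1\<close>. Linear disjointness implies that the products
  of \<open>W2\<close> with the maximal ideal of \<open>U\<close>, the products of \<open>W1\<close> with the maximal ideal of \<open>W2\<close>, and the maximal
  ideal of \<open>V\<close> generate a proper ideal. A valuation ring
  dominating this ideal, localised at the units of \<open>W1\<close> lying in \<open>U\<close>, has the required traces, and it satisfies the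
  invariant because \<open>U\<close> is rational.
\<close>

section \<open>Chevalley's extension theorem\<close>

text \<open>Prescribing the traces on \<open>K1\<close> and \<open>K2\<close> can fail inside a
  given \<open>V\<close>: a relation between residues of the two fields that does not come from
  \<open>k\<close> may contradict the chosen rings. Linear disjointness of the residue fields
  excludes this; at the root, where \<open>V\<close> is the whole field, it is the injectivity of
  the map from the tensor product. The refinement \<open>U\<close> is what keeps the invariant
  alive: a normalised coefficient from \<open>K1\<close> can be replaced by a scalar of
  \<open>k\<close> up to an error in the maximal ideal of \<open>U\<close>. The price is that the
  ring supplied by Chevalley's theorem has trace \<open>U\<close> on \<open>K1\<close> instead of
  \<open>W1\<close>, and localising repairs exactly this. The argument is therefore asymmetric: only
  the \<open>K1\<close> side is refined. Since the elements below a node form a chain, a ring has to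
  be fitted only to that of the immediate predecessor, and incomparable nodes do not
  interact.\<close>

context ring
begin

text \<open>Negation is not built in: wherever a subgroup is needed below, the generating set is
  stable under negation. Adding one generator at a time yields a simple induction.\<close>

inductive_set add_span :: "'a set \<Rightarrow> 'a set" for G where
  zero: "\<zero> \<in> add_span G"
| add: "x \<in> add_span G \<Longrightarrow> g \<in> G \<Longrightarrow> x \<oplus> g \<in> add_span G"

lemma add_span_incl: "G \<subseteq> carrier R \<Longrightarrow> G \<subseteq> add_span G"
  using add_span.add[OF add_span.zero] by fastforce

lemma add_span_carrier:
  assumes "G \<subseteq> carrier R" shows "add_span G \<subseteq> carrier R"
proof
  fix x assume "x \<in> add_span G"
  then show "x \<in> carrier R"
    using assms by induction auto
qed

lemma add_span_add:
  assumes G: "G \<subseteq> carrier R" and "x \<in> add_span G" "y \<in> add_span G"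
  shows "x \<oplus> y \<in> add_span G"
  using assms(3,2)
proof induction
  case zero
  then show ?case using add_span_carrier[OF G] by auto
next
  case (add y g)
  have "x \<oplus> (y \<oplus> g) = x \<oplus> y \<oplus> g"
    using add G add_span_carrier[OF G] by (intro a_assoc[symmetric]) auto
  then show ?case using add by (auto intro: add_span.add)
qed

lemma add_span_least:
  assumes "\<zero> \<in> A" "G \<subseteq> A" "\<And>x y. x \<in> A \<Longrightarrow> y \<in> A \<Longrightarrow> x \<oplus> y \<in> A"
  shows "add_span G \<subseteq> A"
proof
  fix x assume "x \<in> add_span G"
  then show "x \<in> A" using assms by induction auto
qed

lemma add_span_mult:
  assumes G: "G \<subseteq> carrier R" and r: "r \<in> carrier R" "\<And>g. g \<in> G \<Longrightarrow> r \<otimes> g \<in> add_span G"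
    and x: "x \<in> add_span G"
  shows "r \<otimes> x \<in> add_span G"
  using x
proof induction
  case zero
  then show ?case using r by (simp add: add_span.zero)
next
  case (add x g)
  have "x \<in> carrier R" "g \<in> carrier R"
    using add G add_span_carrier[OF G] by auto
  then show ?case
    using add r add_span_add[OF G] by (simp add: r_distr)
qed

lemma add_span_mult_right:
  assumes G: "G \<subseteq> carrier R" and r: "r \<in> carrier R" "\<And>g. g \<in> G \<Longrightarrow> g \<otimes> r \<in> add_span G"
    and x: "x \<in> add_span G"
  shows "x \<otimes> r \<in> add_span G"
  using x
proof induction
  case zero
  then show ?case using r by (simp add: add_span.zero)
next
  case (add x g)
  have "x \<in> carrier R" "g \<in> carrier R"
    using add G add_span_carrier[OF G] by auto
  then show ?case
    using add r add_span_add[OF G] by (simp add: l_distr)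
qed

text \<open>Horner form: these are the values at \<open>x\<close> of polynomials with
  \<open>n\<close> coefficients, that is of degree less than \<open>n\<close>. The coefficients
  range over a mere set because they will be taken from an ideal as well as from a subring.\<close>

primrec poly_values :: "'a set \<Rightarrow> 'a \<Rightarrow> nat \<Rightarrow> 'a set" where
  "poly_values A x 0 = {\<zero>}"
| "poly_values A x (Suc n) = {a \<oplus> x \<otimes> p | a p. a \<in> A \<and> p \<in> poly_values A x n}"

lemma poly_values_carrier:
  "A \<subseteq> carrier R \<Longrightarrow> x \<in> carrier R \<Longrightarrow> poly_values A x n \<subseteq> carrier R"
  by (induction n) auto

lemma poly_values_Suc:
  assumes "\<zero> \<in> A" "A \<subseteq> carrier R" "x \<in> carrier R"
  shows "poly_values A x n \<subseteq> poly_values A x (Suc n)"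
proof (induction n)
  case 0
  have "\<zero> = \<zero> \<oplus> x \<otimes> \<zero>" using assms by simp
  then show ?case using assms(1) by auto
next
  case (Suc n)
  then show ?case by auto
qed

lemma poly_values_mono:
  assumes "\<zero> \<in> A" "A \<subseteq> carrier R" "x \<in> carrier R" "n \<le> m"
  shows "poly_values A x n \<subseteq> poly_values A x m"
  using assms(4) by (induction rule: dec_induct) (use poly_values_Suc[OF assms(1-3)] in auto)

lemma poly_values_zero:
  assumes "\<zero> \<in> A" "A \<subseteq> carrier R" "x \<in> carrier R"
  shows "\<zero> \<in> poly_values A x n"
  using poly_values_mono[OF assms, of 0 n] by auto

lemma poly_values_shift:
  assumes "\<zero> \<in> A" "A \<subseteq> carrier R" "x \<in> carrier R" "p \<in> poly_values A x n"
  shows "x \<otimes> p \<in> poly_values A x (Suc n)"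
proof -
  have "x \<otimes> p = \<zero> \<oplus> x \<otimes> p"
    using assms poly_values_carrier[OF assms(2,3), THEN subsetD] by auto
  then show ?thesis using assms by auto
qed

end

section \<open>Polynomial values in commutative rings\<close>

context cring
begin

lemma poly_values_add:
  assumes A: "A \<subseteq> carrier R" "x \<in> carrier R" "\<And>a b. a \<in> A \<Longrightarrow> b \<in> A \<Longrightarrow> a \<oplus> b \<in> A"
  shows "p \<in> poly_values A x n \<Longrightarrow> q \<in> poly_values A x n \<Longrightarrow> p \<oplus> q \<in> poly_values A x n"
proof (induction n arbitrary: p q)
  case 0
  then show ?case by simp
next
  case (Suc n)
  then obtain a p' b q' where p: "p = a \<oplus> x \<otimes> p'" "a \<in> A" "p' \<in> poly_values A x n"
    and q: "q = b \<oplus> x \<otimes> q'" "b \<in> A" "q' \<in> poly_values A x n" by auto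
  have "p' \<in> carrier R" "q' \<in> carrier R" "a \<in> carrier R" "b \<in> carrier R"
    using p q A poly_values_carrier[OF A(1,2), THEN subsetD] by auto
  then have "p \<oplus> q = (a \<oplus> b) \<oplus> x \<otimes> (p' \<oplus> q')"
    unfolding p q using A(2) by algebra
  then show ?case using Suc.IH[OF p(3) q(3)] A(3)[OF p(2) q(2)] by auto
qed

lemma poly_values_cmult:
  assumes A: "A \<subseteq> carrier R" "x \<in> carrier R" "c \<in> carrier R" "\<And>a. a \<in> A \<Longrightarrow> c \<otimes> a \<in> B"
  shows "p \<in> poly_values A x n \<Longrightarrow> c \<otimes> p \<in> poly_values B x n"
proof (induction n arbitrary: p)
  case 0
  then show ?case using A by simp
next
  case (Suc n)
  then obtain a p' where p: "p = a \<oplus> x \<otimes> p'" "a \<in> A" "p' \<in> poly_values A x n" by auto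
  have "p' \<in> carrier R" "a \<in> carrier R"
    using p A poly_values_carrier[OF A(1,2), THEN subsetD] by auto
  then have "c \<otimes> p = c \<otimes> a \<oplus> x \<otimes> (c \<otimes> p')"
    unfolding p using A by algebra
  then show ?case using Suc.IH[OF p(3)] A(4)[OF p(2)] by auto
qed

text \<open>The recursion splits off the constant term; splitting off the leading term instead is
  what a degree reduction needs.\<close>

lemma poly_values_top:
  assumes A: "\<zero> \<in> A" "A \<subseteq> carrier R" "x \<in> carrier R"
  shows "poly_values A x (Suc n) = {p \<oplus> a \<otimes> x [^] n | p a. p \<in> poly_values A x n \<and> a \<in> A}"
    (is "_ = ?P n")
proof (induction n)
  case 0
  have "p \<in> carrier R" if "p \<in> A" for p using that A by auto
  then have "(\<exists>a. y = a \<oplus> x \<otimes> \<zero> \<and> a \<in> A) \<longleftrightarrow> (\<exists>a. y = \<zero> \<oplus> a \<otimes> x [^] (0::nat) \<and> a \<in> A)" for y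
    using A(3) by (intro ex_cong1) auto
  then show ?case by auto
next
  case (Suc n)
  have "poly_values A x (Suc (Suc n)) = {a \<oplus> x \<otimes> p | a p. a \<in> A \<and> p \<in> ?P n}"
    by (subst poly_values.simps, subst Suc) simp
  also have "\<dots> = {a \<oplus> x \<otimes> (p \<oplus> b \<otimes> x [^] n) | a p b. a \<in> A \<and> p \<in> poly_values A x n \<and> b \<in> A}"
    by blast
  also have "\<dots> = {(a \<oplus> x \<otimes> p) \<oplus> b \<otimes> x [^] Suc n | a p b. a \<in> A \<and> p \<in> poly_values A x n \<and> b \<in> A}"
  proof -
    have "a \<oplus> x \<otimes> (p \<oplus> b \<otimes> x [^] n) = (a \<oplus> x \<otimes> p) \<oplus> b \<otimes> x [^] Suc n"
      if "a \<in> A" "p \<in> poly_values A x n" "b \<in> A" for a p b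
    proof -
      have "a \<in> carrier R" "b \<in> carrier R" "p \<in> carrier R" "x [^] n \<in> carrier R"
        using that A poly_values_carrier[OF A(2,3), THEN subsetD] by auto
      then show ?thesis using A(3) by (simp, algebra)
    qed
    then show ?thesis by (intro Collect_cong iff_exI) (metis (no_types, lifting))
  qed
  also have "\<dots> = ?P (Suc n)" by auto
  finally show ?case .
qed

lemma poly_values_mult:
  assumes A: "subring A R" "x \<in> carrier R"
  shows "p \<in> poly_values A x n \<Longrightarrow> q \<in> poly_values A x m \<Longrightarrow> p \<otimes> q \<in> poly_values A x (n + m)"
proof (induction n arbitrary: p)
  case 0
  then have "q \<in> carrier R" using poly_values_carrier[OF subringE(1)[OF A(1)] A(2)] by auto
  then show ?case using 0 poly_values_zero[OF subringE(2,1)[OF A(1)] A(2)] by simp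
next
  case (Suc n)
  then obtain a p' where p: "p = a \<oplus> x \<otimes> p'" "a \<in> A" "p' \<in> poly_values A x n" by auto
  note Ac = subringE(1)[OF A(1)]
  have c: "p' \<in> carrier R" "a \<in> carrier R" "q \<in> carrier R"
    using p A Ac Suc.prems poly_values_carrier[OF Ac A(2), THEN subsetD] by auto
  have "a \<otimes> q \<in> poly_values A x m"
    by (rule poly_values_cmult[OF Ac A(2) c(2) _ Suc.prems(2)])
      (use subringE(6)[OF A(1)] p in auto)
  then have 1: "a \<otimes> q \<in> poly_values A x (Suc n + m)"
    using poly_values_mono[OF subringE(2,1)[OF A(1)] A(2), of m "Suc n + m"] by auto
  have 2: "x \<otimes> (p' \<otimes> q) \<in> poly_values A x (Suc n + m)"
    using poly_values_shift[OF subringE(2,1)[OF A(1)] A(2) Suc.IH[OF p(3) Suc.prems(2)]] by simp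
  have "p \<otimes> q = a \<otimes> q \<oplus> x \<otimes> (p' \<otimes> q)"
    unfolding p using A(2) c by algebra
  then show ?case
    using poly_values_add[OF Ac A(2) subringE(7)[OF A(1)] 1 2] by simp
qed

lemma poly_values_subring:
  assumes A: "subring A R" "x \<in> carrier R"
  shows "subring (\<Union>n. poly_values A x n) R"
proof (rule subringI)
  note Ac = subringE(1)[OF A(1)] and A0 = subringE(2,1)[OF A(1)]
  show "(\<Union>n. poly_values A x n) \<subseteq> carrier R"
    using poly_values_carrier[OF Ac A(2)] by auto
  have "\<one> = \<one> \<oplus> x \<otimes> \<zero>" using A(2) by simp
  then have "\<one> \<in> poly_values A x 1" using subringE(3)[OF A(1)] by auto
  then show "\<one> \<in> (\<Union>n. poly_values A x n)" by blast
  fix p assume "p \<in> (\<Union>n. poly_values A x n)"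
  then obtain n where n: "p \<in> poly_values A x n" by auto
  have pc: "p \<in> carrier R" using n poly_values_carrier[OF Ac A(2), THEN subsetD] by auto
  have "(\<ominus> \<one>) \<otimes> p \<in> poly_values A x n"
    using poly_values_cmult[OF Ac A(2) _ _ n, of "\<ominus> \<one>" A] subringE(3,5,6)[OF A(1)] by auto
  then show "\<ominus> p \<in> (\<Union>n. poly_values A x n)"
    using pc by (auto simp: l_minus)
  fix q assume "q \<in> (\<Union>n. poly_values A x n)"
  then obtain m where m: "q \<in> poly_values A x m" by auto
  show "p \<otimes> q \<in> (\<Union>n. poly_values A x n)"
    using poly_values_mult[OF A n m] by auto
  have "p \<in> poly_values A x (max n m)" "q \<in> poly_values A x (max n m)"
    using n m poly_values_mono[OF A0 A(2), of n "max n m"]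
      poly_values_mono[OF A0 A(2), of m "max n m"] by auto
  then show "p \<oplus> q \<in> (\<Union>n. poly_values A x n)"
    using poly_values_add[OF Ac A(2) subringE(7)[OF A(1)]] by blast
qed

lemma poly_values_contains:
  assumes A: "subring A R" "x \<in> carrier R"
  shows "A \<subseteq> (\<Union>n. poly_values A x n)" "x \<in> (\<Union>n. poly_values A x n)"
proof -
  show 1: "A \<subseteq> (\<Union>n. poly_values A x n)"
  proof
    fix a assume "a \<in> A"
    moreover then have "a = a \<oplus> x \<otimes> \<zero>" using subringE(1)[OF A(1)] A(2) by auto
    ultimately have "a \<in> poly_values A x 1" by auto
    then show "a \<in> (\<Union>n. poly_values A x n)" by blast
  qed
  then obtain n where n: "\<one> \<in> poly_values A x n" using subringE(3)[OF A(1)] by auto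
  have "x \<otimes> \<one> \<in> poly_values A x (Suc n)"
    by (rule poly_values_shift) (use n A subringE(1,2) in auto)
  then show "x \<in> (\<Union>n. poly_values A x n)" using A(2) by (simp del: poly_values.simps) blast
qed

text \<open>Here \<open>y\<close> is the inverse of \<open>s\<close>, so a power of \<open>s\<close>
  at least as large as the degree clears all denominators, and \<open>J\<close> absorbs the
  remaining powers of \<open>s\<close>.\<close>

lemma poly_values_clear:
  assumes J: "J \<subseteq> carrier R" "\<zero> \<in> J" "\<And>a b. a \<in> J \<Longrightarrow> b \<in> J \<Longrightarrow> a \<oplus> b \<in> J"
    and s: "s \<in> carrier R" "\<And>a. a \<in> J \<Longrightarrow> s \<otimes> a \<in> J" and y: "y \<in> carrier R" "s \<otimes> y = \<one>"
  shows "p \<in> poly_values J y n \<Longrightarrow> s [^] n \<otimes> p \<in> J"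
proof (induction n arbitrary: p)
  case 0
  then show ?case using J by simp
next
  case (Suc n)
  then obtain a p' where p: "p = a \<oplus> y \<otimes> p'" "a \<in> J" "p' \<in> poly_values J y n" by auto
  have c: "p' \<in> carrier R" "a \<in> carrier R" "s [^] n \<in> carrier R"
    using p J s poly_values_carrier[OF J(1) y(1), THEN subsetD] by auto
  have "s [^] Suc n \<otimes> p = s [^] n \<otimes> s \<otimes> (a \<oplus> y \<otimes> p')" using p by simp
  also have "\<dots> = s [^] n \<otimes> (s \<otimes> a) \<oplus> (s \<otimes> y) \<otimes> (s [^] n \<otimes> p')"
    using c s(1) y(1) by algebra
  also have "\<dots> = s [^] n \<otimes> (s \<otimes> a) \<oplus> s [^] n \<otimes> p'" using c y by simp
  finally have "s [^] Suc n \<otimes> p = s [^] n \<otimes> (s \<otimes> a) \<oplus> s [^] n \<otimes> p'" .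
  moreover have "s [^] k \<otimes> b \<in> J" if "b \<in> J" for k :: nat and b
    using that
  proof (induction k arbitrary: b)
    case 0
    then show ?case using J(1) by auto
  next
    case (Suc k)
    then have "b \<in> carrier R" using J(1) by auto
    then have "s [^] Suc k \<otimes> b = s [^] k \<otimes> (s \<otimes> b)" using s(1) by (simp add: m_assoc)
    then show ?case using Suc.IH[OF s(2)[OF Suc.prems]] by simp
  qed
  ultimately show ?case using J(3) Suc.IH[OF p(3)] s(2)[OF p(2)] by auto
qed

text \<open>This is the reciprocal polynomial: the coefficients of \<open>q\<close> reappear in
  reverse order. The additional factor \<open>z\<close> replaces the exponent \<open>n - 1\<close>,
  so that no truncated subtraction occurs.\<close>

lemma poly_values_reverse:
  assumes J: "J \<subseteq> carrier R" "\<zero> \<in> J"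
    and y: "y \<in> carrier R" "z \<in> carrier R" "y \<otimes> z = \<one>"
  shows "q \<in> poly_values J z n \<Longrightarrow> y [^] n \<otimes> (z \<otimes> q) \<in> poly_values J y n"
proof (induction n arbitrary: q)
  case 0
  then show ?case using y by simp
next
  case (Suc n)
  then obtain a p where q: "q = a \<oplus> z \<otimes> p" "a \<in> J" "p \<in> poly_values J z n" by auto
  have c: "p \<in> carrier R" "a \<in> carrier R" "y [^] n \<in> carrier R"
    using q J y poly_values_carrier[OF J(1) y(2), THEN subsetD] by auto
  have "y [^] Suc n \<otimes> (z \<otimes> q) = y [^] n \<otimes> y \<otimes> (z \<otimes> (a \<oplus> z \<otimes> p))" using q by simp
  also have "\<dots> = (y \<otimes> z) \<otimes> (y [^] n \<otimes> (z \<otimes> p) \<oplus> a \<otimes> y [^] n)"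
    using c y(1,2) by algebra
  also have "\<dots> = y [^] n \<otimes> (z \<otimes> p) \<oplus> a \<otimes> y [^] n" using c y by simp
  finally show ?case
    using poly_values_top[OF J(2,1) y(1), of n] q(2) Suc.IH[OF q(3)] by blast
qed

end

section \<open>Chevalley's theorem inside a field\<close>

context field
begin

lemma nonzero_inv:
  assumes "x \<in> carrier R" "x \<noteq> \<zero>"
  shows "inv x \<in> carrier R" "inv x \<noteq> \<zero>" "x \<otimes> inv x = \<one>" "inv x \<otimes> x = \<one>" "inv (inv x) = x"
proof -
  have "x \<in> Units R" using assms field_Units by auto
  then show "inv x \<in> carrier R" "x \<otimes> inv x = \<one>" "inv x \<otimes> x = \<one>" "inv (inv x) = x" by auto
  then show "inv x \<noteq> \<zero>" using assms by (metis r_null zero_not_one)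
qed

text \<open>The test \<open>x = \<zero>\<close> is needed because \<open>inv \<zero>\<close> is unspecified.\<close>

definition nonunits :: "'a set \<Rightarrow> 'a set"
  where "nonunits V = {x \<in> V. x = \<zero> \<or> inv x \<notin> V}"

text \<open>The inverse is that of the ambient field. In this way valuation rings of different
  subfields are subsets of one carrier and can be intersected and compared directly.\<close>

definition val_subring :: "'a set \<Rightarrow> 'a set \<Rightarrow> bool"
  where "val_subring k V \<longleftrightarrow> subring V R \<and> V \<subseteq> k \<and> (\<forall>x \<in> k - {\<zero>}. x \<in> V \<or> inv x \<in> V)"

text \<open>Zorn's lemma gives a subring \<open>M\<close> that is maximal among those in which
  \<open>I\<close> still generates a proper ideal. If neither \<open>x\<close> nor its inverse were
  in \<open>M\<close>, adjoining either would make the ideal improper; the two resulting relations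
  can be played against each other until one of them becomes shorter than the shortest
  possible.\<close>

theorem chevalley_extension:
  assumes R0: "subring R0 R" and I: "I \<subseteq> R0" "\<And>a b. a \<in> I \<Longrightarrow> b \<in> I \<Longrightarrow> a \<oplus> b \<in> I"
    "\<And>r a. r \<in> R0 \<Longrightarrow> a \<in> I \<Longrightarrow> r \<otimes> a \<in> I" "\<zero> \<in> I" "\<one> \<notin> I"
  shows "\<exists>V. val_subring (carrier R) V \<and> R0 \<subseteq> V \<and> I \<subseteq> nonunits V"
proof -
  \<comment> \<open>\<open>J S\<close> is the ideal that \<open>I\<close> generates in a subring
    \<open>S\<close> containing \<open>I\<close>.\<close>
  define J where "J S = add_span {i \<otimes> s | i s. i \<in> I \<and> s \<in> S}" for S
  have Ic: "I \<subseteq> carrier R" using I R0 subringE(1) by blast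
  have Gc: "{i \<otimes> s | i s. i \<in> I \<and> s \<in> S} \<subseteq> carrier R" if "S \<subseteq> carrier R" for S
    using that Ic by auto
  have Jc: "J S \<subseteq> carrier R" if "S \<subseteq> carrier R" for S
    unfolding J_def by (rule add_span_carrier[OF Gc[OF that]])
  have J0: "\<zero> \<in> J S" for S unfolding J_def by (rule add_span.zero)
  have Ja: "a \<oplus> b \<in> J S" if "S \<subseteq> carrier R" "a \<in> J S" "b \<in> J S" for S a b
    using add_span_add[OF Gc[OF that(1)]] that unfolding J_def by auto
  have JG: "i \<otimes> s \<in> J S" if "S \<subseteq> carrier R" "i \<in> I" "s \<in> S" for S i s
    using add_span_incl[OF Gc[OF that(1)]] that unfolding J_def by auto
  have Jm: "r \<otimes> x \<in> J S" if S: "subring S R" and r: "r \<in> S" and x: "x \<in> J S" for S r x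
    unfolding J_def
  proof (rule add_span_mult[OF _ _ _ x[unfolded J_def]])
    note Sc = subringE(1)[OF S]
    show "{i \<otimes> s | i s. i \<in> I \<and> s \<in> S} \<subseteq> carrier R" by (rule Gc[OF Sc])
    show "r \<in> carrier R" using r Sc by auto
    fix g assume "g \<in> {i \<otimes> s | i s. i \<in> I \<and> s \<in> S}"
    then obtain i s where g: "g = i \<otimes> s" "i \<in> I" "s \<in> S" by auto
    have "r \<otimes> g = i \<otimes> (r \<otimes> s)"
      unfolding g using r g Sc Ic by (intro m_lcomm) auto
    then show "r \<otimes> g \<in> add_span {i \<otimes> s | i s. i \<in> I \<and> s \<in> S}"
      using JG[OF Sc g(2), of "r \<otimes> s"] subringE(6)[OF S r g(3)] unfolding J_def by simp
  qed
  define \<A> where "\<A> = {S. subring S R \<and> R0 \<subseteq> S \<and> \<one> \<notin> J S}"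
  have "J R0 \<subseteq> I" unfolding J_def
  proof (rule add_span_least)
    have "i \<otimes> r \<in> I" if "i \<in> I" "r \<in> R0" for i r
      using I(3)[OF that(2,1)] that Ic subringE(1)[OF R0] by (simp add: m_comm subset_iff)
    then show "{i \<otimes> s |i s. i \<in> I \<and> s \<in> R0} \<subseteq> I" by auto
  qed (use I in auto)
  then have "R0 \<in> \<A>" using R0 I unfolding \<A>_def by auto
  have "\<exists>M\<in>\<A>. \<forall>Y\<in>\<A>. M \<subseteq> Y \<longrightarrow> Y = M"
  proof (rule subset_Zorn_nonempty)
    show "\<A> \<noteq> {}" using \<open>R0 \<in> \<A>\<close> by auto
    fix \<C> assume C: "\<C> \<noteq> {}" "subset.chain \<A> \<C>"
    have CA: "\<And>S. S \<in> \<C> \<Longrightarrow> S \<in> \<A>" and lin: "\<And>S T. S \<in> \<C> \<Longrightarrow> T \<in> \<C> \<Longrightarrow> S \<subseteq> T \<or> T \<subseteq> S"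
      using C(2) unfolding subset.chain_def by blast+
    have sub: "subring S R" if "S \<in> \<C>" for S using CA[OF that] unfolding \<A>_def by auto
    have two: "\<exists>S\<in>\<C>. x \<in> S \<and> y \<in> S" if "x \<in> \<Union>\<C>" "y \<in> \<Union>\<C>" for x y
      using that lin by (meson UnionE subsetD)
    have subU: "subring (\<Union>\<C>) R"
    proof (rule subringI)
      show "\<Union>\<C> \<subseteq> carrier R" using subringE(1)[OF sub] by auto
      show "\<one> \<in> \<Union>\<C>" using subringE(3)[OF sub] C(1) by auto
      show "\<ominus> h \<in> \<Union>\<C>" if "h \<in> \<Union>\<C>" for h using subringE(5)[OF sub] that by auto
      show "h1 \<otimes> h2 \<in> \<Union>\<C>" "h1 \<oplus> h2 \<in> \<Union>\<C>" if "h1 \<in> \<Union>\<C>" "h2 \<in> \<Union>\<C>" for h1 h2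
        using two[OF that] subringE(6,7)[OF sub] by blast+
    qed
    have Jmono: "J S \<subseteq> J T" if "S \<subseteq> T" "T \<subseteq> carrier R" for S T
      unfolding J_def
    proof (rule add_span_least)
      show "{i \<otimes> s |i s. i \<in> I \<and> s \<in> S} \<subseteq> add_span {i \<otimes> s |i s. i \<in> I \<and> s \<in> T}"
        using JG[OF that(2)] that(1) unfolding J_def by auto
    qed (use J0 Ja[OF that(2)] in \<open>auto simp: J_def\<close>)
    have "J (\<Union>\<C>) \<subseteq> (\<Union>S\<in>\<C>. J S)"
      unfolding J_def[of "\<Union>\<C>"]
    proof (rule add_span_least)
      show "\<zero> \<in> (\<Union>S\<in>\<C>. J S)" using J0 C(1) by auto
      show "{i \<otimes> s |i s. i \<in> I \<and> s \<in> \<Union> \<C>} \<subseteq> \<Union> (J ` \<C>)"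
        using JG subringE(1)[OF sub] by blast
      fix x y assume "x \<in> \<Union> (J ` \<C>)" "y \<in> \<Union> (J ` \<C>)"
      then obtain S T where ST: "S \<in> \<C>" "x \<in> J S" "T \<in> \<C>" "y \<in> J T" by auto
      then obtain U where "U \<in> \<C>" "S \<subseteq> U" "T \<subseteq> U" using lin[of S T] by auto
      then have "x \<in> J U" "y \<in> J U" "U \<in> \<C>" "U \<subseteq> carrier R"
        using ST Jmono subringE(1)[OF sub] by blast+
      then show "x \<oplus> y \<in> \<Union> (J ` \<C>)" using Ja by blast
    qed
    then show "\<Union>\<C> \<in> \<A>" using CA C(1) subU unfolding \<A>_def by blast
  qed
  then obtain M where M: "M \<in> \<A>" "\<And>Y. Y \<in> \<A> \<Longrightarrow> M \<subseteq> Y \<Longrightarrow> Y = M" by auto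
  have subM: "subring M R" and RM: "R0 \<subseteq> M" and M1: "\<one> \<notin> J M"
    using M(1) unfolding \<A>_def by auto
  note Mc = subringE(1)[OF subM]
  note JMc = Jc[OF Mc] and JMa = Ja[OF Mc] and JMm = Jm[OF subM]
  \<comment> \<open>By maximality the extended ideal of the ring obtained by adjoining
    \<open>x\<close> contains 1, and its elements are polynomials in \<open>x\<close> with
    coefficients in \<open>J M\<close>.\<close>
  have adjoin: "\<exists>n. \<one> \<in> poly_values (J M) x n" if x: "x \<in> carrier R" "x \<notin> M" for x
  proof -
    let ?S = "\<Union>n. poly_values M x n"
    have S: "subring ?S R" by (rule poly_values_subring[OF subM x(1)])
    have "?S \<notin> \<A>" using M(2)[of ?S] poly_values_contains[OF subM x(1)] x(2) by auto
    then have "\<one> \<in> J ?S" using S RM poly_values_contains[OF subM x(1)] unfolding \<A>_def by auto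
    moreover have "J ?S \<subseteq> (\<Union>n. poly_values (J M) x n)"
      unfolding J_def[of ?S]
    proof (rule add_span_least)
      show "\<zero> \<in> (\<Union>n. poly_values (J M) x n)"
        using poly_values_zero[OF J0 JMc x(1)] by blast
      show "{i \<otimes> s |i s. i \<in> I \<and> s \<in> ?S} \<subseteq> (\<Union>n. poly_values (J M) x n)"
        using poly_values_cmult[OF Mc x(1) _ JG[OF Mc]] Ic by blast
      fix p q assume "p \<in> (\<Union>n. poly_values (J M) x n)" "q \<in> (\<Union>n. poly_values (J M) x n)"
      then obtain n m where nm: "p \<in> poly_values (J M) x n" "q \<in> poly_values (J M) x m" by auto
      have "p \<in> poly_values (J M) x (max n m)" "q \<in> poly_values (J M) x (max n m)"
        using nm poly_values_mono[OF J0 JMc x(1), of n "max n m"]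
          poly_values_mono[OF J0 JMc x(1), of m "max n m"] by auto
      then show "p \<oplus> q \<in> (\<Union>n. poly_values (J M) x n)"
        using poly_values_add[OF JMc x(1) JMa] by blast
    qed
    ultimately show ?thesis by auto
  qed
  have Jneg: "\<ominus> j \<in> J M" if "j \<in> J M" for j
    using JMm[of "\<ominus> \<one>" j] subringE(3,5)[OF subM] that JMc by (auto simp: l_minus)
  have IJ: "I \<subseteq> J M" using JG[OF Mc _ subringE(3)[OF subM]] Ic by fastforce
  have JM: "J M \<subseteq> M"
    unfolding J_def
    by (rule add_span_least) (use subringE(2,6,7)[OF subM] I(1) RM in blast)+
  \<comment> \<open>If the inverse of \<open>\<one> \<ominus> j\<close> were missing from
    \<open>M\<close>, clearing denominators in the relation from \<open>adjoin\<close> would put a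
    power of \<open>\<one> \<ominus> j\<close> into \<open>J M\<close>. That power is congruent to 1
    modulo \<open>J M\<close>, so 1 would lie there as well.\<close>
  have unit: "\<one> \<ominus> j \<noteq> \<zero>" "inv (\<one> \<ominus> j) \<in> M" if j: "j \<in> J M" for j
  proof -
    let ?s = "\<one> \<ominus> j"
    have jc: "j \<in> carrier R" using j JMc by auto
    show s0: "?s \<noteq> \<zero>" using M1 j jc by auto
    have sc: "?s \<in> carrier R" using jc by auto
    have sM: "?s \<in> M"
      using subringE(3,5,7)[OF subM] JM j unfolding a_minus_def by blast
    note s' = nonzero_inv[OF sc s0]
    show "inv ?s \<in> M"
    proof (rule ccontr)
      assume "inv ?s \<notin> M"
      then obtain n where "\<one> \<in> poly_values (J M) (inv ?s) n" using adjoin s' by blast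
      then have "?s [^] n \<otimes> \<one> \<in> J M"
        using poly_values_clear[OF JMc J0 JMa sc JMm[OF sM] s'(1,3), of \<one> n] by simp
      then have sJ: "?s [^] n \<in> J M" using sc by simp
      have "\<one> \<ominus> ?s [^] n \<in> J M"
      proof (induction n)
        case 0
        then show ?case using J0 by (simp add: a_minus_def r_neg)
      next
        case (Suc n)
        have "\<one> \<ominus> ?s [^] Suc n = (\<one> \<ominus> j) \<otimes> (\<one> \<ominus> ?s [^] n) \<oplus> j"
          using jc nat_pow_closed[OF sc, of n] by (simp, algebra)
        then show ?case using JMa JMm[OF sM Suc] j by simp
      qed
      then have "(\<one> \<ominus> ?s [^] n) \<oplus> ?s [^] n \<in> J M" using JMa sJ by blast
      moreover have "(\<one> \<ominus> ?s [^] n) \<oplus> ?s [^] n = \<one>"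
        using nat_pow_closed[OF sc, of n] by algebra
      ultimately show False using M1 by simp
    qed
  qed
  \<comment> \<open>In the relation for \<open>inv y\<close> the constant term \<open>j\<close> is
    moved to the left and the unit \<open>\<one> \<ominus> j\<close> is divided out. Reversing the
    rest expresses a power of \<open>y\<close> by lower ones with coefficients in
    \<open>J M\<close>; after multiplication by powers of \<open>y\<close> this replaces the leading
    term of the relation for \<open>y\<close>.\<close>
  have reduce: "\<exists>n'. n' < n \<and> \<one> \<in> poly_values (J M) y n'"
    if y: "y \<in> carrier R" "y \<noteq> \<zero>" and n: "\<one> \<in> poly_values (J M) y n"
      and m: "\<one> \<in> poly_values (J M) (inv y) m" and mn: "m \<le> n" for y n m
  proof -
    note y' = nonzero_inv[OF y]
    obtain m' where m': "m = Suc m'" using m by (cases m) auto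
    obtain n' where n': "n = Suc n'" using mn m' by (cases n) auto
    have mn': "m' \<le> n'" using mn m' n' by auto
    obtain j q where jq: "\<one> = j \<oplus> inv y \<otimes> q" "j \<in> J M" "q \<in> poly_values (J M) (inv y) m'"
      using m m' by auto
    let ?s = "\<one> \<ominus> j"
    let ?q = "inv ?s \<otimes> q"
    have c: "j \<in> carrier R" "q \<in> carrier R" using jq JMc poly_values_carrier[OF JMc y'(1), THEN subsetD] by auto
    have s: "inv ?s \<in> carrier R" "inv ?s \<in> M" "inv ?s \<otimes> ?s = \<one>"
      using unit[OF jq(2)] c nonzero_inv[of ?s] by auto
    have "?s = inv y \<otimes> q"
    proof -
      have "?s = (j \<oplus> inv y \<otimes> q) \<ominus> j" using jq(1) by simp
      then show ?thesis using c y'(1) by algebra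
    qed
    moreover have "inv y \<otimes> ?q = inv ?s \<otimes> (inv y \<otimes> q)"
      using s c y' by (intro m_lcomm) auto
    ultimately have q1: "inv y \<otimes> ?q = \<one>" using s by simp
    have "?q \<in> poly_values (J M) (inv y) m'"
      by (rule poly_values_cmult[OF JMc y'(1) s(1) JMm[OF s(2)] jq(3)])
    from poly_values_reverse[OF JMc J0 y(1) y'(1,3) this]
    have ym: "y [^] m' \<in> poly_values (J M) y m'" using q1 y by simp
    have yk: "y [^] k \<in> poly_values (J M) y k" if "m' \<le> k" for k
      using that
    proof (induction rule: dec_induct)
      case base
      then show ?case using ym .
    next
      case (step k)
      have "y \<otimes> y [^] k \<in> poly_values (J M) y (Suc k)"
        by (rule poly_values_shift[OF J0 JMc y(1) step.IH])
      then show ?case using y by (simp add: m_comm)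
    qed
    obtain p i where pi: "\<one> = p \<oplus> i \<otimes> y [^] n'" "p \<in> poly_values (J M) y n'" "i \<in> J M"
      using n unfolding n' poly_values_top[OF J0 JMc y(1), of n'] by blast
    have "i \<otimes> y [^] n' \<in> poly_values (J M) y n'"
      by (rule poly_values_cmult[OF JMc y(1) _ _ yk[OF mn']]) (use pi JM JMm JMc in auto)
    from poly_values_add[OF JMc y(1) JMa pi(2) this]
    have "\<one> \<in> poly_values (J M) y n'" by (subst pi(1))
    then show ?thesis using n' by blast
  qed
  have val: "x \<in> M \<or> inv x \<in> M" if x: "x \<in> carrier R - {\<zero>}" for x
  proof (rule ccontr)
    assume neg: "\<not> (x \<in> M \<or> inv x \<in> M)"
    have xc: "x \<in> carrier R" "x \<noteq> \<zero>" using x by auto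
    note x' = nonzero_inv[OF xc]
    let ?P = "\<lambda>y n. \<one> \<in> poly_values (J M) y n"
    have ex: "\<exists>n. ?P x n" "\<exists>n. ?P (inv x) n" using adjoin xc x' neg by auto
    \<comment> \<open>Shortest relations for \<open>x\<close> and for its inverse. The one with at
      least as many terms is shortened by \<open>reduce\<close>; in the second case
      \<open>reduce\<close> is applied to \<open>inv x\<close>, whose inverse is \<open>x\<close>
      again.\<close>
    define n m where "n = (LEAST n. ?P x n)" and "m = (LEAST n. ?P (inv x) n)"
    have nm: "?P x n" "?P (inv x) m"
      unfolding n_def m_def using ex by (auto intro: LeastI_ex)
    have least: "\<And>k. k < n \<Longrightarrow> \<not> ?P x k" "\<And>k. k < m \<Longrightarrow> \<not> ?P (inv x) k"
      unfolding n_def m_def by (auto dest: not_less_Least)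
    show False
    proof (cases "m \<le> n")
      case True
      then show ?thesis using reduce[OF xc nm] least(1) by blast
    next
      case False
      then have "n \<le> m" by simp
      moreover have "?P (inv (inv x)) n" using nm(1) x'(5) by simp
      ultimately show ?thesis using reduce[OF x'(1,2) nm(2)] least(2) by blast
    qed
  qed
  have "I \<subseteq> nonunits M"
  proof
    fix i assume i: "i \<in> I"
    have False if "i \<noteq> \<zero>" "inv i \<in> M"
      using JG[OF Mc i that(2)] nonzero_inv[of i] that i Ic M1 by auto
    then show "i \<in> nonunits M" using i I(1) RM unfolding nonunits_def by auto
  qed
  then show ?thesis
    using subM Mc val RM unfolding val_subring_def by blast
qed

end

section \<open>Valuation rings of subfields\<close>

lemma (in abelian_monoid) finsum_mem:
  assumes "\<zero> \<in> H" "H \<subseteq> carrier G" "\<And>x y. x \<in> H \<Longrightarrow> y \<in> H \<Longrightarrow> x \<oplus> y \<in> H" "\<And>i. i \<in> I \<Longrightarrow> f i \<in> H"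
  shows "finsum G f I \<in> H"
  using assms(4)
proof (induction I rule: infinite_finite_induct)
  case (insert i I)
  then have "f \<in> I \<rightarrow> carrier G" "f i \<in> carrier G" using assms(2) by auto
  then show ?case using insert assms(3) by auto
qed (use assms(1) in auto)

text \<open>The idealizer spares the computation of a base ring for Chevalley's theorem: once
  \<open>I\<close> is closed under products it lies in this ring and is an ideal of it, so only the
  elements that must be contained in the base ring have to be checked.\<close>

lemma (in ring) idealizer_subring:
  assumes I: "I \<subseteq> carrier R" "\<And>x y. x \<in> I \<Longrightarrow> y \<in> I \<Longrightarrow> x \<oplus> y \<in> I" "\<And>x. x \<in> I \<Longrightarrow> \<ominus> x \<in> I"
  shows "subring {r \<in> carrier R. \<forall>x\<in>I. r \<otimes> x \<in> I} R"
proof (rule subringI)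
  show "\<one> \<in> {r \<in> carrier R. \<forall>x\<in>I. r \<otimes> x \<in> I}" using I(1) by auto
  fix r assume r: "r \<in> {r \<in> carrier R. \<forall>x\<in>I. r \<otimes> x \<in> I}"
  then show "\<ominus> r \<in> {r \<in> carrier R. \<forall>x\<in>I. r \<otimes> x \<in> I}" using I by (auto simp: l_minus subset_iff)
  fix s assume s: "s \<in> {r \<in> carrier R. \<forall>x\<in>I. r \<otimes> x \<in> I}"
  show "r \<otimes> s \<in> {r \<in> carrier R. \<forall>x\<in>I. r \<otimes> x \<in> I}"
    using r s I by (auto simp: m_assoc subset_iff)
  show "r \<oplus> s \<in> {r \<in> carrier R. \<forall>x\<in>I. r \<otimes> x \<in> I}"
    using r s I by (auto simp: l_distr subset_iff)
qed auto

lemma (in ring) nat_pow_mem: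
  assumes "subring S R" "x \<in> S" shows "x [^] (n::nat) \<in> S"
  using assms by (induction n) (auto intro: subringE(3,6))

lemma (in ring) eval_mem:
  assumes S: "subring S R"
  shows "set l \<subseteq> S \<Longrightarrow> x \<in> S \<Longrightarrow> eval l x \<in> S"
proof (induction l)
  case Nil
  then show ?case using subringE(2)[OF S] by simp
next
  case (Cons c l)
  moreover have "x [^] n \<in> S" for n :: nat
    using nat_pow_mem[OF S] Cons.prems by auto
  ultimately show ?case by (auto intro!: subringE(6,7)[OF S])
qed

context cring
begin

text \<open>Passage to coefficient lists, where the leading coefficient comes first; the constant
  term split off by the Horner recursion is therefore appended at the end.\<close>

lemma poly_values_eval:
  assumes "A \<subseteq> carrier R" "x \<in> carrier R"
  shows "p \<in> poly_values A x n \<Longrightarrow> \<exists>l. set l \<subseteq> A \<and> eval l x = p"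
proof (induction n arbitrary: p)
  case 0
  then show ?case by (intro exI[of _ "[]"]) simp
next
  case (Suc n)
  then obtain a p' where p: "p = a \<oplus> x \<otimes> p'" "a \<in> A" "p' \<in> poly_values A x n" by auto
  then obtain l where l: "set l \<subseteq> A" "eval l x = p'" using Suc.IH by blast
  have "p' \<in> carrier R" "a \<in> carrier R"
    using p poly_values_carrier[OF assms, THEN subsetD] assms by auto
  then have "eval (l @ [a]) x = p"
    using eval_append_aux[of l a x] l p assms by (auto simp: m_comm a_comm)
  then show ?case using l p by (intro exI[of _ "l @ [a]"]) auto
qed

text \<open>The coefficients of the quotient are the partial Horner values at
  \<open>\<alpha>\<close>, hence they stay in \<open>S\<close>. The leading coefficient is recorded
  because a quotient of a monic polynomial has to be recognised as monic.\<close>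

lemma synthetic_division:
  assumes S: "subring S R" "\<alpha> \<in> S" "a \<in> S"
  shows "set p \<subseteq> S \<Longrightarrow> \<exists>q. set q \<subseteq> S \<and> length q = length p \<and> (p \<noteq> [] \<longrightarrow> hd q = a) \<and>
    (\<forall>t\<in>carrier R. eval (a # p) t \<ominus> eval (a # p) \<alpha> = (t \<ominus> \<alpha>) \<otimes> eval q t)"
proof (induction p rule: rev_induct)
  case Nil
  have "a \<in> carrier R" "\<alpha> \<in> carrier R" using S subringE(1) by auto
  then show ?case by (intro exI[of _ "[]"]) (auto simp: a_minus_def r_neg)
next
  case (snoc b p)
  note Sc = subringE(1)[OF S(1)]
  from snoc obtain q where q: "set q \<subseteq> S" "length q = length p" "p \<noteq> [] \<longrightarrow> hd q = a"
    "\<And>t. t \<in> carrier R \<Longrightarrow> eval (a # p) t \<ominus> eval (a # p) \<alpha> = (t \<ominus> \<alpha>) \<otimes> eval q t" by auto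
  let ?e = "eval (a # p) \<alpha>"
  have eS: "?e \<in> S" using eval_mem[OF S(1), of "a # p" \<alpha>] snoc.prems S by auto
  have c: "set (a # p) \<subseteq> carrier R" "set q \<subseteq> carrier R" "b \<in> carrier R" "\<alpha> \<in> carrier R" "?e \<in> carrier R"
    using Sc snoc.prems q S eS by auto
  show ?case
  proof (intro exI[of _ "q @ [?e]"] conjI ballI impI)
    show "set (q @ [?e]) \<subseteq> S" using q eS by auto
    show "length (q @ [?e]) = length (p @ [b])" using q by simp
    show "hd (q @ [?e]) = a"
    proof (cases "p = []")
      case True
      then show ?thesis using q c by auto
    next
      case False
      then have "q \<noteq> []" using q by auto
      then show ?thesis using q False by auto
    qed
    fix t assume t: "t \<in> carrier R"
    have ev: "eval (a # p) t \<in> carrier R" "eval q t \<in> carrier R" using c t eval_in_carrier by blast+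
    have "eval (a # p @ [b]) t \<ominus> eval (a # p @ [b]) \<alpha> =
        (eval (a # p) t \<otimes> t \<oplus> b) \<ominus> (?e \<otimes> \<alpha> \<oplus> b)"
      using eval_append_aux[OF c(1,3) t] eval_append_aux[OF c(1,3,4)]
      by (simp del: eval.simps)
    also have "\<dots> = (eval (a # p) t \<ominus> ?e) \<otimes> t \<oplus> ?e \<otimes> (t \<ominus> \<alpha>)"
      using ev(1) c(3-5) t by algebra
    also have "\<dots> = (t \<ominus> \<alpha>) \<otimes> (eval q t \<otimes> t \<oplus> ?e)"
      unfolding q(4)[OF t] using ev c(3-5) t by algebra
    also have "\<dots> = (t \<ominus> \<alpha>) \<otimes> eval (q @ [?e]) t"
      using eval_append_aux[OF c(2,5) t] by (simp del: eval.simps)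
    finally show "eval (a # p @ [b]) t \<ominus> eval (a # p @ [b]) \<alpha> = (t \<ominus> \<alpha>) \<otimes> eval (q @ [?e]) t" .
  qed
qed

lemma eval_smult:
  assumes "set p \<subseteq> carrier R" "c \<in> carrier R" "x \<in> carrier R"
  shows "eval (map ((\<otimes>) c) p) x = c \<otimes> eval p x"
  using assms by (induction p) (auto simp: eval_in_carrier r_distr m_assoc)

end

context field
begin

lemma val_subringD:
  assumes "val_subring k V"
  shows "subring V R" "V \<subseteq> k" "\<And>x. x \<in> k \<Longrightarrow> x \<noteq> \<zero> \<Longrightarrow> x \<in> V \<or> inv x \<in> V" "V \<subseteq> carrier R"
  using assms subringE(1) unfolding val_subring_def by auto

lemma nonunits_zero: "subring V R \<Longrightarrow> \<zero> \<in> nonunits V"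
  unfolding nonunits_def using subringE(2) by auto

lemma one_not_nonunit: "subring V R \<Longrightarrow> \<one> \<notin> nonunits V"
  unfolding nonunits_def using subringE(3) by auto

lemma nonunits_subset: "x \<in> nonunits V \<Longrightarrow> x \<in> V"
  unfolding nonunits_def by auto

lemma unitD:
  assumes "x \<in> V" "x \<notin> nonunits V"
  shows "x \<noteq> \<zero>" "inv x \<in> V"
  using assms unfolding nonunits_def by auto

lemma nonunits_mult:
  assumes V: "subring V R" and a: "a \<in> V" and b: "b \<in> nonunits V"
  shows "a \<otimes> b \<in> nonunits V"
proof (rule ccontr)
  assume neg: "a \<otimes> b \<notin> nonunits V"
  have bV: "b \<in> V" using b nonunits_subset by auto
  have ab: "a \<otimes> b \<in> V" using subringE(6)[OF V a bV] .
  note u = unitD[OF ab neg]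
  have c: "a \<in> carrier R" "b \<in> carrier R" using a bV subringE(1)[OF V] by auto
  then have b0: "b \<noteq> \<zero>" using u(1) by auto
  have abc: "a \<otimes> b \<in> carrier R" using c by auto
  note i = nonzero_inv[OF c(2) b0] nonzero_inv[OF abc u(1)]
  have "inv b = inv b \<otimes> ((a \<otimes> b) \<otimes> inv (a \<otimes> b))" using i by simp
  also have "\<dots> = (inv b \<otimes> b) \<otimes> (a \<otimes> inv (a \<otimes> b))"
    using i(1,6) c by (simp add: m_ac)
  also have "\<dots> = a \<otimes> inv (a \<otimes> b)" using i c by simp
  finally have "inv b \<in> V" using subringE(6)[OF V a u(2)] by simp
  then show False using b b0 unfolding nonunits_def by auto
qed

lemma nonunits_uminus:
  assumes V: "subring V R" and b: "b \<in> nonunits V"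
  shows "\<ominus> b \<in> nonunits V"
proof -
  have "(\<ominus> \<one>) \<otimes> b \<in> nonunits V"
    using nonunits_mult[OF V _ b] subringE(3,5)[OF V] by auto
  then show ?thesis using b nonunits_subset subringE(1)[OF V] by (auto simp: l_minus subset_iff)
qed

lemma inv_divide:
  assumes "a \<in> carrier R" "b \<in> carrier R" "a \<noteq> \<zero>" "b \<noteq> \<zero>"
  shows "inv (inv a \<otimes> b) = inv b \<otimes> a" "inv a \<otimes> b \<noteq> \<zero>"
proof -
  note ia = nonzero_inv[OF assms(1,3)] and ib = nonzero_inv[OF assms(2,4)]
  have "(inv a \<otimes> b) \<otimes> (inv b \<otimes> a) = (inv a \<otimes> a) \<otimes> (b \<otimes> inv b)"
    using ia(1) ib(1) assms(1,2) by (simp add: m_ac)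
  then have 1: "(inv a \<otimes> b) \<otimes> (inv b \<otimes> a) = \<one>" using ia ib by simp
  then show "inv (inv a \<otimes> b) = inv b \<otimes> a"
    using ia(1) ib(1) assms(1,2) by (intro comm_inv_char) auto
  show "inv a \<otimes> b \<noteq> \<zero>" using 1 ib(1) assms(1) by auto
qed

lemma divide_mem:
  assumes "subfield k R" "a \<in> k" "b \<in> k" "a \<noteq> \<zero>"
  shows "inv a \<otimes> b \<in> k"
  using subfield_m_inv(1)[OF assms(1), of a] assms subringE(6)[OF subfieldE(1)[OF assms(1)]] by auto

text \<open>This is where the valuation property enters: of two nonzero elements one divides the
  other in \<open>V\<close>, and the divisor can be factored out of the sum.\<close>

lemma nonunits_add:
  assumes V: "val_subring k V" and k: "subfield k R" and a: "a \<in> nonunits V" and b: "b \<in> nonunits V"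
  shows "a \<oplus> b \<in> nonunits V"
proof -
  note Vs = val_subringD[OF V]
  have c: "a \<in> carrier R" "b \<in> carrier R" "a \<in> k" "b \<in> k"
    using a b nonunits_subset Vs by auto
  have *: "x \<oplus> y \<in> nonunits V"
    if xy: "x \<in> nonunits V" "y \<in> nonunits V" "y \<noteq> \<zero>" "inv y \<otimes> x \<in> V" for x y
  proof -
    have c: "x \<in> carrier R" "y \<in> carrier R" "y \<in> V" using xy nonunits_subset Vs by auto
    note i = nonzero_inv[OF c(2) xy(3)]
    have "x \<oplus> y = ((inv y \<otimes> y) \<otimes> x) \<oplus> y" using i c by simp
    also have "\<dots> = (inv y \<otimes> x \<oplus> \<one>) \<otimes> y" using i(1) c(1,2) by algebra
    finally show ?thesis
      using nonunits_mult[OF Vs(1) _ xy(2)] subringE(7)[OF Vs(1) xy(4) subringE(3)[OF Vs(1)]] by simp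
  qed
  show ?thesis
  proof (cases "a = \<zero> \<or> b = \<zero>")
    case True
    then show ?thesis using a b c by auto
  next
    case False
    then have "inv b \<otimes> a \<in> V \<or> inv a \<otimes> b \<in> V"
      using Vs(3)[OF divide_mem[OF k c(4,3)]] inv_divide[OF c(2,1)] by auto
    then show ?thesis
      using *[OF a b] *[OF b a] False c by (auto simp: a_comm)
  qed
qed

lemma inv_in_nonunits:
  assumes "val_subring k V" "subfield k R" "x \<in> k" "x \<notin> V"
  shows "x \<noteq> \<zero>" "inv x \<in> nonunits V"
proof -
  note Vs = val_subringD[OF assms(1)]
  show x0: "x \<noteq> \<zero>" using assms(4) subringE(2)[OF Vs(1)] by auto
  have "x \<in> carrier R" using assms subfieldE(3) by auto
  then show "inv x \<in> nonunits V"
    using Vs(3)[OF assms(3) x0] assms(4) nonzero_inv[OF _ x0] unfolding nonunits_def by auto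
qed

text \<open>A nonunit of \<open>W\<close> lies in \<open>V\<close>, since otherwise its inverse
  would lie in \<open>V\<close> and so in \<open>W\<close>.\<close>

lemma nonunits_antimono:
  assumes V: "val_subring k V" and W: "V \<subseteq> W" "W \<subseteq> k"
  shows "nonunits W \<subseteq> nonunits V"
proof
  fix x assume "x \<in> nonunits W"
  then have x: "x \<in> k" "x = \<zero> \<or> inv x \<notin> V" using W unfolding nonunits_def by auto
  then have "x \<in> V" using val_subringD(3)[OF V x(1)] subringE(2)[OF val_subringD(1)[OF V]] by auto
  then show "x \<in> nonunits V" using x unfolding nonunits_def by auto
qed

lemma nonunits_inter:
  assumes "subfield k R"
  shows "nonunits (V \<inter> k) = nonunits V \<inter> k"
  using subfield_m_inv(1)[OF assms] unfolding nonunits_def by auto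

lemma val_subring_inter:
  assumes "val_subring k V" "subfield k' R" "k' \<subseteq> k"
  shows "val_subring k' (V \<inter> k')"
  using val_subringD[OF assms(1)] assms(3) subring_inter[OF _ subfieldE(1)[OF assms(2)], of V]
    subfield_m_inv(1)[OF assms(2)] unfolding val_subring_def by auto

lemma units_mult:
  assumes V: "subring V R" and "x \<in> V" "x \<notin> nonunits V" "y \<in> V" "y \<notin> nonunits V"
  shows "x \<otimes> y \<in> V" "x \<otimes> y \<notin> nonunits V"
proof -
  show xy: "x \<otimes> y \<in> V" using subringE(6)[OF V] assms by auto
  have c: "x \<in> carrier R" "y \<in> carrier R" using assms subringE(1)[OF V] by auto
  note u = unitD[OF assms(2,3)]
  show "x \<otimes> y \<notin> nonunits V"
  proof
    assume "x \<otimes> y \<in> nonunits V"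
    then have "inv x \<otimes> (x \<otimes> y) \<in> nonunits V" by (rule nonunits_mult[OF V u(2)])
    moreover have "inv x \<otimes> (x \<otimes> y) = y"
      using c nonzero_inv[OF c(1) u(1)] by (simp add: m_assoc[symmetric])
    ultimately show False using assms(5) by simp
  qed
qed

lemma inv_unit:
  assumes V: "subring V R" and x: "x \<in> V" "x \<notin> nonunits V"
  shows "inv x \<in> V" "inv x \<notin> nonunits V"
  using unitD[OF x] x nonzero_inv[of x] subringE(1)[OF V] unfolding nonunits_def by auto

text \<open>Divisibility in \<open>V\<close> is a total preorder on the nonzero elements of
  \<open>k\<close>, so a finite family has a member of least value. Dividing by it moves the whole
  family into \<open>V\<close> and turns one member into 1.\<close>

lemma exists_dominant:
  assumes V: "val_subring k V" and k: "subfield k R"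
    and "finite I" "\<And>i. i \<in> I \<Longrightarrow> a i \<in> k" "i0 \<in> I" "a i0 \<noteq> \<zero>"
  shows "\<exists>j\<in>I. a j \<noteq> \<zero> \<and> (\<forall>i\<in>I. inv (a j) \<otimes> a i \<in> V)"
proof -
  note Vs = val_subringD[OF V]
  note kc = subfieldE(3)[OF k]
  have V1: "inv x \<otimes> x \<in> V" if "x \<in> k" "x \<noteq> \<zero>" for x
    using that kc nonzero_inv[of x] subringE(3)[OF Vs(1)] by auto
  have V0: "x \<otimes> \<zero> \<in> V" if "x \<in> carrier R" for x using that subringE(2)[OF Vs(1)] by simp
  show ?thesis
    using assms(3-6)
  proof (induction I arbitrary: i0 rule: finite_induct)
    case empty
    then show ?case by simp
  next
    case (insert l I)
    show ?case
    proof (cases "\<exists>i\<in>I. a i \<noteq> \<zero>")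
      case False
      then have "i0 = l" using insert.prems by auto
      then show ?thesis
        using False insert.prems(1-3) subringE(2)[OF Vs(1)] V1[of "a l"] nonzero_inv(1)[of "a l"] kc
        by (intro bexI[of _ l]) (auto simp: subset_iff)
    next
      case True
      then obtain i1 where "i1 \<in> I" "a i1 \<noteq> \<zero>" by auto
      then obtain j where j: "j \<in> I" "a j \<noteq> \<zero>" "\<And>i. i \<in> I \<Longrightarrow> inv (a j) \<otimes> a i \<in> V"
        using insert.IH[of i1] insert.prems by auto
      have jk: "a j \<in> k" "a l \<in> k" using insert.prems j by auto
      have jc: "a j \<in> carrier R" "a l \<in> carrier R" using jk kc by auto
      note ij = nonzero_inv[OF jc(1) j(2)]
      show ?thesis
      proof (cases "inv (a j) \<otimes> a l \<in> V")
        case True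
        then show ?thesis using j by auto
      next
        case F: False
        then have l0: "a l \<noteq> \<zero>" using V0 ij by auto
        note il = nonzero_inv[OF jc(2) l0]
        have lj: "inv (a l) \<otimes> a j \<in> V"
          using Vs(3)[OF divide_mem[OF k jk j(2)]] F inv_divide[OF jc j(2) l0] by auto
        have "inv (a l) \<otimes> a i \<in> V" if "i \<in> I" for i
        proof -
          have ic: "a i \<in> carrier R" using insert.prems that kc by auto
          have "inv (a l) \<otimes> a i = (a j \<otimes> inv (a j)) \<otimes> (inv (a l) \<otimes> a i)"
            using ij il ic by simp
          also have "\<dots> = (inv (a l) \<otimes> a j) \<otimes> (inv (a j) \<otimes> a i)"
            using ij(1) il(1) jc ic by (simp add: m_ac)
          finally show ?thesis using subringE(6)[OF Vs(1) lj j(3)[OF that]] by simp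
        qed
        then show ?thesis using l0 V1[OF jk(2)] by auto
      qed
    qed
  qed
qed

text \<open>Algebraic closedness of a subfield, phrased by evaluation in the ambient ring so that
  \<open>k\<close> need not become a structure of its own. Coefficient lists start with the leading
  coefficient; a nonempty \<open>p\<close> means positive degree.\<close>

definition root_closed :: "'a set \<Rightarrow> bool"
  where "root_closed k \<longleftrightarrow> (\<forall>p. p \<noteq> [] \<and> set p \<subseteq> k \<longrightarrow> (\<exists>\<alpha>\<in>k. eval (\<one> # p) \<alpha> = \<zero>))"

lemma val_subring_integrally_closed:
  assumes V: "val_subring k V" and k: "subfield k R"
    and p: "set p \<subseteq> V" and \<alpha>: "\<alpha> \<in> k" "eval (\<one> # p) \<alpha> = \<zero>"
  shows "\<alpha> \<in> V"
proof (rule ccontr)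
  note Vs = val_subringD[OF V]
  assume neg: "\<alpha> \<notin> V"
  note b = inv_in_nonunits[OF V k \<alpha>(1) neg]
  let ?b = "inv \<alpha>"
  have ac: "\<alpha> \<in> carrier R" using \<alpha> subfieldE(3)[OF k] by auto
  note i = nonzero_inv[OF ac b(1)]
  have pw: "?b [^] n \<otimes> \<alpha> [^] n = \<one>" for n :: nat
    using i ac by (simp add: nat_pow_distrib[symmetric])
  \<comment> \<open>A coefficient \<open>c\<close> at \<open>\<alpha> [^] i\<close> with
    \<open>i\<close> less than the length of the list becomes \<open>c\<close> times a positive
    power of the nonunit \<open>inv \<alpha>\<close>. Applied to the lower terms of the monic
    equation this puts 1 among the nonunits.\<close>
  have key: "?b [^] length l \<otimes> eval l \<alpha> \<in> nonunits V" if "set l \<subseteq> V" for l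
    using that
  proof (induction l)
    case Nil
    then show ?case using nonunits_zero[OF Vs(1)] i by simp
  next
    case (Cons c l)
    let ?n = "length l"
    have cc: "c \<in> carrier R" "eval l \<alpha> \<in> carrier R" "?b [^] ?n \<in> carrier R" "\<alpha> [^] ?n \<in> carrier R"
      using Cons.prems Vs(4) ac eval_in_carrier[of l \<alpha>] i by auto
    have "?b [^] length (c # l) \<otimes> eval (c # l) \<alpha>
        = ?b [^] ?n \<otimes> ?b \<otimes> (c \<otimes> \<alpha> [^] ?n \<oplus> eval l \<alpha>)" by simp
    also have "\<dots> = (?b [^] ?n \<otimes> \<alpha> [^] ?n) \<otimes> (c \<otimes> ?b) \<oplus> ?b \<otimes> (?b [^] ?n \<otimes> eval l \<alpha>)"
      using cc i(1) by algebra
    also have "\<dots> = c \<otimes> ?b \<oplus> ?b \<otimes> (?b [^] ?n \<otimes> eval l \<alpha>)" using pw cc i by simp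
    moreover have "c \<otimes> ?b \<in> nonunits V" "?b \<otimes> (?b [^] ?n \<otimes> eval l \<alpha>) \<in> nonunits V"
      using nonunits_mult[OF Vs(1)] Cons b(2) nonunits_subset by auto
    ultimately show ?case using nonunits_add[OF V k] by simp
  qed
  have c: "eval p \<alpha> \<in> carrier R" "?b [^] length p \<in> carrier R" "\<alpha> [^] length p \<in> carrier R"
    using p Vs(4) ac eval_in_carrier[of p \<alpha>] i by auto
  have "\<one> = ?b [^] length p \<otimes> \<alpha> [^] length p" using pw by simp
  also have "\<dots> = ?b [^] length p \<otimes> (eval (\<one> # p) \<alpha> \<ominus> eval p \<alpha>)"
    using c by (simp, algebra)
  also have "\<dots> = \<ominus> (?b [^] length p \<otimes> eval p \<alpha>)"
    unfolding \<alpha>(2) using c by algebra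
  finally have "\<one> \<in> nonunits V" using nonunits_uminus[OF Vs(1) key[OF p]] by simp
  then show False using one_not_nonunit[OF Vs(1)] by simp
qed

text \<open>The residue of \<open>t\<close> is algebraic over the residue field of
  \<open>k0\<close>, hence lies in it. A leading coefficient without residue is dropped; otherwise
  the polynomial is made monic, a root \<open>\<alpha>\<close> in \<open>k0\<close> is taken, which
  is integral and so lies in \<open>U\<close>, and either \<open>\<alpha>\<close> has the residue of
  \<open>t\<close> or the quotient by the linear factor vanishes at that residue.\<close>

lemma root_mod_nonunits:
  assumes k0: "subfield k0 R" "root_closed k0" and k1: "subfield k1 R" "k0 \<subseteq> k1"
    and U: "val_subring k1 U" and t: "t \<in> U"
  shows "set f \<subseteq> U \<inter> k0 \<Longrightarrow> \<exists>c\<in>set f. c \<notin> nonunits U \<Longrightarrow> eval f t \<in> nonunits U \<Longrightarrow>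
    \<exists>c\<in>U \<inter> k0. t \<ominus> c \<in> nonunits U"
proof (induction "length f" arbitrary: f rule: less_induct)
  case less
  note Us = val_subringD[OF U]
  have V0: "val_subring k0 (U \<inter> k0)" by (rule val_subring_inter[OF U k0(1) k1(2)])
  note V0s = val_subringD[OF V0]
  have tc: "t \<in> carrier R" using t Us by auto
  obtain h g where f: "f = h # g" using less.prems(2) by (cases f) auto
  have hg: "h \<in> U" "h \<in> k0" "set g \<subseteq> U \<inter> k0" using less.prems f by auto
  have c: "h \<in> carrier R" "set g \<subseteq> carrier R" using hg Us by auto
  have tn: "t [^] length g \<in> U" by (rule nat_pow_mem[OF Us(1) t])
  show ?case
  proof (cases "h \<in> nonunits U")
    case True
    have gc: "eval g t \<in> carrier R" "t [^] length g \<in> carrier R" using c tc eval_in_carrier by auto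
    have "h \<otimes> t [^] length g \<in> nonunits U"
      using nonunits_mult[OF Us(1) tn True] c gc by (simp add: m_comm)
    then have "eval f t \<oplus> \<ominus> (h \<otimes> t [^] length g) \<in> nonunits U"
      using nonunits_add[OF U k1(1) less.prems(3)] nonunits_uminus[OF Us(1)] by blast
    moreover have "eval f t \<oplus> \<ominus> (h \<otimes> t [^] length g) = eval g t"
      unfolding f using gc c by (simp, algebra)
    ultimately have "eval g t \<in> nonunits U" by simp
    then show ?thesis using less.hyps[of g] less.prems(2) f hg True by auto
  next
    case False
    note hu = unitD[OF hg(1) False]
    have h': "inv h \<in> U \<inter> k0" using hu subfield_m_inv(1)[OF k0(1), of h] hg by auto
    let ?g = "map ((\<otimes>) (inv h)) g"
    have sg: "set ?g \<subseteq> U \<inter> k0"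
      using hg h' subringE(6)[OF V0s(1)] by auto
    have "map ((\<otimes>) (inv h)) f = \<one> # ?g" using f nonzero_inv[OF c(1) hu(1)] by simp
    then have ev: "eval (\<one> # ?g) t = inv h \<otimes> eval f t"
      using eval_smult[of f "inv h" t] c f tc h' Us by auto
    have evn: "eval (\<one> # ?g) t \<in> nonunits U"
      unfolding ev using nonunits_mult[OF Us(1) hu(2) less.prems(3)] .
    have g0: "g \<noteq> []" using evn one_not_nonunit[OF Us(1)] by auto
    then obtain \<alpha> where \<alpha>: "\<alpha> \<in> k0" "eval (\<one> # ?g) \<alpha> = \<zero>"
      using k0(2) sg unfolding root_closed_def
      by (metis (no_types, lifting) Int_subset_iff map_is_Nil_conv)
    have \<alpha>V: "\<alpha> \<in> U \<inter> k0" by (rule val_subring_integrally_closed[OF V0 k0(1) sg \<alpha>])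
    obtain q where q: "set q \<subseteq> U \<inter> k0" "length q = length ?g" "hd q = \<one>"
      "eval (\<one> # ?g) t \<ominus> eval (\<one> # ?g) \<alpha> = (t \<ominus> \<alpha>) \<otimes> eval q t"
      using synthetic_division[OF V0s(1) \<alpha>V subringE(3)[OF V0s(1)] sg] g0 tc by auto
    have qt: "eval q t \<in> U" using eval_mem[OF Us(1) _ t] q by auto
    have ta: "t \<ominus> \<alpha> \<in> U"
      using t \<alpha>V subringE(5,7)[OF Us(1)] unfolding a_minus_def by auto
    have "eval (\<one> # ?g) t = (t \<ominus> \<alpha>) \<otimes> eval q t"
      using q(4) \<alpha>(2) nonunits_subset evn Us by (auto simp: a_minus_def subset_iff)
    then have "(t \<ominus> \<alpha>) \<otimes> eval q t \<in> nonunits U" using evn by simp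
    then have "t \<ominus> \<alpha> \<in> nonunits U \<or> eval q t \<in> nonunits U"
      using units_mult(2)[OF Us(1) ta _ qt] by blast
    \<comment> \<open>The quotient is monic, so its reduction is again a nonzero polynomial.\<close>
    moreover have "\<exists>c\<in>set q. c \<notin> nonunits U"
      using q g0 one_not_nonunit[OF Us(1)] by (metis hd_in_set length_0_conv map_is_Nil_conv)
    ultimately show ?thesis
      using less.hyps[of q] q \<alpha>V f by auto
  qed
qed

end

section \<open>Rational refinements and residual disjointness\<close>

context field
begin

lemma rational_refinement:
  assumes k0: "subfield k0 R" "root_closed k0" and k1: "subfield k1 R" "k0 \<subseteq> k1"
    and V: "val_subring k1 V"
  shows "\<exists>U. val_subring k1 U \<and> U \<subseteq> V \<and> U \<inter> k0 = V \<inter> k0 \<and>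
    (\<forall>x\<in>U. \<exists>c\<in>U \<inter> k0. x \<ominus> c \<in> nonunits U)"
proof -
  define \<A> where "\<A> = {U. val_subring k1 U \<and> U \<subseteq> V \<and> V \<inter> k0 \<subseteq> U}"
  \<comment> \<open>Zorn's lemma is applied to complements, because a minimal ring is
    wanted.\<close>
  have "\<exists>M\<in>uminus ` \<A>. \<forall>Y\<in>uminus ` \<A>. M \<subseteq> Y \<longrightarrow> Y = M"
  proof (rule subset_Zorn_nonempty)
    show "uminus ` \<A> \<noteq> {}" using V unfolding \<A>_def by auto
    fix \<C> assume C: "\<C> \<noteq> {}" "subset.chain (uminus ` \<A>) \<C>"
    define \<D> where "\<D> = uminus ` \<C>"
    have D: "\<D> \<noteq> {}" "\<And>U. U \<in> \<D> \<Longrightarrow> U \<in> \<A>"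
      using C unfolding \<D>_def subset.chain_def by auto
    have lin: "S \<subseteq> T \<or> T \<subseteq> S" if "S \<in> \<D>" "T \<in> \<D>" for S T
    proof -
      have "-S \<in> \<C>" "-T \<in> \<C>" using that unfolding \<D>_def by auto
      then have "-S \<subseteq> -T \<or> -T \<subseteq> -S" using C(2) unfolding subset.chain_def by blast
      then show ?thesis by auto
    qed
    have val: "val_subring k1 S" if "S \<in> \<D>" for S using D(2)[OF that] unfolding \<A>_def by auto
    have "subring (\<Inter>\<D>) R" using subring_Inter D(1) val_subringD(1)[OF val] by blast
    moreover have "\<Inter>\<D> \<subseteq> k1" using D(1) val_subringD(2)[OF val] by blast
    \<comment> \<open>Were \<open>x\<close> missing from one member of the chain and its inverse
      from another, the smaller of the two would contain neither.\<close>
    moreover have "x \<in> \<Inter>\<D> \<or> inv x \<in> \<Inter>\<D>" if x: "x \<in> k1" "x \<noteq> \<zero>" for x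
    proof (rule ccontr)
      assume "\<not> ?thesis"
      then obtain S T where ST: "S \<in> \<D>" "x \<notin> S" "T \<in> \<D>" "inv x \<notin> T" by auto
      then have "inv x \<in> S" "x \<in> T" using val_subringD(3)[OF val x] by blast+
      then show False using lin[OF ST(1,3)] ST by auto
    qed
    ultimately have "val_subring k1 (\<Inter>\<D>)" unfolding val_subring_def by auto
    moreover have "\<Inter>\<D> \<subseteq> V" "V \<inter> k0 \<subseteq> \<Inter>\<D>" using D unfolding \<A>_def by auto
    ultimately have "\<Inter>\<D> \<in> \<A>" unfolding \<A>_def by auto
    moreover have "\<Union>\<C> = - \<Inter>\<D>" unfolding \<D>_def by auto
    ultimately show "\<Union>\<C> \<in> uminus ` \<A>" by auto
  qed
  then obtain U where UA: "U \<in> \<A>" and min: "\<And>W. W \<in> \<A> \<Longrightarrow> W \<subseteq> U \<Longrightarrow> W = U" by auto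
  have U: "val_subring k1 U" "U \<subseteq> V" "V \<inter> k0 \<subseteq> U" using UA unfolding \<A>_def by auto
  note Us = val_subringD[OF U(1)]
  have UV: "U \<inter> k0 = V \<inter> k0" using U by auto
  have V0: "val_subring k0 (U \<inter> k0)" by (rule val_subring_inter[OF U(1) k0(1) k1(2)])
  note V0s = val_subringD[OF V0]
  have "\<exists>c\<in>U \<inter> k0. t \<ominus> c \<in> nonunits U" if t: "t \<in> U" for t
  proof (rule ccontr)
    assume neg: "\<not> (\<exists>c\<in>U \<inter> k0. t \<ominus> c \<in> nonunits U)"
    have tc: "t \<in> carrier R" using t Us by auto
    define P where "P = (\<Union>n. poly_values (U \<inter> k0) t n)"
    have P: "subring P R" unfolding P_def by (rule poly_values_subring[OF V0s(1) tc])
    note Ps = subringE[OF P]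
    have VP: "U \<inter> k0 \<subseteq> P" unfolding P_def by (rule poly_values_contains[OF V0s(1) tc])
    have PU: "P \<subseteq> U"
    proof
      fix p assume "p \<in> P"
      then obtain l where "set l \<subseteq> U \<inter> k0" "eval l t = p"
        using poly_values_eval[OF V0s(4) tc] unfolding P_def by blast
      then show "p \<in> U" using eval_mem[OF Us(1) _ t, of l] by auto
    qed
    \<comment> \<open>\<open>I\<close> asks \<open>t\<close> to become a nonunit while the nonunits
      of \<open>U\<close> remain nonunits. Together with \<open>U \<inter> k0\<close> in the
      idealizer, this produces a ring inside \<open>U\<close> with the same trace on
      \<open>k0\<close> in which \<open>t\<close> is no longer invertible.\<close>
    define I where "I = {a \<oplus> t \<otimes> p \<oplus> \<mu> | a p \<mu>. a \<in> nonunits (U \<inter> k0) \<and> p \<in> P \<and> \<mu> \<in> nonunits U}"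
    have mem: "a \<in> U" "a \<in> P" "a \<in> carrier R" if "a \<in> nonunits (U \<inter> k0)" for a
      using nonunits_subset[OF that] VP PU Us(4) by auto
    have memP: "a \<in> U" "a \<in> carrier R" if "a \<in> P" for a using that PU Us(4) by auto
    have memU: "a \<in> U" "a \<in> carrier R" if "a \<in> nonunits U" for a
      using nonunits_subset[OF that] Us(4) by auto
    have Ii: "a \<oplus> t \<otimes> p \<oplus> \<mu> \<in> I" if "a \<in> nonunits (U \<inter> k0)" "p \<in> P" "\<mu> \<in> nonunits U" for a p \<mu>
      using that unfolding I_def by blast
    have Ic: "I \<subseteq> carrier R" unfolding I_def using mem(3) memP(2) memU(2) tc by auto
    have Ia: "x \<oplus> y \<in> I" if "x \<in> I" "y \<in> I" for x y
    proof -
      obtain a p \<mu> b q \<nu> where *: "x = a \<oplus> t \<otimes> p \<oplus> \<mu>" "y = b \<oplus> t \<otimes> q \<oplus> \<nu>"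
        "a \<in> nonunits (U \<inter> k0)" "p \<in> P" "\<mu> \<in> nonunits U" "b \<in> nonunits (U \<inter> k0)" "q \<in> P" "\<nu> \<in> nonunits U"
        using \<open>x \<in> I\<close> \<open>y \<in> I\<close> unfolding I_def by blast
      have "x \<oplus> y = (a \<oplus> b) \<oplus> t \<otimes> (p \<oplus> q) \<oplus> (\<mu> \<oplus> \<nu>)"
        unfolding *(1,2) using mem(3)[OF *(3)] mem(3)[OF *(6)] memP(2)[OF *(4)] memP(2)[OF *(7)]
          memU(2)[OF *(5)] memU(2)[OF *(8)] tc by algebra
      then show ?thesis
        using Ii[OF nonunits_add[OF V0 k0(1) *(3,6)] Ps(7)[OF *(4,7)] nonunits_add[OF U(1) k1(1) *(5,8)]]
        by simp
    qed
    have In: "\<ominus> x \<in> I" if "x \<in> I" for x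
    proof -
      obtain a p \<mu> where *: "x = a \<oplus> t \<otimes> p \<oplus> \<mu>"
        "a \<in> nonunits (U \<inter> k0)" "p \<in> P" "\<mu> \<in> nonunits U"
        using \<open>x \<in> I\<close> unfolding I_def by blast
      have "\<ominus> x = \<ominus> a \<oplus> t \<otimes> (\<ominus> p) \<oplus> \<ominus> \<mu>"
        unfolding *(1) using mem(3)[OF *(2)] memP(2)[OF *(3)] memU(2)[OF *(4)] tc by algebra
      then show ?thesis
        using Ii[OF nonunits_uminus[OF V0s(1) *(2)] Ps(5)[OF *(3)] nonunits_uminus[OF Us(1) *(4)]] by simp
    qed
    have Im: "x \<otimes> y \<in> I" if "x \<in> I" "y \<in> I" for x y
    proof -
      obtain a p \<mu> b q \<nu> where *: "x = a \<oplus> t \<otimes> p \<oplus> \<mu>" "y = b \<oplus> t \<otimes> q \<oplus> \<nu>"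
        "a \<in> nonunits (U \<inter> k0)" "p \<in> P" "\<mu> \<in> nonunits U" "b \<in> nonunits (U \<inter> k0)" "q \<in> P" "\<nu> \<in> nonunits U"
        using \<open>x \<in> I\<close> \<open>y \<in> I\<close> unfolding I_def by blast
      note c = mem(3)[OF *(3)] mem(3)[OF *(6)] memP(2)[OF *(4)] memP(2)[OF *(7)]
          memU(2)[OF *(5)] memU(2)[OF *(8)] tc
      have 1: "b \<oplus> t \<otimes> q \<oplus> \<nu> \<in> U" "a \<oplus> t \<otimes> p \<in> U"
        using mem(1)[OF *(3)] mem(1)[OF *(6)] memP(1)[OF *(4)] memP(1)[OF *(7)] memU(1)[OF *(8)] t
        by (auto intro!: subringE(6,7)[OF Us(1)])
      have "x \<otimes> y = (a \<otimes> b) \<oplus> t \<otimes> ((a \<otimes> q \<oplus> p \<otimes> b) \<oplus> t \<otimes> (p \<otimes> q)) \<oplus>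
          ((b \<oplus> t \<otimes> q \<oplus> \<nu>) \<otimes> \<mu> \<oplus> (a \<oplus> t \<otimes> p) \<otimes> \<nu>)"
        unfolding *(1,2) using c by algebra
      moreover have "t \<in> P" unfolding P_def by (rule poly_values_contains[OF V0s(1) tc])
      then have "(a \<otimes> q \<oplus> p \<otimes> b) \<oplus> t \<otimes> (p \<otimes> q) \<in> P"
        using mem(2)[OF *(3)] mem(2)[OF *(6)] *(4,7) by (intro Ps(6,7))
      moreover have "a \<otimes> b \<in> nonunits (U \<inter> k0)"
        by (rule nonunits_mult[OF V0s(1) _ *(6)]) (use *(3) nonunits_subset in auto)
      moreover have "(b \<oplus> t \<otimes> q \<oplus> \<nu>) \<otimes> \<mu> \<oplus> (a \<oplus> t \<otimes> p) \<otimes> \<nu> \<in> nonunits U"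
        using nonunits_mult[OF Us(1) 1(1) *(5)] nonunits_mult[OF Us(1) 1(2) *(8)]
        by (rule nonunits_add[OF U(1) k1(1)])
      ultimately show ?thesis using Ii by simp
    qed
    define R' where "R' = {r \<in> carrier R. \<forall>x\<in>I. r \<otimes> x \<in> I}"
    have R': "subring R' R" unfolding R'_def by (rule idealizer_subring[OF Ic Ia In])
    have IR: "I \<subseteq> R'" unfolding R'_def using Ic Im by auto
    have VR: "U \<inter> k0 \<subseteq> R'"
    proof
      fix c assume c: "c \<in> U \<inter> k0"
      have "c \<otimes> x \<in> I" if "x \<in> I" for x
      proof -
        obtain a p \<mu> where *: "x = a \<oplus> t \<otimes> p \<oplus> \<mu>"
          "a \<in> nonunits (U \<inter> k0)" "p \<in> P" "\<mu> \<in> nonunits U"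
          using \<open>x \<in> I\<close> unfolding I_def by blast
        have cP: "c \<in> P" "c \<in> U" using VP c by auto
        have "c \<otimes> x = c \<otimes> a \<oplus> t \<otimes> (c \<otimes> p) \<oplus> c \<otimes> \<mu>"
          unfolding *(1) using mem(3)[OF *(2)] memP(2)[OF *(3)] memU(2)[OF *(4)] memP(2)[OF cP(1)] tc
          by algebra
        then show ?thesis
          using Ii[OF nonunits_mult[OF V0s(1) c *(2)] Ps(6)[OF cP(1) *(3)]
              nonunits_mult[OF Us(1) cP(2) *(4)]] by simp
      qed
      then show "c \<in> R'" unfolding R'_def using c Us(4) by auto
    qed
    have z: "\<zero> \<in> nonunits (U \<inter> k0)" "\<zero> \<in> nonunits U" using nonunits_zero V0s(1) Us(1) by auto
    have tI: "t \<in> I" using Ii[OF z(1) Ps(3) z(2)] tc by simp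
    have UI: "nonunits U \<subseteq> I"
    proof
      fix x assume "x \<in> nonunits U"
      then show "x \<in> I" using Ii[OF z(1) Ps(2), of x] tc memU(2)[of x] by simp
    qed
    \<comment> \<open>An expression of 1 as an element of \<open>I\<close> is a polynomial over
      \<open>U \<inter> k0\<close> with constant term \<open>\<one> \<ominus> a\<close>, a unit,
      whose value at \<open>t\<close> is a nonunit. Then \<open>root_mod_nonunits\<close> finds the
      residue of \<open>t\<close> in \<open>k0\<close>, against the assumption.\<close>
    have I1: "\<one> \<notin> I"
    proof
      assume "\<one> \<in> I"
      then obtain a p \<mu> where *: "\<one> = a \<oplus> t \<otimes> p \<oplus> \<mu>"
        "a \<in> nonunits (U \<inter> k0)" "p \<in> P" "\<mu> \<in> nonunits U"
        unfolding I_def by blast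
      note c = mem(3)[OF *(2)] memP(2)[OF *(3)] memU(2)[OF *(4)]
      have "\<ominus> p \<in> P" by (rule Ps(5)[OF *(3)])
      then obtain l where l: "set l \<subseteq> U \<inter> k0" "eval l t = \<ominus> p"
        using poly_values_eval[OF V0s(4) tc] unfolding P_def by blast
      have a1: "\<one> \<ominus> a \<in> U \<inter> k0"
        using nonunits_subset[OF *(2)] subringE(3,5,7)[OF V0s(1)] unfolding a_minus_def by blast
      have "eval (l @ [\<one> \<ominus> a]) t = \<ominus> p \<otimes> t \<oplus> (\<one> \<ominus> a)"
        using eval_append_aux[of l "\<one> \<ominus> a" t] l V0s(4) a1 tc by auto
      also have "\<dots> = \<ominus> p \<otimes> t \<oplus> ((a \<oplus> t \<otimes> p \<oplus> \<mu>) \<ominus> a)" using *(1) by simp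
      also have "\<dots> = \<mu>" using c tc by algebra
      finally have "eval (l @ [\<one> \<ominus> a]) t \<in> nonunits U" using *(4) by simp
      moreover have "\<one> \<ominus> a \<notin> nonunits U"
      proof
        assume "\<one> \<ominus> a \<in> nonunits U"
        moreover have "a \<in> nonunits U" using *(2) nonunits_inter[OF k0(1)] by auto
        ultimately have "(\<one> \<ominus> a) \<oplus> a \<in> nonunits U" by (rule nonunits_add[OF U(1) k1(1)])
        moreover have "(\<one> \<ominus> a) \<oplus> a = \<one>" using c by algebra
        ultimately show False using one_not_nonunit[OF Us(1)] by simp
      qed
      ultimately show False
        using root_mod_nonunits[OF k0 k1 U(1) t, of "l @ [\<one> \<ominus> a]"] l(1) a1 neg by auto
    qed
    obtain W where W: "val_subring (carrier R) W" "R' \<subseteq> W" "I \<subseteq> nonunits W"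
      using chevalley_extension[OF R' IR Ia _ _ I1] UI z(2) unfolding R'_def by blast
    have kc: "k1 \<subseteq> carrier R" by (rule subfieldE(3)[OF k1(1)])
    have W': "val_subring k1 (W \<inter> k1)" by (rule val_subring_inter[OF W(1) k1(1) kc])
    \<comment> \<open>An element of \<open>k1\<close> outside \<open>U\<close> has its inverse in
      \<open>nonunits U\<close>, hence in \<open>nonunits W\<close>.\<close>
    have WU: "W \<inter> k1 \<subseteq> U"
    proof (rule ccontr)
      assume "\<not> W \<inter> k1 \<subseteq> U"
      then obtain x where x: "x \<in> W" "x \<in> k1" "x \<notin> U" by auto
      note i = inv_in_nonunits[OF U(1) k1(1) x(2,3)]
      have "inv x \<in> nonunits W" using i(2) UI W(3) by auto
      moreover note nonzero_inv[of x]
      ultimately show False using x i(1) kc unfolding nonunits_def by auto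
    qed
    have "V \<inter> k0 \<subseteq> W \<inter> k1" using VR W(2) k1(2) unfolding UV by blast
    then have "W \<inter> k1 \<in> \<A>" using W' WU U(2) unfolding \<A>_def by auto
    then have UW: "U \<subseteq> W" using min WU by blast
    moreover have "t \<in> nonunits W" using tI W(3) by auto
    \<comment> \<open>The scalar 0 is among the candidates ruled out for the residue of
      \<open>t\<close>. So \<open>t\<close> is invertible in \<open>U\<close>, and by minimality its
      inverse lies in \<open>W\<close>, where \<open>t\<close> is a nonunit.\<close>
    moreover have "t \<notin> nonunits U"
    proof -
      have "t \<ominus> \<zero> = t" using tc by (simp add: a_minus_def)
      moreover have "t \<ominus> \<zero> \<notin> nonunits U" using neg subringE(2)[OF V0s(1)] by blast
      ultimately show ?thesis by simp
    qed
    ultimately show False using unitD[OF t] unfolding nonunits_def[of W] by blast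
  qed
  then show ?thesis using U UV by blast
qed

text \<open>The residue fields of \<^term>\<open>V \<inter> k1\<close> and \<^term>\<open>V \<inter> k2\<close> are linearly disjoint over that of
  \<^term>\<open>V \<inter> k0\<close> inside the residue field of \<^term>\<open>V\<close>.\<close>

definition residually_disjoint :: "'a set \<Rightarrow> 'a set \<Rightarrow> 'a set \<Rightarrow> 'a set \<Rightarrow> bool"
  where "residually_disjoint k0 k1 k2 V \<longleftrightarrow>
    (\<forall>(I::nat set) a b. finite I \<and> a ` I \<subseteq> V \<inter> k1 \<and> b ` I \<subseteq> V \<inter> k2 \<and>
      (\<Oplus>i\<in>I. a i \<otimes> b i) \<in> nonunits V \<and> (\<exists>i\<in>I. a i \<notin> nonunits V) \<longrightarrow>
      (\<exists>c. c ` I \<subseteq> V \<inter> k0 \<and> (\<exists>i\<in>I. c i \<notin> nonunits V) \<and> (\<Oplus>i\<in>I. c i \<otimes> b i) \<in> nonunits V))"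

lemma finsum_smult_diff:
  assumes "finite I" "a \<in> carrier R" "f \<in> I \<rightarrow> carrier R" "g \<in> I \<rightarrow> carrier R" "h \<in> I \<rightarrow> carrier R"
  shows "(\<Oplus>i\<in>I. (f i \<ominus> a \<otimes> g i) \<otimes> h i) = (\<Oplus>i\<in>I. f i \<otimes> h i) \<ominus> a \<otimes> (\<Oplus>i\<in>I. g i \<otimes> h i)"
  using assms
proof (induction I rule: finite_induct)
  case empty
  then show ?case by (simp add: a_minus_def)
next
  case (insert i I)
  have c: "f i \<in> carrier R" "g i \<in> carrier R" "h i \<in> carrier R"
    "(\<Oplus>i\<in>I. f i \<otimes> h i) \<in> carrier R" "(\<Oplus>i\<in>I. g i \<otimes> h i) \<in> carrier R"
    using insert.prems by (auto intro!: finsum_closed)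
  have "(\<Oplus>i\<in>insert i I. (f i \<ominus> a \<otimes> g i) \<otimes> h i)
      = (f i \<ominus> a \<otimes> g i) \<otimes> h i \<oplus> ((\<Oplus>i\<in>I. f i \<otimes> h i) \<ominus> a \<otimes> (\<Oplus>i\<in>I. g i \<otimes> h i))"
    using insert by (subst finsum_insert) (auto simp: Pi_def)
  also have "\<dots> = (f i \<otimes> h i \<oplus> (\<Oplus>i\<in>I. f i \<otimes> h i)) \<ominus> a \<otimes> (g i \<otimes> h i \<oplus> (\<Oplus>i\<in>I. g i \<otimes> h i))"
  proof -
    have "(p \<ominus> a \<otimes> q) \<otimes> r \<oplus> (F \<ominus> a \<otimes> G) = (p \<otimes> r \<oplus> F) \<ominus> a \<otimes> (q \<otimes> r \<oplus> G)"
      if "p \<in> carrier R" "q \<in> carrier R" "r \<in> carrier R" "F \<in> carrier R" "G \<in> carrier R" for p q r F G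
      using that insert.prems(1) by algebra
    then show ?thesis using c by simp
  qed
  also have "\<dots> = (\<Oplus>i\<in>insert i I. f i \<otimes> h i) \<ominus> a \<otimes> (\<Oplus>i\<in>insert i I. g i \<otimes> h i)"
    using insert c by (subst (1 2) finsum_insert) (auto simp: Pi_def)
  finally show ?case .
qed

lemma finsum_smult:
  assumes "finite I" "a \<in> carrier R" "g \<in> I \<rightarrow> carrier R"
  shows "(\<Oplus>i\<in>I. a \<otimes> g i) = a \<otimes> (\<Oplus>i\<in>I. g i)"
  using finsum_rdistr[OF assms] by simp

end

lemma (in field) residually_disjointD:
  fixes I :: "nat set"
  assumes "residually_disjoint k0 k1 k2 V" "finite I" "a ` I \<subseteq> V \<inter> k1" "b ` I \<subseteq> V \<inter> k2"
    "(\<Oplus>i\<in>I. a i \<otimes> b i) \<in> nonunits V" "\<exists>i\<in>I. a i \<notin> nonunits V"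
  shows "\<exists>c. c ` I \<subseteq> V \<inter> k0 \<and> (\<exists>i\<in>I. c i \<notin> nonunits V) \<and> (\<Oplus>i\<in>I. c i \<otimes> b i) \<in> nonunits V"
  using assms(1)[unfolded residually_disjoint_def, THEN spec, of I, THEN spec, of a, THEN spec, of b]
    assms(2-6) by simp

section \<open>One refinement step: valuation rings with prescribed traces inside
  \<open>V\<close>\<close>

locale residue_refinement = field R for R (structure) +
  fixes k0 k1 k2 V W1 W2 U :: "'a set"
  assumes k0: "subfield k0 R" and k1: "subfield k1 R" and k2: "subfield k2 R"
    and k01: "k0 \<subseteq> k1" and k02: "k0 \<subseteq> k2"
    and V: "val_subring (carrier R) V" and disj: "residually_disjoint k0 k1 k2 V"
    and W1: "val_subring k1 W1" and W1V: "W1 \<subseteq> V"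
    and W2: "val_subring k2 W2" and W2V: "W2 \<subseteq> V"
    and W12: "W1 \<inter> k0 = W2 \<inter> k0"
    and U: "val_subring k1 U" and UW1: "U \<subseteq> W1" and UW0: "U \<inter> k0 = W1 \<inter> k0"
    and rational: "\<And>x. x \<in> U \<Longrightarrow> \<exists>c\<in>U \<inter> k0. x \<ominus> c \<in> nonunits U"
begin

lemmas Vs = val_subringD[OF V] and W1s = val_subringD[OF W1] and W2s = val_subringD[OF W2]
  and Us = val_subringD[OF U]

lemma W0: "val_subring k0 (W1 \<inter> k0)"
  by (rule val_subring_inter[OF W1 k0 k01])

lemmas W0s = val_subringD[OF W0]

lemma nonunits_V1: "x \<in> nonunits V \<Longrightarrow> x \<in> k1 \<Longrightarrow> x \<in> nonunits W1"
  using nonunits_antimono[OF W1, of "V \<inter> k1"] W1V W1s(2) nonunits_inter[OF k1] by auto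

lemma nonunits_V2: "x \<in> nonunits V \<Longrightarrow> x \<in> k2 \<Longrightarrow> x \<in> nonunits W2"
  using nonunits_antimono[OF W2, of "V \<inter> k2"] W2V W2s(2) nonunits_inter[OF k2] by auto

lemma nonunits_W1: "x \<in> nonunits W1 \<Longrightarrow> x \<in> nonunits U"
  using nonunits_antimono[OF U UW1 W1s(2)] by auto

lemma nonunits_W0: "x \<in> nonunits (W1 \<inter> k0) \<longleftrightarrow> x \<in> nonunits W1 \<and> x \<in> k0"
  "x \<in> nonunits (W1 \<inter> k0) \<longleftrightarrow> x \<in> nonunits W2 \<and> x \<in> k0"
  using nonunits_inter[OF k0, of W1] nonunits_inter[OF k0, of W2] W12 by auto

text \<open>\<open>small a b\<close> says that \<open>a \<otimes> b\<close> has to become a nonunit of the extension.\<close>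

definition small :: "'a \<Rightarrow> 'a \<Rightarrow> bool"
  where "small a b \<longleftrightarrow> a \<in> nonunits U \<and> b \<in> W2 \<or> a \<in> W1 \<and> b \<in> nonunits W2"

lemma smallD: "small a b \<Longrightarrow> a \<in> W1" "small a b \<Longrightarrow> b \<in> W2"
  using nonunits_subset UW1 unfolding small_def by auto

text \<open>A relation modulo \<open>V\<close> yields, by disjointness, a relation among the \<open>b i\<close> with coefficients in \<open>k0\<close>;
  it eliminates one term, and normalising it at a suitable index keeps the other terms small.\<close>

lemma combination_not_nonunit:
  "finite I \<Longrightarrow> i0 \<in> I \<Longrightarrow> b i0 = \<one> \<Longrightarrow> a i0 \<in> U \<Longrightarrow> a i0 \<notin> nonunits U \<Longrightarrow>
    (\<And>i. i \<in> I \<Longrightarrow> i \<noteq> i0 \<Longrightarrow> small (a i) (b i)) \<Longrightarrow>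
    (\<Oplus>i\<in>I. a i \<otimes> b i) \<notin> nonunits V" for I :: "nat set"
proof (induction "card I" arbitrary: I a rule: less_induct)
  case less
  note fin = less.prems(1) and i0 = less.prems(2) and b0 = less.prems(3) and a0 = less.prems(4,5)
    and sm = less.prems(6)
  show ?case
  proof
    assume sum: "(\<Oplus>i\<in>I. a i \<otimes> b i) \<in> nonunits V"
    have aW: "a i \<in> W1" and bW: "b i \<in> W2" if "i \<in> I" for i
      using smallD[OF sm[OF that]] that a0 UW1 b0 subringE(3)[OF W2s(1)] by (cases "i = i0"; auto)+
    have ac: "a i \<in> carrier R" and bc: "b i \<in> carrier R" if "i \<in> I" for i
      using aW[OF that] bW[OF that] W1s(4) W2s(4) by auto
    have "a i0 \<notin> nonunits V"
      using a0 nonunits_V1 nonunits_W1 Us(2) by blast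
    moreover have "a ` I \<subseteq> V \<inter> k1" "b ` I \<subseteq> V \<inter> k2"
      using aW bW W1V W2V W1s(2) W2s(2) by blast+
    ultimately obtain c' where c': "c' ` I \<subseteq> V \<inter> k0" "\<exists>i\<in>I. c' i \<notin> nonunits V"
      "(\<Oplus>i\<in>I. c' i \<otimes> b i) \<in> nonunits V"
      using residually_disjointD[OF disj fin _ _ sum] i0 by blast
    obtain i1 where i1: "i1 \<in> I" "c' i1 \<notin> nonunits V" using c'(2) by auto
    then have "c' i1 \<noteq> \<zero>" using nonunits_zero[OF Vs(1)] by auto
    \<comment> \<open>Dominance is measured in \<open>W1 \<inter> k0\<close>, not in
      \<open>V\<close>: the normalised coefficients must lie in both \<open>W1\<close> and
      \<open>W2\<close>.\<close>
    then obtain l where l: "l \<in> I" "c' l \<noteq> \<zero>" "\<And>i. i \<in> I \<Longrightarrow> inv (c' l) \<otimes> c' i \<in> W1 \<inter> k0"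
      using exists_dominant[OF W0 k0 fin _ i1(1), of c'] c'(1) by blast
    have c'c: "c' i \<in> carrier R" if "i \<in> I" for i using that c'(1) Vs(4) by auto
    note il = nonzero_inv[OF c'c[OF l(1)] l(2)]
    \<comment> \<open>All coefficients are multiples of \<open>c' l\<close> by elements of
      \<open>V\<close>, so \<open>c' l\<close> inherits being a unit of \<open>V\<close> from
      \<open>c' i1\<close>. Division by it therefore keeps the sum in the maximal ideal of
      \<open>V\<close>.\<close>
    have ul: "c' l \<notin> nonunits V"
    proof
      assume "c' l \<in> nonunits V"
      then have "(inv (c' l) \<otimes> c' i1) \<otimes> c' l \<in> nonunits V"
        using l(3)[OF i1(1)] W1V by (intro nonunits_mult[OF Vs(1)]) auto
      moreover have "(inv (c' l) \<otimes> c' i1) \<otimes> c' l = (c' l \<otimes> inv (c' l)) \<otimes> c' i1"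
        using il(1) c'c[OF l(1)] c'c[OF i1(1)] by (simp add: m_ac)
      then have "(inv (c' l) \<otimes> c' i1) \<otimes> c' l = c' i1"
        using il(3) c'c[OF i1(1)] by simp
      ultimately show False using i1(2) by simp
    qed
    have scale: "(\<Oplus>i\<in>I. (u \<otimes> f i) \<otimes> b i) \<in> nonunits V"
      if u: "u \<in> V" and f: "\<And>i. i \<in> I \<Longrightarrow> f i \<in> carrier R" and s: "(\<Oplus>i\<in>I. f i \<otimes> b i) \<in> nonunits V" for u f
    proof -
      have uc: "u \<in> carrier R" using u Vs(4) by auto
      have "(\<Oplus>i\<in>I. (u \<otimes> f i) \<otimes> b i) = (\<Oplus>i\<in>I. u \<otimes> (f i \<otimes> b i))"
        using f bc uc by (intro finsum_cong') (auto simp: m_assoc)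
      also have "\<dots> = u \<otimes> (\<Oplus>i\<in>I. f i \<otimes> b i)"
        using f bc uc fin by (intro finsum_smult) auto
      finally show ?thesis using nonunits_mult[OF Vs(1) u s] by simp
    qed
    define c where "c = (\<lambda>i. inv (c' l) \<otimes> c' i)"
    have cW: "c i \<in> W1" "c i \<in> k0" "c i \<in> W2" "c i \<in> carrier R" if "i \<in> I" for i
      using l(3)[OF that] W12 W1s(4) unfolding c_def by auto
    have cl: "c l = \<one>" unfolding c_def using il by simp
    have "c' l \<in> V" using c'(1) l(1) by auto
    then have csum: "(\<Oplus>i\<in>I. c i \<otimes> b i) \<in> nonunits V"
      unfolding c_def using scale[OF _ c'c c'(3)] unitD(2)[OF _ ul] by blast
    \<comment> \<open>\<open>j\<close> is the index to be eliminated and \<open>d\<close> the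
      relation normalised at it. The last condition is exactly what is needed so that subtracting
      \<open>a j \<otimes> d i\<close> preserves the unit at \<open>i0\<close> and those terms that
      are small on account of \<open>a i\<close>.\<close>
    have "\<exists>j d. j \<in> I \<and> j \<noteq> i0 \<and> (\<forall>i\<in>I. d i \<in> W1 \<inter> k0) \<and> d j = \<one> \<and>
      (\<Oplus>i\<in>I. d i \<otimes> b i) \<in> nonunits V \<and> (\<forall>i\<in>I. i = i0 \<or> a i \<in> nonunits U \<longrightarrow> a j \<otimes> d i \<in> nonunits U)"
    proof (cases "\<exists>j\<in>I. j \<noteq> i0 \<and> a j \<in> nonunits U \<and> c j \<notin> nonunits (W1 \<inter> k0)")
      case True
      then obtain j where j: "j \<in> I" "j \<noteq> i0" "a j \<in> nonunits U" "c j \<notin> nonunits (W1 \<inter> k0)" by auto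
      have cj: "c j \<in> W1 \<inter> k0" using cW j by auto
      note u = inv_unit[OF W0s(1) cj j(4)]
      have "inv (c j) \<otimes> c i \<in> W1 \<inter> k0" if "i \<in> I" for i
        using subringE(6)[OF W0s(1) u(1)] cW[OF that] by auto
      moreover have "inv (c j) \<otimes> c j = \<one>"
        using unitD(1)[OF cj j(4)] nonzero_inv(4)[of "c j"] cW(4)[OF j(1)] by auto
      moreover have "(\<Oplus>i\<in>I. (inv (c j) \<otimes> c i) \<otimes> b i) \<in> nonunits V"
        using scale[OF _ cW(4) csum, of "inv (c j)"] u(1) W1V by blast
      moreover have "a j \<otimes> x \<in> nonunits U" if "x \<in> W1 \<inter> k0" for x
      proof -
        have "x \<otimes> a j \<in> nonunits U" using nonunits_mult[OF Us(1) _ j(3)] that UW0 by auto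
        then show ?thesis using that ac[OF j(1)] W1s(4) by (simp add: m_comm subset_iff)
      qed
      ultimately show ?thesis
        using j(1,2) by (intro exI[of _ j] exI[of _ "\<lambda>i. inv (c j) \<otimes> c i"]) auto
    next
      case False
      \<comment> \<open>In this case a term that is small on account of \<open>a i\<close> has a
        nonunit scalar \<open>c i\<close>, and every other term has a nonunit \<open>b i\<close>;
        both ways the product is a nonunit of \<open>W2\<close>.\<close>
      have prods: "c i \<otimes> b i \<in> nonunits W2" if i: "i \<in> I - {i0}" for i
      proof (cases "a i \<in> nonunits U")
        case True
        then have "c i \<in> nonunits W2" using False i nonunits_W0(2) by auto
        then have "b i \<otimes> c i \<in> nonunits W2" using nonunits_mult[OF W2s(1)] bW i by auto
        then show ?thesis using i bc cW(4) by (simp add: m_comm)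
      next
        case F: False
        then have "b i \<in> nonunits W2" using sm[of i] i unfolding small_def by auto
        then show ?thesis using nonunits_mult[OF W2s(1)] cW(3) i by auto
      qed
      let ?S = "\<Oplus>i\<in>I - {i0}. c i \<otimes> b i"
      have S2: "?S \<in> nonunits W2"
      proof (rule finsum_mem)
        show "nonunits W2 \<subseteq> carrier R" using nonunits_subset W2s(4) by auto
      qed (use nonunits_zero[OF W2s(1)] nonunits_add[OF W2 k2] prods in auto)
      have Sc: "?S \<in> carrier R" using S2 nonunits_subset W2s(4) by auto
      have "(\<Oplus>i\<in>insert i0 (I - {i0}). c i \<otimes> b i) = c i0 \<otimes> b i0 \<oplus> ?S"
        using fin cW(4) bc i0 by (intro finsum_insert) auto
      then have eq: "(\<Oplus>i\<in>I. c i \<otimes> b i) = c i0 \<oplus> ?S"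
        using i0 b0 cW(4) by (simp add: insert_absorb)
      have "c i0 \<oplus> ?S \<in> W2" using subringE(7)[OF W2s(1) cW(3)[OF i0]] nonunits_subset[OF S2] by auto
      \<comment> \<open>The sum lies in \<open>k2\<close> and in the maximal ideal of
        \<open>V\<close>, hence in that of \<open>W2\<close>. All terms but the one at
        \<open>i0\<close> are known to lie there, so \<open>c i0\<close> does too, and the index
        \<open>l\<close> with coefficient 1 cannot be \<open>i0\<close>.\<close>
      then have "c i0 \<oplus> ?S \<in> nonunits W2" using nonunits_V2 csum W2s(2) unfolding eq by auto
      then have "(c i0 \<oplus> ?S) \<oplus> \<ominus> ?S \<in> nonunits W2"
        using nonunits_add[OF W2 k2] nonunits_uminus[OF W2s(1) S2] by blast
      moreover have "(c i0 \<oplus> ?S) \<oplus> \<ominus> ?S = c i0"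
        using cW(4)[OF i0] Sc by (simp add: a_assoc r_neg)
      ultimately have ci0: "c i0 \<in> nonunits W2" by simp
      then have li0: "l \<noteq> i0" using cl one_not_nonunit[OF W2s(1)] by auto
      have "a l \<otimes> c i \<in> nonunits U" if i: "i \<in> I" "i = i0 \<or> a i \<in> nonunits U" for i
      proof -
        have "c i \<in> nonunits (W1 \<inter> k0)"
          using False i ci0 cW(2)[OF i(1)] nonunits_W0(2) by (cases "i = i0") auto
        then have "c i \<in> nonunits W1" using nonunits_W0(1) by auto
        then show ?thesis by (intro nonunits_W1 nonunits_mult[OF W1s(1) aW[OF l(1)]])
      qed
      then show ?thesis using l(1) li0 cW cl csum by (intro exI[of _ l] exI[of _ c]) auto
    qed
    then obtain j d where j: "j \<in> I" "j \<noteq> i0" and d: "\<And>i. i \<in> I \<Longrightarrow> d i \<in> W1 \<inter> k0" "d j = \<one>"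
      "(\<Oplus>i\<in>I. d i \<otimes> b i) \<in> nonunits V"
      "\<And>i. i \<in> I \<Longrightarrow> i = i0 \<or> a i \<in> nonunits U \<Longrightarrow> a j \<otimes> d i \<in> nonunits U" by auto
    have dc: "d i \<in> carrier R" if "i \<in> I" for i using d(1)[OF that] W1s(4) by auto
    define a' where "a' = (\<lambda>i. a i \<ominus> a j \<otimes> d i)"
    have "(\<Oplus>i\<in>I. a' i \<otimes> b i) = (\<Oplus>i\<in>I. a i \<otimes> b i) \<ominus> a j \<otimes> (\<Oplus>i\<in>I. d i \<otimes> b i)"
      unfolding a'_def using fin ac bc dc j by (intro finsum_smult_diff) auto
    moreover have "a j \<otimes> (\<Oplus>i\<in>I. d i \<otimes> b i) \<in> nonunits V"
      by (rule nonunits_mult[OF Vs(1) _ d(3)]) (use aW[OF j(1)] W1V in auto)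
    ultimately have s': "(\<Oplus>i\<in>I. a' i \<otimes> b i) \<in> nonunits V"
      using nonunits_add[OF V carrier_is_subfield sum] nonunits_uminus[OF Vs(1)] unfolding a_minus_def by auto
    have a'c: "a' i \<in> carrier R" if "i \<in> I" for i unfolding a'_def using ac dc that j by auto
    have "a' j = \<zero>" unfolding a'_def using d(2) ac[OF j(1)] by (simp add: a_minus_def r_neg)
    moreover have "(\<Oplus>i\<in>insert j (I - {j}). a' i \<otimes> b i) = a' j \<otimes> b j \<oplus> (\<Oplus>i\<in>I - {j}. a' i \<otimes> b i)"
      using fin a'c bc j by (intro finsum_insert) auto
    moreover have "(\<Oplus>i\<in>I - {j}. a' i \<otimes> b i) \<in> carrier R" using a'c bc by (intro finsum_closed) auto
    ultimately have s'': "(\<Oplus>i\<in>I - {j}. a' i \<otimes> b i) \<in> nonunits V"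
      using s' bc[OF j(1)] j(1) by (simp add: insert_absorb)
    have sub: "x \<ominus> y \<in> nonunits U" if "x \<in> nonunits U" "y \<in> nonunits U" for x y
      unfolding a_minus_def using nonunits_add[OF U k1 that(1)] nonunits_uminus[OF Us(1) that(2)] by auto
    have a0': "a' i0 \<in> U" "a' i0 \<notin> nonunits U"
    proof -
      have aj: "a j \<otimes> d i0 \<in> nonunits U" using d(4)[OF i0] by auto
      show "a' i0 \<in> U" unfolding a'_def a_minus_def
        using subringE(5,7)[OF Us(1)] a0(1) nonunits_subset[OF aj] by auto
      show "a' i0 \<notin> nonunits U"
      proof
        assume "a' i0 \<in> nonunits U"
        then have "a' i0 \<oplus> a j \<otimes> d i0 \<in> nonunits U" using nonunits_add[OF U k1 _ aj] by blast
        moreover have "a' i0 \<oplus> a j \<otimes> d i0 = a i0"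
          unfolding a'_def using ac[OF i0] ac[OF j(1)] dc[OF i0] by algebra
        ultimately show False using a0(2) by simp
      qed
    qed
    \<comment> \<open>Terms with \<open>a i\<close> in the maximal ideal of \<open>U\<close> are
      covered by the condition on \<open>d\<close>; for the others \<open>b i\<close> is a nonunit
      and any coefficient in \<open>W1\<close> is allowed.\<close>
    have "small (a' i) (b i)" if i: "i \<in> I - {j}" "i \<noteq> i0" for i
    proof (cases "a i \<in> nonunits U")
      case True
      then show ?thesis using sub[OF True] d(4)[of i] i bW unfolding small_def a'_def by auto
    next
      case False
      then have "b i \<in> nonunits W2" using sm[of i] i unfolding small_def by auto
      moreover have "a' i \<in> W1" unfolding a'_def a_minus_def
        using subringE(5,6,7)[OF W1s(1)] aW i j d(1) by auto
      ultimately show ?thesis unfolding small_def by auto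
    qed
    moreover have "card (I - {j}) < card I" using fin j(1) by (rule card_Diff1_less)
    ultimately show False
      using less.hyps[of "I - {j}" a'] fin i0 j b0 a0' s'' by auto
  qed
qed

text \<open>The factor paired with the nonunits of \<open>W2\<close> ranges over \<open>W1\<close>
  and not only over \<open>U\<close>. This allows the denominators of the later localisation, whose
  inverses lie in \<open>W1\<close>, to be absorbed.\<close>

definition kernel_gens :: "'a set"
  where "kernel_gens = {a \<otimes> b | a b. small a b} \<union> nonunits V"

text \<open>Closure under products is needed for the generated additive group to lie in its own
  idealizer.\<close>

lemma small_mult:
  assumes "small a b" "small a' b'"
  shows "small (a \<otimes> a') (b \<otimes> b')"
proof -
  have n: "x \<otimes> y \<in> nonunits W" if "subring W R" "x \<in> nonunits W" "y \<in> W" for x y W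
    using nonunits_mult[OF that(1,3,2)] that nonunits_subset[OF that(2)] subringE(1)[OF that(1)]
    by (simp add: m_comm subset_iff)
  note * = subringE(6)[OF W1s(1)] subringE(6)[OF W2s(1)]
    nonunits_mult[OF Us(1)] nonunits_mult[OF W2s(1)] n[OF Us(1)] n[OF W2s(1)]
  show ?thesis
    using assms * smallD[OF assms(1)] smallD[OF assms(2)] nonunits_subset
    unfolding small_def by meson
qed

lemma small_scale:
  assumes "small a b"
  shows "u \<in> U \<Longrightarrow> small (u \<otimes> a) b" "w \<in> W2 \<Longrightarrow> small a (w \<otimes> b)"
  using assms nonunits_mult[OF Us(1)] nonunits_mult[OF W2s(1)] UW1
    subringE(6)[OF W1s(1)] subringE(6)[OF W2s(1)]
  unfolding small_def by blast+

lemma gens_carrier: "kernel_gens \<subseteq> carrier R"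
  using smallD W1s(4) W2s(4) nonunits_subset[of _ V] Vs(4) unfolding kernel_gens_def by blast

lemma gens_V: "kernel_gens \<subseteq> V"
  using smallD W1V W2V subringE(6)[OF Vs(1)] nonunits_subset[of _ V] unfolding kernel_gens_def by blast

lemma small_carrier: "small a b \<Longrightarrow> a \<in> carrier R \<and> b \<in> carrier R"
  using smallD W1s(4) W2s(4) by blast

lemma gens_mult:
  assumes "x \<in> kernel_gens" "y \<in> kernel_gens"
  shows "x \<otimes> y \<in> kernel_gens"
proof -
  have xy: "x \<in> V" "y \<in> V" "x \<in> carrier R" "y \<in> carrier R"
    using assms gens_V gens_carrier by auto
  consider "x \<in> nonunits V" | "y \<in> nonunits V"
    | a b a' b' where "x = a \<otimes> b" "small a b" "y = a' \<otimes> b'" "small a' b'"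
    using assms unfolding kernel_gens_def by blast
  then show ?thesis
  proof cases
    case 1
    then have "y \<otimes> x \<in> nonunits V" by (rule nonunits_mult[OF Vs(1) xy(2)])
    then show ?thesis using xy unfolding kernel_gens_def by (simp add: m_comm)
  next
    case 2
    then have "x \<otimes> y \<in> nonunits V" by (rule nonunits_mult[OF Vs(1) xy(1)])
    then show ?thesis unfolding kernel_gens_def by simp
  next
    case 3
    have "x \<otimes> y = (a \<otimes> a') \<otimes> (b \<otimes> b')"
      unfolding 3(1,3) using small_carrier[OF 3(2)] small_carrier[OF 3(4)] by (simp add: m_ac)
    then show ?thesis using small_mult[OF 3(2,4)] unfolding kernel_gens_def by blast
  qed
qed

text \<open>Scaling by \<open>W1\<close> is not claimed: a nonunit of \<open>U\<close> may be a unit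
  of \<open>W1\<close>, and scaling by its inverse would give 1.\<close>

lemma gens_scale:
  assumes "x \<in> kernel_gens" "r \<in> U \<or> r \<in> W2"
  shows "r \<otimes> x \<in> kernel_gens"
proof -
  have r: "r \<in> V" "r \<in> carrier R" using assms(2) UW1 W1V W2V Vs(4) by auto
  consider "x \<in> nonunits V" | a b where "x = a \<otimes> b" "small a b"
    using assms(1) unfolding kernel_gens_def by blast
  then show ?thesis
  proof cases
    case 1
    then show ?thesis using nonunits_mult[OF Vs(1) r(1)] unfolding kernel_gens_def by blast
  next
    case 2
    note c = small_carrier[OF 2(2)]
    have "r \<otimes> x = (r \<otimes> a) \<otimes> b" "r \<otimes> x = a \<otimes> (r \<otimes> b)"
      unfolding 2(1) using c r(2) by (simp_all add: m_ac)
    then show ?thesis using small_scale[OF 2(2)] assms(2) unfolding kernel_gens_def by blast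
  qed
qed

lemma kernel_mult:
  assumes "x \<in> add_span kernel_gens" "y \<in> add_span kernel_gens"
  shows "x \<otimes> y \<in> add_span kernel_gens"
proof (rule add_span_mult[OF gens_carrier _ _ assms(2)])
  show "x \<in> carrier R" using assms(1) add_span_carrier[OF gens_carrier] by auto
  fix g assume g: "g \<in> kernel_gens"
  show "x \<otimes> g \<in> add_span kernel_gens"
  proof (rule add_span_mult_right[OF gens_carrier _ _ assms(1)])
    show "g \<in> carrier R" using g gens_carrier by auto
    fix h assume "h \<in> kernel_gens"
    then show "h \<otimes> g \<in> add_span kernel_gens"
      using gens_mult[OF _ g] add_span_incl[OF gens_carrier] by auto
  qed
qed

lemma kernel_scale:
  assumes "x \<in> add_span kernel_gens" "r \<in> U \<or> r \<in> W2"
  shows "r \<otimes> x \<in> add_span kernel_gens"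
proof (rule add_span_mult[OF gens_carrier _ _ assms(1)])
  show "r \<in> carrier R" using assms(2) Us(4) W2s(4) by auto
  fix g assume "g \<in> kernel_gens"
  then show "r \<otimes> g \<in> add_span kernel_gens"
    using gens_scale[OF _ assms(2)] add_span_incl[OF gens_carrier] by auto
qed

text \<open>Contributions from the maximal ideal of \<open>V\<close> are collected in one
  \<open>\<mu>\<close>. The remaining terms are indexed by an initial segment, which leaves
  \<open>n\<close> free for one more term.\<close>

lemma kernel_form:
  "x \<in> add_span kernel_gens \<Longrightarrow> \<exists>n a b \<mu>. (\<forall>i<n::nat. small (a i) (b i)) \<and> \<mu> \<in> nonunits V \<and>
    x = (\<Oplus>i\<in>{..<n}. a i \<otimes> b i) \<oplus> \<mu>"
proof (induction rule: add_span.induct)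
  case zero
  then show ?case
    using nonunits_zero[OF Vs(1)] by (intro exI[of _ 0] exI exI exI[of _ \<zero>]) auto
next
  case (add x g)
  then obtain n :: nat and a b \<mu> where *: "\<And>i. i < n \<Longrightarrow> small (a i) (b i)" "\<mu> \<in> nonunits V"
    "x = (\<Oplus>i\<in>{..<n}. a i \<otimes> b i) \<oplus> \<mu>" by blast
  have c: "a i \<in> carrier R" "b i \<in> carrier R" if "i < n" for i using small_carrier[OF *(1)[OF that]] by auto
  have Sc: "(\<Oplus>i\<in>{..<n}. a i \<otimes> b i) \<in> carrier R" using c by (intro finsum_closed) auto
  have mc: "\<mu> \<in> carrier R" using nonunits_subset[OF *(2)] Vs(4) by auto
  have gc: "g \<in> carrier R" using add gens_carrier by auto
  consider "g \<in> nonunits V" | a' b' where "g = a' \<otimes> b'" "small a' b'"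
    using add unfolding kernel_gens_def by blast
  then show ?case
  proof cases
    case 1
    then have "\<mu> \<oplus> g \<in> nonunits V" using nonunits_add[OF V carrier_is_subfield *(2)] by auto
    moreover have "x \<oplus> g = (\<Oplus>i\<in>{..<n}. a i \<otimes> b i) \<oplus> (\<mu> \<oplus> g)"
      unfolding *(3) using Sc mc gc by (simp add: a_assoc)
    ultimately show ?thesis using *(1) by blast
  next
    case 2
    let ?a = "a(n := a')" and ?b = "b(n := b')"
    have "(\<Oplus>i\<in>{..<Suc n}. ?a i \<otimes> ?b i) = ?a n \<otimes> ?b n \<oplus> (\<Oplus>i\<in>{..<n}. ?a i \<otimes> ?b i)"
      unfolding lessThan_Suc using c small_carrier[OF 2(2)] by (intro finsum_insert) auto
    also have "(\<Oplus>i\<in>{..<n}. ?a i \<otimes> ?b i) = (\<Oplus>i\<in>{..<n}. a i \<otimes> b i)"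
      using c by (intro finsum_cong') auto
    finally have "(\<Oplus>i\<in>{..<Suc n}. ?a i \<otimes> ?b i) = g \<oplus> (\<Oplus>i\<in>{..<n}. a i \<otimes> b i)" using 2 by simp
    then have "x \<oplus> g = (\<Oplus>i\<in>{..<Suc n}. ?a i \<otimes> ?b i) \<oplus> \<mu>"
      unfolding *(3) using Sc mc gc by (simp add: a_ac)
    moreover have "\<forall>i<Suc n. small (?a i) (?b i)" using *(1) 2(2) by (auto simp: less_Suc_eq)
    ultimately show ?thesis using *(2) by blast
  qed
qed

lemma one_not_in_kernel: "\<one> \<notin> add_span kernel_gens"
proof
  assume "\<one> \<in> add_span kernel_gens"
  then obtain n :: nat and a b \<mu> where *: "\<And>i. i < n \<Longrightarrow> small (a i) (b i)" "\<mu> \<in> nonunits V"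
    "\<one> = (\<Oplus>i\<in>{..<n}. a i \<otimes> b i) \<oplus> \<mu>" using kernel_form by blast
  have c: "a i \<in> carrier R" "b i \<in> carrier R" if "i < n" for i using small_carrier[OF *(1)[OF that]] by auto
  have Sc: "(\<Oplus>i\<in>{..<n}. a i \<otimes> b i) \<in> carrier R" using c by (intro finsum_closed) auto
  have mc: "\<mu> \<in> carrier R" using nonunits_subset[OF *(2)] Vs(4) by auto
  \<comment> \<open>The equation is brought to one side by adding the term
    \<open>\<ominus> \<one>\<close> times 1 at the free index \<open>n\<close>, which becomes the
    distinguished index of \<open>combination_not_nonunit\<close>.\<close>
  let ?a = "a(n := \<ominus> \<one>)" and ?b = "b(n := \<one>)"
  have "(\<Oplus>i\<in>{..<Suc n}. ?a i \<otimes> ?b i) = ?a n \<otimes> ?b n \<oplus> (\<Oplus>i\<in>{..<n}. ?a i \<otimes> ?b i)"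
    unfolding lessThan_Suc using c by (intro finsum_insert) auto
  also have "(\<Oplus>i\<in>{..<n}. ?a i \<otimes> ?b i) = (\<Oplus>i\<in>{..<n}. a i \<otimes> b i)"
    using c by (intro finsum_cong') auto
  also have "?a n \<otimes> ?b n \<oplus> \<dots> = \<ominus> ((\<Oplus>i\<in>{..<n}. a i \<otimes> b i) \<oplus> \<mu>) \<oplus> (\<Oplus>i\<in>{..<n}. a i \<otimes> b i)"
    unfolding *(3)[symmetric] by simp
  also have "\<dots> = \<ominus> \<mu>" using Sc mc by (simp add: minus_add a_ac l_neg r_neg)
  finally have "(\<Oplus>i\<in>{..<Suc n}. ?a i \<otimes> ?b i) \<in> nonunits V"
    using nonunits_uminus[OF Vs(1) *(2)] by simp
  moreover have "\<ominus> \<one> \<in> U" "\<ominus> \<one> \<notin> nonunits U"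
    using subringE(3,5)[OF Us(1)] nonunits_uminus[OF Us(1), of "\<ominus> \<one>"] one_not_nonunit[OF Us(1)] by auto
  then have "(\<Oplus>i\<in>{..<Suc n}. ?a i \<otimes> ?b i) \<notin> nonunits V"
    using *(1) by (intro combination_not_nonunit[of _ n]) auto
  ultimately show False by simp
qed

end

section \<open>The refined valuation ring and its residue fields\<close>

context residue_refinement
begin

lemma extension:
  "\<exists>V'. val_subring (carrier R) V' \<and> V' \<subseteq> V \<and> V' \<inter> k1 = W1 \<and> V' \<inter> k2 = W2 \<and>
    residually_disjoint k0 k1 k2 V'"
proof -
  let ?J = "add_span kernel_gens"
  note Jc = add_span_carrier[OF gens_carrier]
  have GJ: "x \<in> ?J" if "x \<in> kernel_gens" for x using add_span_incl[OF gens_carrier] that by auto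
  define R' where "R' = {r \<in> carrier R. \<forall>x\<in>?J. r \<otimes> x \<in> ?J}"
  have U1: "\<ominus> \<one> \<in> U" using subringE(3,5)[OF Us(1)] by auto
  have Jn: "\<ominus> x \<in> ?J" if "x \<in> ?J" for x
    using kernel_scale[OF that, of "\<ominus> \<one>"] U1 Jc that by (auto simp: l_minus)
  have R': "subring R' R"
    unfolding R'_def by (rule idealizer_subring[OF Jc add_span_add[OF gens_carrier] Jn])
  have JR: "?J \<subseteq> R'" unfolding R'_def using Jc kernel_mult by auto
  have UR: "U \<subseteq> R'" and W2R: "W2 \<subseteq> R'"
    unfolding R'_def using kernel_scale Us(4) W2s(4) by auto
  have "r \<otimes> a \<in> ?J" if "r \<in> R'" "a \<in> ?J" for r a using that unfolding R'_def by auto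
  then obtain H where H: "val_subring (carrier R) H" "R' \<subseteq> H" "?J \<subseteq> nonunits H"
    using chevalley_extension[OF R' JR add_span_add[OF gens_carrier] _ add_span.zero one_not_in_kernel]
    by blast
  note Hs = val_subringD[OF H(1)]
  \<comment> \<open>The Chevalley ring \<open>H\<close> has trace \<open>U\<close> on
    \<open>k1\<close>. Inverting the units of \<open>W1\<close> contained in \<open>U\<close> turns
    this trace into \<open>W1\<close>, since an element of \<open>W1\<close> outside
    \<open>U\<close> is the inverse of such a unit.\<close>
  define S where "S = {s \<in> U. s \<notin> nonunits W1}"
  have S: "s \<in> U" "s \<in> W1" "s \<in> carrier R" "s \<in> H" "s \<noteq> \<zero>" "inv s \<in> W1" if "s \<in> S" for s
    using that UW1 W1s(4) UR H(2) unitD[of s W1] unfolding S_def by auto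
  have S1: "\<one> \<in> S" unfolding S_def using subringE(3)[OF Us(1)] one_not_nonunit[OF W1s(1)] by auto
  have Sm: "s \<otimes> t \<in> S" if "s \<in> S" "t \<in> S" for s t
  proof -
    have "s \<otimes> t \<in> U" by (rule subringE(6)[OF Us(1) S(1)[OF that(1)] S(1)[OF that(2)]])
    moreover have "s \<otimes> t \<notin> nonunits W1"
      using units_mult(2)[OF W1s(1) S(2)[OF that(1)] _ S(2)[OF that(2)]] that unfolding S_def by auto
    ultimately show ?thesis unfolding S_def by auto
  qed
  \<comment> \<open>Localisation of \<open>H\<close> at \<open>S\<close>, written without fractions:
    a denominator from \<open>S\<close> moves \<open>x\<close> into \<open>H\<close>.\<close>
  define V' where "V' = {x \<in> carrier R. \<exists>s\<in>S. s \<otimes> x \<in> H}"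
  have HV: "H \<subseteq> V'" 
  proof
    fix x assume x: "x \<in> H"
    then have "\<one> \<otimes> x \<in> H" "x \<in> carrier R" using Hs(4) by auto
    then show "x \<in> V'" using S1 unfolding V'_def by blast
  qed
  have subV': "subring V' R"
  proof (rule subringI)
    show "V' \<subseteq> carrier R" unfolding V'_def by auto
    show "\<one> \<in> V'" using HV subringE(3)[OF Hs(1)] by auto
    fix x assume "x \<in> V'"
    then obtain s where x: "x \<in> carrier R" "s \<in> S" "s \<otimes> x \<in> H" unfolding V'_def by auto
    have "s \<otimes> (\<ominus> x) = \<ominus> (s \<otimes> x)" using x S by (simp add: r_minus)
    then have "s \<otimes> (\<ominus> x) \<in> H" using subringE(5)[OF Hs(1) x(3)] by simp
    then show "\<ominus> x \<in> V'" using x(1,2) a_inv_closed[OF x(1)] unfolding V'_def by blast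
    fix y assume "y \<in> V'"
    then obtain t where y: "y \<in> carrier R" "t \<in> S" "t \<otimes> y \<in> H" unfolding V'_def by auto
    have c: "s \<in> carrier R" "t \<in> carrier R" "s \<in> H" "t \<in> H" using x y S by auto
    have "(s \<otimes> t) \<otimes> (x \<otimes> y) = (s \<otimes> x) \<otimes> (t \<otimes> y)" using x(1) y(1) c by (simp add: m_ac)
    then have "(s \<otimes> t) \<otimes> (x \<otimes> y) \<in> H" using subringE(6)[OF Hs(1) x(3) y(3)] by simp
    then show "x \<otimes> y \<in> V'"
      using m_closed[OF x(1) y(1)] Sm[OF x(2) y(2)] unfolding V'_def by blast
    have "(s \<otimes> t) \<otimes> (x \<oplus> y) = t \<otimes> (s \<otimes> x) \<oplus> s \<otimes> (t \<otimes> y)" using x(1) y(1) c by algebra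
    then have "(s \<otimes> t) \<otimes> (x \<oplus> y) \<in> H"
      using subringE(7)[OF Hs(1) subringE(6)[OF Hs(1) c(4) x(3)] subringE(6)[OF Hs(1) c(3) y(3)]] by simp
    then show "x \<oplus> y \<in> V'"
      using a_closed[OF x(1) y(1)] Sm[OF x(2) y(2)] unfolding V'_def by blast
  qed
  have V': "val_subring (carrier R) V'"
    using subV' HV Hs(3) subringE(1) unfolding val_subring_def by blast
  note V's = val_subringD[OF V']
  text \<open>If \<open>inv x / s\<close> lies in the ideal \<open>J\<close>, then \<open>s x\<close> is the inverse of a nonunit of \<open>H\<close>.\<close>
  have exclude: "x \<notin> V'" if x: "x \<in> carrier R" "x \<noteq> \<zero>" "\<And>s. s \<in> S \<Longrightarrow> inv s \<otimes> inv x \<in> kernel_gens" for x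
  proof
    assume "x \<in> V'"
    then obtain s where s: "s \<in> S" "s \<otimes> x \<in> H" unfolding V'_def by auto
    have sc: "s \<in> carrier R" "s \<noteq> \<zero>" using S s by auto
    note i = nonzero_inv[OF sc] and ix = nonzero_inv[OF x(1,2)]
    have "inv s \<otimes> inv x \<in> nonunits H" using GJ[OF x(3)[OF s(1)]] H(3) by auto
    then have "(s \<otimes> x) \<otimes> (inv s \<otimes> inv x) \<in> nonunits H" by (rule nonunits_mult[OF Hs(1) s(2)])
    moreover have "(s \<otimes> x) \<otimes> (inv s \<otimes> inv x) = (s \<otimes> inv s) \<otimes> (x \<otimes> inv x)"
      using i(1) ix(1) sc x by (simp add: m_ac)
    ultimately show False using i(3) ix(3) one_not_nonunit[OF Hs(1)] by simp
  qed
  have k1c: "k1 \<subseteq> carrier R" and k2c: "k2 \<subseteq> carrier R" using subfieldE(3) k1 k2 by auto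
  have V'V: "V' \<subseteq> V"
  proof (rule ccontr)
    assume "\<not> V' \<subseteq> V"
    then obtain x where x: "x \<in> V'" "x \<notin> V" by auto
    have xc: "x \<in> carrier R" using x V's by auto
    note i = inv_in_nonunits[OF V carrier_is_subfield xc x(2)]
    \<comment> \<open>The inverse of \<open>s\<close> lies in \<open>W1\<close> and hence in
      \<open>V\<close>, so it is absorbed by the maximal ideal of \<open>V\<close>.\<close>
    have "inv s \<otimes> inv x \<in> kernel_gens" if "s \<in> S" for s
      using nonunits_mult[OF Vs(1) _ i(2)] S(6)[OF that] W1V unfolding kernel_gens_def by auto
    then show False using exclude[OF xc i(1)] x by auto
  qed
  have W1V': "W1 \<subseteq> V'"
  proof
    fix w assume w: "w \<in> W1"
    then have wc: "w \<in> carrier R" "w \<in> k1" using W1s by auto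
    show "w \<in> V'"
    proof (cases "w \<in> U")
      case True
      then show ?thesis using UR H(2) HV by auto
    next
      case False
      note i = inv_in_nonunits[OF U k1 wc(2) False]
      note iw = nonzero_inv[OF wc(1) i(1)]
      have "inv w \<notin> nonunits W1" using w iw unfolding nonunits_def by auto
      then have "inv w \<in> S" using nonunits_subset[OF i(2)] unfolding S_def by auto
      moreover have "inv w \<otimes> w \<in> H" using iw(4) subringE(3)[OF Hs(1)] by simp
      ultimately show ?thesis using wc(1) unfolding V'_def by blast
    qed
  qed
  have V'1: "V' \<inter> k1 = W1"
  proof (rule ccontr)
    assume "V' \<inter> k1 \<noteq> W1"
    then obtain x where x: "x \<in> V'" "x \<in> k1" "x \<notin> W1" using W1V' W1s(2) by auto
    have xc: "x \<in> carrier R" using x V's by auto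
    note i = inv_in_nonunits[OF W1 k1 x(2,3)]
    \<comment> \<open>The product is a nonunit of \<open>W1\<close>, hence of \<open>U\<close>;
      pairing it with 1 from \<open>W2\<close> makes it a generator.\<close>
    have "inv s \<otimes> inv x \<in> kernel_gens" if "s \<in> S" for s
    proof -
      have n: "inv s \<otimes> inv x \<in> nonunits U"
        using nonunits_mult[OF W1s(1) S(6)[OF that] i(2)] nonunits_W1 by auto
      then have "inv s \<otimes> inv x \<in> carrier R" using nonunits_subset[OF n] Us(4) by auto
      then have "inv s \<otimes> inv x = (inv s \<otimes> inv x) \<otimes> \<one>" by simp
      then show ?thesis
        using n subringE(3)[OF W2s(1)] unfolding kernel_gens_def small_def by blast
    qed
    then show False using exclude[OF xc i(1)] x by auto
  qed
  have V'2: "V' \<inter> k2 = W2"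
  proof (rule ccontr)
    assume "V' \<inter> k2 \<noteq> W2"
    then obtain x where x: "x \<in> V'" "x \<in> k2" "x \<notin> W2" using W2R H(2) HV W2s(2) by auto
    have xc: "x \<in> carrier R" using x V's by auto
    note i = inv_in_nonunits[OF W2 k2 x(2,3)]
    \<comment> \<open>Here the generators of the form \<open>W1\<close> times nonunits of
      \<open>W2\<close> are indispensable, as \<open>inv s\<close> need not belong to
      \<open>U\<close>.\<close>
    have "inv s \<otimes> inv x \<in> kernel_gens" if "s \<in> S" for s
      using S(6)[OF that] i(2) unfolding kernel_gens_def small_def by blast
    then show False using exclude[OF xc i(1)] x by auto
  qed
  have mH: "x \<in> nonunits H" if "x \<in> nonunits V'" for x
    using nonunits_antimono[OF H(1) HV V's(2)] that by auto
  have m1: "x \<in> nonunits W1" if "x \<in> nonunits V'" "x \<in> k1" for x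
    using that nonunits_inter[OF k1, of V'] V'1 by auto
  have m1': "x \<in> nonunits V'" if "x \<in> nonunits W1" for x
    using that nonunits_inter[OF k1, of V'] V'1 by auto
  have "residually_disjoint k0 k1 k2 V'"
    unfolding residually_disjoint_def
  proof (intro allI impI, elim conjE)
    fix I :: "nat set" and a b
    assume fin: "finite I" and a: "a ` I \<subseteq> V' \<inter> k1" and b: "b ` I \<subseteq> V' \<inter> k2"
      and sum: "(\<Oplus>i\<in>I. a i \<otimes> b i) \<in> nonunits V'" and ex: "\<exists>i\<in>I. a i \<notin> nonunits V'"
    have aW: "a i \<in> W1" "a i \<in> k1" "a i \<in> carrier R" if "i \<in> I" for i using a that V'1 W1s(4) by auto
    have bW: "b i \<in> W2" "b i \<in> carrier R" if "i \<in> I" for i using b that V'2 W2s(4) by auto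
    obtain i1 where i1: "i1 \<in> I" "a i1 \<notin> nonunits V'" using ex by auto
    then have "a i1 \<noteq> \<zero>" using nonunits_zero[OF V's(1)] by auto
    \<comment> \<open>The dominant coefficient is chosen with respect to \<open>U\<close>, since
      only elements of \<open>U\<close> are known to have residues in \<open>k0\<close>.\<close>
    then obtain l where l: "l \<in> I" "a l \<noteq> \<zero>" "\<And>i. i \<in> I \<Longrightarrow> inv (a l) \<otimes> a i \<in> U"
      using exists_dominant[of k1 U I a i1, OF U k1 fin aW(2) i1(1)] by blast
    note il = nonzero_inv[OF aW(3)[OF l(1)] l(2)]
    have "a l \<notin> nonunits W1"
    proof
      assume "a l \<in> nonunits W1"
      then have "(inv (a l) \<otimes> a i1) \<otimes> a l \<in> nonunits W1"
        using l(3)[OF i1(1)] UW1 by (intro nonunits_mult[OF W1s(1)]) auto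
      moreover have "(inv (a l) \<otimes> a i1) \<otimes> a l = (a l \<otimes> inv (a l)) \<otimes> a i1"
        using il(1) aW(3)[OF l(1)] aW(3)[OF i1(1)] by (simp add: m_ac)
      ultimately show False using m1' i1(2) il(3) aW(3)[OF i1(1)] by simp
    qed
    then have ilV: "inv (a l) \<in> V'" using unitD(2)[OF aW(1)[OF l(1)]] W1V' by auto
    \<comment> \<open>Rationality of \<open>U\<close> replaces each coefficient by a scalar. The
      errors \<open>e i\<close> lie in the maximal ideal of \<open>U\<close>, so their products with
      \<open>b i\<close> are nonunits of \<open>H\<close> by construction.\<close>
    have "\<forall>i\<in>I. \<exists>c. c \<in> U \<inter> k0 \<and> inv (a l) \<otimes> a i \<ominus> c \<in> nonunits U" using rational l(3) by blast
    then obtain c where c: "\<And>i. i \<in> I \<Longrightarrow> c i \<in> U \<inter> k0"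
      "\<And>i. i \<in> I \<Longrightarrow> inv (a l) \<otimes> a i \<ominus> c i \<in> nonunits U" by metis
    have cc: "c i \<in> carrier R" if "i \<in> I" for i using c(1)[OF that] Us(4) by auto
    have cV: "c i \<in> V' \<inter> k0" if "i \<in> I" for i using c(1)[OF that] UW1 W1V' by auto
    define e where "e i = inv (a l) \<otimes> a i \<ominus> c i" for i
    have ec: "e i \<in> carrier R" if "i \<in> I" for i unfolding e_def using il(1) aW that cc by auto
    have UH: "x \<otimes> y \<in> nonunits H" if "x \<in> nonunits U" "y \<in> W2" for x y
      using GJ[of "x \<otimes> y"] that H(3) unfolding kernel_gens_def small_def by blast
    have "(\<Oplus>i\<in>I. (inv (a l) \<otimes> a i) \<otimes> b i) = (\<Oplus>i\<in>I. inv (a l) \<otimes> (a i \<otimes> b i))"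
      using aW bW il by (intro finsum_cong') (auto simp: m_assoc)
    also have "\<dots> = inv (a l) \<otimes> (\<Oplus>i\<in>I. a i \<otimes> b i)"
      using aW bW il fin by (intro finsum_smult) auto
    finally have 1: "(\<Oplus>i\<in>I. (inv (a l) \<otimes> a i) \<otimes> b i) \<in> nonunits H"
      using nonunits_mult[OF V's(1) ilV sum] mH by simp
    have 2: "(\<Oplus>i\<in>I. e i \<otimes> b i) \<in> nonunits H"
    proof (rule finsum_mem)
      show "nonunits H \<subseteq> carrier R" using nonunits_subset Hs(4) by auto
    qed (use nonunits_zero[OF Hs(1)] nonunits_add[OF H(1) carrier_is_subfield] UH c(2) bW
        in \<open>auto simp: e_def\<close>)
    have "(\<Oplus>i\<in>I. c i \<otimes> b i) = (\<Oplus>i\<in>I. (inv (a l) \<otimes> a i \<ominus> \<one> \<otimes> e i) \<otimes> b i)"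
    proof (intro finsum_cong')
      fix i assume i: "i \<in> I"
      have "inv (a l) \<otimes> a i \<ominus> \<one> \<otimes> e i = c i"
        unfolding e_def using il(1) aW(3)[OF i] cc[OF i] by algebra
      then show "c i \<otimes> b i = (inv (a l) \<otimes> a i \<ominus> \<one> \<otimes> e i) \<otimes> b i" by simp
    qed (use il(1) aW ec bW in auto)
    also have "\<dots> = (\<Oplus>i\<in>I. (inv (a l) \<otimes> a i) \<otimes> b i) \<ominus> \<one> \<otimes> (\<Oplus>i\<in>I. e i \<otimes> b i)"
      using il(1) aW(3) ec bW(2) fin by (intro finsum_smult_diff) auto
    also have "\<dots> = (\<Oplus>i\<in>I. (inv (a l) \<otimes> a i) \<otimes> b i) \<oplus> \<ominus> (\<Oplus>i\<in>I. e i \<otimes> b i)"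
      using 2 nonunits_subset Hs(4) by (simp add: a_minus_def subset_iff)
    finally have cH: "(\<Oplus>i\<in>I. c i \<otimes> b i) \<in> nonunits H"
      using nonunits_add[OF H(1) carrier_is_subfield 1 nonunits_uminus[OF Hs(1) 2]] by simp
    have "c i \<otimes> b i \<in> W2" if "i \<in> I" for i
      using c(1)[OF that] bW(1)[OF that] UW0 W12 subringE(6)[OF W2s(1)] by auto
    then have c2: "(\<Oplus>i\<in>I. c i \<otimes> b i) \<in> W2"
      using subringE(2,7)[OF W2s(1)] W2s(4) by (intro finsum_mem) auto
    \<comment> \<open>So far the sum is a nonunit of \<open>H\<close> only, which is weaker than the
      claim for \<open>V'\<close>. But it lies in \<open>k2\<close>, where \<open>V'\<close> has
      trace \<open>W2\<close>; an inverse in \<open>V'\<close> would thus lie in \<open>W2\<close>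
      and so in \<open>H\<close>.\<close>
    have cs: "(\<Oplus>i\<in>I. c i \<otimes> b i) \<in> nonunits V'"
    proof (rule ccontr)
      assume neg: "(\<Oplus>i\<in>I. c i \<otimes> b i) \<notin> nonunits V'"
      have V'c: "(\<Oplus>i\<in>I. c i \<otimes> b i) \<in> V'" using c2 V'2 by auto
      note u = unitD[OF V'c neg]
      have "inv (\<Oplus>i\<in>I. c i \<otimes> b i) \<in> k2"
        using subfield_m_inv(1)[OF k2, of "\<Oplus>i\<in>I. c i \<otimes> b i"] c2 W2s(2) u(1) by auto
      then have "inv (\<Oplus>i\<in>I. c i \<otimes> b i) \<in> H" using u(2) V'2 W2R H(2) by blast
      then show False using cH u(1) unfolding nonunits_def by auto
    qed
    \<comment> \<open>The normalised coefficient at \<open>l\<close> is 1, so \<open>c l\<close> has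
      residue 1.\<close>
    have "c l \<notin> nonunits V'"
    proof
      assume "c l \<in> nonunits V'"
      then have "c l \<in> nonunits U" using m1 nonunits_W1 c(1)[OF l(1)] k01 by auto
      then have "e l \<oplus> c l \<in> nonunits U"
        using nonunits_add[OF U k1] c(2)[OF l(1)] unfolding e_def by blast
      moreover have "e l \<oplus> c l = inv (a l) \<otimes> a l"
        unfolding e_def using il(1) aW(3)[OF l(1)] cc[OF l(1)] by algebra
      ultimately show False using il(4) one_not_nonunit[OF Us(1)] by simp
    qed
    then show "\<exists>c. c ` I \<subseteq> V' \<inter> k0 \<and> (\<exists>i\<in>I. c i \<notin> nonunits V') \<and> (\<Oplus>i\<in>I. c i \<otimes> b i) \<in> nonunits V'"
      using cV l(1) cs by blast
  qed
  then show ?thesis using V' V'V V'1 V'2 by blast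
qed

end

text \<open>The auxiliary ring \<open>U\<close> is chosen here and disappears; in this form the step
  is applied along every edge of the tree.\<close>

theorem (in field) residually_disjoint_extension:
  assumes k: "subfield k0 R" "subfield k1 R" "subfield k2 R" "k0 \<subseteq> k1" "k0 \<subseteq> k2" "root_closed k0"
    and V: "val_subring (carrier R) V" "residually_disjoint k0 k1 k2 V"
    and W: "val_subring k1 W1" "W1 \<subseteq> V" "val_subring k2 W2" "W2 \<subseteq> V" "W1 \<inter> k0 = W2 \<inter> k0"
  shows "\<exists>V'. val_subring (carrier R) V' \<and> V' \<subseteq> V \<and> V' \<inter> k1 = W1 \<and> V' \<inter> k2 = W2 \<and>
    residually_disjoint k0 k1 k2 V'"
proof -
  obtain U where U: "val_subring k1 U" "U \<subseteq> W1" "U \<inter> k0 = W1 \<inter> k0"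
    "\<forall>x\<in>U. \<exists>c\<in>U \<inter> k0. x \<ominus> c \<in> nonunits U"
    using rational_refinement[OF k(1,6,2,4) W(1)] by blast
  interpret residue_refinement R k0 k1 k2 V W1 W2 U
    by (intro residue_refinement.intro field_axioms residue_refinement_axioms.intro) (fact k(1-5) V W U(1-3) | rule U(4)[THEN bspec])+
  show ?thesis by (rule extension)
qed

section \<open>The tensor product\<close>

text \<open>Additivity in the function instead of the chain; it yields distributivity in the second
  factor of the monoid ring.\<close>

lemma frag_extend_fun_diff: "frag_extend (\<lambda>x. f x - g x) c = frag_extend f c - frag_extend g c"
proof -
  have "Poly_Mapping.keys c \<subseteq> UNIV" by simp
  then show ?thesis by (induction c rule: frag_induction) (auto simp: frag_extend_diff)
qed

lemma frag_extend_zero_fun [simp]: "frag_extend (\<lambda>x. 0) c = 0"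
  by (rule frag_extend_eq_0) simp

section \<open>The integral monoid ring is a commutative ring\<close>

context comm_monoid
begin

text \<open>Stated for differences because \<open>frag_induction\<close> builds chains from
  generators by subtraction.\<close>

lemma monoid_ring_diff_left:
  "(c - c') \<otimes>\<^bsub>integral_monoid_ring G\<^esub> d =
    c \<otimes>\<^bsub>integral_monoid_ring G\<^esub> d - c' \<otimes>\<^bsub>integral_monoid_ring G\<^esub> d"
  by (simp add: integral_monoid_ring_def frag_extend_diff)

lemma monoid_ring_diff_right:
  "c \<otimes>\<^bsub>integral_monoid_ring G\<^esub> (d - d') =
    c \<otimes>\<^bsub>integral_monoid_ring G\<^esub> d - c \<otimes>\<^bsub>integral_monoid_ring G\<^esub> d'"
  by (simp add: integral_monoid_ring_def frag_extend_diff frag_extend_fun_diff)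

lemma monoid_ring_zero [simp]:
  "0 \<otimes>\<^bsub>integral_monoid_ring G\<^esub> d = 0" "c \<otimes>\<^bsub>integral_monoid_ring G\<^esub> 0 = 0"
  by (simp_all add: integral_monoid_ring_def)

lemma monoid_ring_frag_of [simp]:
  "frag_of x \<otimes>\<^bsub>integral_monoid_ring G\<^esub> frag_of y = frag_of (x \<otimes> y)"
  by (simp add: integral_monoid_ring_def)

lemma monoid_ring_carrier:
  "c \<in> carrier (integral_monoid_ring G) \<longleftrightarrow> Poly_Mapping.keys c \<subseteq> carrier G"
  by (simp add: integral_monoid_ring_def)

lemma monoid_ring_closed:
  assumes "Poly_Mapping.keys c \<subseteq> carrier G" "Poly_Mapping.keys d \<subseteq> carrier G"
  shows "Poly_Mapping.keys (c \<otimes>\<^bsub>integral_monoid_ring G\<^esub> d) \<subseteq> carrier G"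
  using assms(1)
proof (induction c rule: frag_induction)
  case (one x)
  show ?case using assms(2)
  proof (induction d rule: frag_induction)
    case (diff a b)
    then show ?case using keys_diff by (fastforce simp: monoid_ring_diff_right)
  qed (use one in auto)
next
  case (diff a b)
  then show ?case using keys_diff by (fastforce simp: monoid_ring_diff_left)
qed auto

lemma monoid_ring_comm:
  assumes "Poly_Mapping.keys c \<subseteq> carrier G" "Poly_Mapping.keys d \<subseteq> carrier G"
  shows "c \<otimes>\<^bsub>integral_monoid_ring G\<^esub> d = d \<otimes>\<^bsub>integral_monoid_ring G\<^esub> c"
  using assms(1)
proof (induction c rule: frag_induction)
  case (one x)
  show ?case using assms(2)
    by (induction d rule: frag_induction)
      (use one in \<open>auto simp: monoid_ring_diff_right monoid_ring_diff_left m_comm\<close>)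
qed (auto simp: monoid_ring_diff_right monoid_ring_diff_left)

lemma monoid_ring_assoc:
  assumes "Poly_Mapping.keys c \<subseteq> carrier G" "Poly_Mapping.keys d \<subseteq> carrier G"
    "Poly_Mapping.keys e \<subseteq> carrier G"
  shows "(c \<otimes>\<^bsub>integral_monoid_ring G\<^esub> d) \<otimes>\<^bsub>integral_monoid_ring G\<^esub> e =
    c \<otimes>\<^bsub>integral_monoid_ring G\<^esub> (d \<otimes>\<^bsub>integral_monoid_ring G\<^esub> e)"
  using assms(1)
proof (induction c rule: frag_induction)
  case (one x)
  show ?case using assms(2)
  proof (induction d rule: frag_induction)
    case (one y)
    show ?case using assms(3)
      by (induction e rule: frag_induction)
        (use one \<open>x \<in> carrier G\<close> in \<open>auto simp: monoid_ring_diff_right m_assoc\<close>)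
  qed (auto simp: monoid_ring_diff_right monoid_ring_diff_left)
qed (auto simp: monoid_ring_diff_left)

lemma cring_integral_monoid_ring: "cring (integral_monoid_ring G)"
proof (rule cringI)
  let ?A = "integral_monoid_ring G"
  have [simp]: "\<zero>\<^bsub>?A\<^esub> = 0" "a \<oplus>\<^bsub>?A\<^esub> b = a + b" "\<one>\<^bsub>?A\<^esub> = frag_of \<one>" for a b
    by (simp_all add: integral_monoid_ring_def)
  show "abelian_group ?A"
  proof (rule abelian_groupI)
    fix x assume "x \<in> carrier ?A"
    then show "\<exists>y\<in>carrier ?A. y \<oplus>\<^bsub>?A\<^esub> x = \<zero>\<^bsub>?A\<^esub>"
      by (intro bexI[of _ "-x"]) (auto simp: monoid_ring_carrier)
  next
    fix x y assume "x \<in> carrier ?A" "y \<in> carrier ?A"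
    then show "x \<oplus>\<^bsub>?A\<^esub> y \<in> carrier ?A"
      using keys_add[of x y] by (auto simp: monoid_ring_carrier)
  qed (auto simp: monoid_ring_carrier)
  show "comm_monoid ?A"
  proof (rule comm_monoidI)
    fix x assume "x \<in> carrier ?A"
    then have "Poly_Mapping.keys x \<subseteq> carrier G" by (simp add: monoid_ring_carrier)
    then show "\<one>\<^bsub>?A\<^esub> \<otimes>\<^bsub>?A\<^esub> x = x"
      by (induction x rule: frag_induction) (auto simp: monoid_ring_diff_right)
  qed (auto simp: monoid_ring_carrier monoid_ring_assoc intro: monoid_ring_comm
      dest: monoid_ring_closed[THEN subsetD, rotated 2])
  \<comment> \<open>Addition is rewritten as subtraction of \<open>-y\<close>, and \<open>-y\<close>
    as \<open>0 - y\<close>.\<close>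
  show "(x \<oplus>\<^bsub>?A\<^esub> y) \<otimes>\<^bsub>?A\<^esub> z = x \<otimes>\<^bsub>?A\<^esub> z \<oplus>\<^bsub>?A\<^esub> y \<otimes>\<^bsub>?A\<^esub> z" for x y z
    using monoid_ring_diff_left[of x "-y" z] monoid_ring_diff_left[of 0 y z] by simp
qed

end

lemma (in ring) add_span_finsum:
  assumes G: "G \<subseteq> carrier R" and x: "x \<in> add_span G"
  shows "\<exists>(n::nat) g. (\<forall>i<n. g i \<in> G) \<and> x = (\<Oplus>i\<in>{..<n}. g i)"
  using x
proof induction
  case zero
  show ?case by (intro exI[of _ 0]) auto
next
  case (add x h)
  then obtain n :: nat and g where g: "\<And>i. i < n \<Longrightarrow> g i \<in> G" "x = (\<Oplus>i\<in>{..<n}. g i)" by blast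
  have "(\<Oplus>i\<in>{..<Suc n}. (g(n := h)) i) = h \<oplus> (\<Oplus>i\<in>{..<n}. (g(n := h)) i)"
    unfolding lessThan_Suc using g(1) add(2) G by (subst finsum_insert) auto
  also have "(\<Oplus>i\<in>{..<n}. (g(n := h)) i) = x"
    unfolding g(2) using g(1) G by (intro finsum_cong') auto
  also have "h \<oplus> x = x \<oplus> h" using add G add_span_carrier[OF G] by (intro a_comm) auto
  finally show ?case
    using g(1) add(2) by (intro exI[of _ "Suc n"] exI[of _ "g(n := h)"]) (auto simp: less_Suc_eq)
qed

text \<open>Only additivity of \<open>h\<close> is assumed, so that this also covers the base change
  of the residue map and the map sending \<open>b\<close> to a pure tensor with fixed left factor;
  neither need be multiplicative.\<close>

lemma finsum_hom:
  assumes "abelian_monoid G" "abelian_monoid H" and f: "f \<in> I \<rightarrow> carrier G" and "finite I"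
    and h: "\<And>x. x \<in> carrier G \<Longrightarrow> h x \<in> carrier H"
      "\<And>x y. x \<in> carrier G \<Longrightarrow> y \<in> carrier G \<Longrightarrow> h (x \<oplus>\<^bsub>G\<^esub> y) = h x \<oplus>\<^bsub>H\<^esub> h y" "h \<zero>\<^bsub>G\<^esub> = \<zero>\<^bsub>H\<^esub>"
  shows "h (\<Oplus>\<^bsub>G\<^esub>i\<in>I. f i) = (\<Oplus>\<^bsub>H\<^esub>i\<in>I. h (f i))"
proof -
  interpret G: abelian_monoid G by fact
  interpret H: abelian_monoid H by fact
  show ?thesis
    using assms(4) f
  proof (induction I rule: finite_induct)
    case empty
    then show ?case by (simp add: h(3))
  next
    case (insert i I)
    then have c: "f \<in> I \<rightarrow> carrier G" "f i \<in> carrier G" by auto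
    have "(\<lambda>i. h (f i)) \<in> I \<rightarrow> carrier H" using c(1) h(1) by (simp add: Pi_iff)
    then show ?case
      using insert.hyps insert.IH[OF c(1)] c h(1) h(2)[OF c(2) G.finsum_closed[OF c(1)]] by simp
  qed
qed

section \<open>The tensor product of two commutative algebras and its universal property\<close>

locale algebra_pair = K0: cring K0 + K1: cring K1 + K2: cring K2
  for K0 :: "('a, 'k) ring_scheme" and K1 :: "('b, 'm) ring_scheme" and K2 :: "('c, 'n) ring_scheme" +
  fixes g1 :: "'a \<Rightarrow> 'b" and g2 :: "'a \<Rightarrow> 'c"
  assumes g1: "g1 \<in> ring_hom K0 K1" and g2: "g2 \<in> ring_hom K0 K2"
begin

abbreviation "A \<equiv> integral_monoid_ring (K1 \<times>\<times> K2)"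
abbreviation "J \<equiv> tensor_ideal K0 K1 K2 g1 g2"
abbreviation "T \<equiv> tensor_ring K0 K1 K2 g1 g2"
abbreviation "pure \<equiv> pure_tensor K0 K1 K2 g1 g2"

sublocale M: comm_monoid "K1 \<times>\<times> K2"
  by (rule comm_monoidI) (auto simp: K1.m_ac K2.m_ac)

sublocale A: cring A
  by (rule M.cring_integral_monoid_ring)

lemma A_simps [simp]:
  "\<zero>\<^bsub>A\<^esub> = 0" "a \<oplus>\<^bsub>A\<^esub> b = a + b" "\<one>\<^bsub>A\<^esub> = frag_of (\<one>\<^bsub>K1\<^esub>, \<one>\<^bsub>K2\<^esub>)"
  by (simp_all add: integral_monoid_ring_def)

lemma A_carrier: "c \<in> carrier A \<longleftrightarrow> Poly_Mapping.keys c \<subseteq> carrier K1 \<times> carrier K2"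
  using M.monoid_ring_carrier by simp

lemma frag_of_A: "a \<in> carrier K1 \<Longrightarrow> b \<in> carrier K2 \<Longrightarrow> frag_of (a, b) \<in> carrier A"
  by (simp add: A_carrier)

lemma A_uminus: "c \<in> carrier A \<Longrightarrow> \<ominus>\<^bsub>A\<^esub> c = - c"
  by (rule A.minus_equality) (auto simp: A_carrier)

lemma A_minus: "c \<in> carrier A \<Longrightarrow> d \<in> carrier A \<Longrightarrow> c \<ominus>\<^bsub>A\<^esub> d = c - d"
  by (simp add: a_minus_def A_uminus)

lemma hom1: "x \<in> carrier K0 \<Longrightarrow> g1 x \<in> carrier K1" and hom2: "x \<in> carrier K0 \<Longrightarrow> g2 x \<in> carrier K2"
  using ring_hom_closed g1 g2 by metis+

lemma relations_carrier: "tensor_relations K0 K1 K2 g1 g2 \<subseteq> carrier A"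
proof -
  have "c - d \<in> carrier A" if "c \<in> carrier A" "d \<in> carrier A" for c d
    using that A.minus_closed[of c d] by (simp add: A_minus)
  then show ?thesis
    unfolding tensor_relations_def using frag_of_A hom1 hom2 by auto
qed

sublocale J: ideal J A
  unfolding tensor_ideal_def by (rule A.genideal_ideal[OF relations_carrier])

lemma relations_J: "tensor_relations K0 K1 K2 g1 g2 \<subseteq> J"
  unfolding tensor_ideal_def by (rule A.genideal_self[OF relations_carrier])

sublocale T: cring T
  unfolding tensor_ring_def by (rule J.quotient_is_cring[OF A.cring_axioms])

abbreviation "proj \<equiv> (+>\<^bsub>A\<^esub>) J"

sublocale proj: ring_hom_ring A T proj
  unfolding tensor_ring_def by (rule J.rcos_ring_hom_ring)

lemma pure_proj: "pure a b = proj (frag_of (a, b))"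
  unfolding pure_tensor_def ..

lemma pure_closed [simp]: "a \<in> carrier K1 \<Longrightarrow> b \<in> carrier K2 \<Longrightarrow> pure a b \<in> carrier T"
  unfolding pure_proj using frag_of_A by auto

lemma proj_surj: "u \<in> carrier T \<Longrightarrow> \<exists>c\<in>carrier A. u = proj c"
  unfolding tensor_ring_def FactRing_def A_RCOSETS_def' by auto

lemma proj_eq: "c \<in> carrier A \<Longrightarrow> d \<in> carrier A \<Longrightarrow> c - d \<in> J \<longleftrightarrow> proj c = proj d"
  using A.quotient_eq_iff_same_a_r_cos[OF J.ideal_axioms, of c d] by (simp add: A_minus)

lemma pure_mult:
  assumes "a \<in> carrier K1" "b \<in> carrier K2" "a' \<in> carrier K1" "b' \<in> carrier K2"
  shows "pure a b \<otimes>\<^bsub>T\<^esub> pure a' b' = pure (a \<otimes>\<^bsub>K1\<^esub> a') (b \<otimes>\<^bsub>K2\<^esub> b')"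
  unfolding pure_proj using assms by (subst proj.hom_mult[symmetric]) (auto simp: frag_of_A)

lemma pure_one: "pure \<one>\<^bsub>K1\<^esub> \<one>\<^bsub>K2\<^esub> = \<one>\<^bsub>T\<^esub>"
  unfolding pure_proj using proj.hom_one by simp

lemma pure_add_left:
  assumes "a \<in> carrier K1" "a' \<in> carrier K1" "b \<in> carrier K2"
  shows "pure (a \<oplus>\<^bsub>K1\<^esub> a') b = pure a b \<oplus>\<^bsub>T\<^esub> pure a' b"
proof -
  have "frag_of (a \<oplus>\<^bsub>K1\<^esub> a', b) - frag_of (a, b) - frag_of (a', b) \<in> J"
    using relations_J assms unfolding tensor_relations_def by blast
  then have "frag_of (a \<oplus>\<^bsub>K1\<^esub> a', b) - (frag_of (a, b) + frag_of (a', b)) \<in> J"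
    by (simp add: diff_diff_add)
  moreover have c: "frag_of (a, b) \<in> carrier A" "frag_of (a', b) \<in> carrier A" "frag_of (a \<oplus>\<^bsub>K1\<^esub> a', b) \<in> carrier A"
    using assms frag_of_A by auto
  moreover have "frag_of (a, b) + frag_of (a', b) \<in> carrier A"
    using A.a_closed[OF c(1,2)] by simp
  ultimately have "pure (a \<oplus>\<^bsub>K1\<^esub> a') b = proj (frag_of (a, b) \<oplus>\<^bsub>A\<^esub> frag_of (a', b))"
    unfolding pure_proj using proj_eq by simp
  then show ?thesis using proj.hom_add[OF c(1,2)] unfolding pure_proj by simp
qed

lemma pure_add_right:
  assumes "a \<in> carrier K1" "b \<in> carrier K2" "b' \<in> carrier K2"
  shows "pure a (b \<oplus>\<^bsub>K2\<^esub> b') = pure a b \<oplus>\<^bsub>T\<^esub> pure a b'"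
proof -
  have "frag_of (a, b \<oplus>\<^bsub>K2\<^esub> b') - frag_of (a, b) - frag_of (a, b') \<in> J"
    using relations_J assms unfolding tensor_relations_def by blast
  then have "frag_of (a, b \<oplus>\<^bsub>K2\<^esub> b') - (frag_of (a, b) + frag_of (a, b')) \<in> J"
    by (simp add: diff_diff_add)
  moreover have c: "frag_of (a, b) \<in> carrier A" "frag_of (a, b') \<in> carrier A" "frag_of (a, b \<oplus>\<^bsub>K2\<^esub> b') \<in> carrier A"
    using assms frag_of_A by auto
  moreover have "frag_of (a, b) + frag_of (a, b') \<in> carrier A"
    using A.a_closed[OF c(1,2)] by simp
  ultimately have "pure a (b \<oplus>\<^bsub>K2\<^esub> b') = proj (frag_of (a, b) \<oplus>\<^bsub>A\<^esub> frag_of (a, b'))"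
    unfolding pure_proj using proj_eq by simp
  then show ?thesis using proj.hom_add[OF c(1,2)] unfolding pure_proj by simp
qed

lemma pure_balanced:
  assumes "r \<in> carrier K0" "a \<in> carrier K1" "b \<in> carrier K2"
  shows "pure (g1 r \<otimes>\<^bsub>K1\<^esub> a) b = pure a (g2 r \<otimes>\<^bsub>K2\<^esub> b)"
proof -
  have "frag_of (g1 r \<otimes>\<^bsub>K1\<^esub> a, b) - frag_of (a, g2 r \<otimes>\<^bsub>K2\<^esub> b) \<in> J"
    using relations_J assms unfolding tensor_relations_def by blast
  then show ?thesis unfolding pure_proj using proj_eq assms hom1 hom2 frag_of_A by simp
qed

lemma pure_zero:
  shows "b \<in> carrier K2 \<Longrightarrow> pure \<zero>\<^bsub>K1\<^esub> b = \<zero>\<^bsub>T\<^esub>" "a \<in> carrier K1 \<Longrightarrow> pure a \<zero>\<^bsub>K2\<^esub> = \<zero>\<^bsub>T\<^esub>"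
  using pure_add_left[of "\<zero>\<^bsub>K1\<^esub>" "\<zero>\<^bsub>K1\<^esub>" b] pure_add_right[of a "\<zero>\<^bsub>K2\<^esub>" "\<zero>\<^bsub>K2\<^esub>"]
    T.add.l_cancel_one'[of "pure \<zero>\<^bsub>K1\<^esub> b" "pure \<zero>\<^bsub>K1\<^esub> b"]
    T.add.l_cancel_one'[of "pure a \<zero>\<^bsub>K2\<^esub>" "pure a \<zero>\<^bsub>K2\<^esub>"] by simp_all

lemma pure_hom_left: "(\<lambda>a. pure a \<one>\<^bsub>K2\<^esub>) \<in> ring_hom K1 T"
  by (rule ring_hom_memI) (auto simp: pure_mult pure_add_left pure_one)

lemma pure_hom_right: "(\<lambda>b. pure \<one>\<^bsub>K1\<^esub> b) \<in> ring_hom K2 T"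
  by (rule ring_hom_memI) (auto simp: pure_mult pure_add_right pure_one)

text \<open>Integer coefficients cause no trouble: signs are absorbed into the left factor, so plain
  sums of pure tensors suffice.\<close>

lemma pure_span: "carrier T \<subseteq> T.add_span {pure a b | a b. a \<in> carrier K1 \<and> b \<in> carrier K2}"
    (is "_ \<subseteq> T.add_span ?G")
proof
  have G: "?G \<subseteq> carrier T" by auto
  have neg: "\<ominus>\<^bsub>T\<^esub> x \<in> T.add_span ?G" if "x \<in> T.add_span ?G" for x
  proof -
    have "(\<ominus>\<^bsub>T\<^esub> \<one>\<^bsub>T\<^esub>) \<otimes>\<^bsub>T\<^esub> x \<in> T.add_span ?G"
    proof (rule T.add_span_mult[OF G _ _ that])
      fix g assume "g \<in> ?G"
      then obtain a b where g: "g = pure a b" "a \<in> carrier K1" "b \<in> carrier K2" by auto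
      have "pure (\<ominus>\<^bsub>K1\<^esub> a) b \<oplus>\<^bsub>T\<^esub> pure a b = \<zero>\<^bsub>T\<^esub>"
        using g pure_add_left[of "\<ominus>\<^bsub>K1\<^esub> a" a b] by (simp add: K1.l_neg pure_zero)
      then have "\<ominus>\<^bsub>T\<^esub> pure a b = pure (\<ominus>\<^bsub>K1\<^esub> a) b" using g by (intro T.minus_equality) auto
      then have "(\<ominus>\<^bsub>T\<^esub> \<one>\<^bsub>T\<^esub>) \<otimes>\<^bsub>T\<^esub> g = pure (\<ominus>\<^bsub>K1\<^esub> a) b" using g by (simp add: T.l_minus)
      then show "(\<ominus>\<^bsub>T\<^esub> \<one>\<^bsub>T\<^esub>) \<otimes>\<^bsub>T\<^esub> g \<in> T.add_span ?G"
        using T.add_span_incl[OF G, THEN subsetD, of "pure (\<ominus>\<^bsub>K1\<^esub> a) b"] g(2,3) by auto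
    qed simp
    then show ?thesis using T.add_span_carrier[OF G] that by (auto simp: T.l_minus)
  qed
  fix u assume "u \<in> carrier T"
  then obtain c where c: "c \<in> carrier A" "u = proj c" using proj_surj by auto
  have "Poly_Mapping.keys c \<subseteq> carrier K1 \<times> carrier K2" using c A_carrier by auto
  then have "c \<in> carrier A \<and> proj c \<in> T.add_span ?G"
  proof (induction c rule: frag_induction)
    case zero
    then show ?case using proj.hom_zero T.add_span.zero by (simp add: A_carrier)
  next
    case (one x)
    then have "proj (frag_of x) \<in> ?G" using pure_proj by (cases x) auto
    then show ?case using T.add_span_incl[OF G] one by (auto simp: A_carrier)
  next
    case (diff a b)
    then have ab: "a \<in> carrier A" "b \<in> carrier A" by auto
    have "proj (a \<ominus>\<^bsub>A\<^esub> b) = proj a \<oplus>\<^bsub>T\<^esub> \<ominus>\<^bsub>T\<^esub> proj b"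
      unfolding a_minus_def using ab by (simp del: A_simps)
    then have "proj (a - b) = proj a \<oplus>\<^bsub>T\<^esub> \<ominus>\<^bsub>T\<^esub> proj b" using ab by (simp add: A_minus)
    moreover have "a - b \<in> carrier A" using A.minus_closed[OF ab] ab by (simp add: A_minus)
    ultimately show ?case
      using T.add_span_add[OF G] neg diff by simp
  qed
  then show "u \<in> T.add_span ?G" using c by auto
qed

text \<open>The map extends freely to the group of chains; what needs care is that it vanishes on
  the whole ideal, although the map is merely additive while the ideal is generated by
  multiplication too.\<close>

lemma bilinear_extension:
  fixes \<phi> :: "'b \<Rightarrow> 'c \<Rightarrow> 'd" and L :: "('d, 'l) ring_scheme"
  assumes "abelian_group L"
    and closed: "\<And>a b. a \<in> carrier K1 \<Longrightarrow> b \<in> carrier K2 \<Longrightarrow> \<phi> a b \<in> carrier L"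
    and add1: "\<And>a a' b. a \<in> carrier K1 \<Longrightarrow> a' \<in> carrier K1 \<Longrightarrow> b \<in> carrier K2 \<Longrightarrow>
      \<phi> (a \<oplus>\<^bsub>K1\<^esub> a') b = \<phi> a b \<oplus>\<^bsub>L\<^esub> \<phi> a' b"
    and add2: "\<And>a b b'. a \<in> carrier K1 \<Longrightarrow> b \<in> carrier K2 \<Longrightarrow> b' \<in> carrier K2 \<Longrightarrow>
      \<phi> a (b \<oplus>\<^bsub>K2\<^esub> b') = \<phi> a b \<oplus>\<^bsub>L\<^esub> \<phi> a b'"
    and bal: "\<And>r a b. r \<in> carrier K0 \<Longrightarrow> a \<in> carrier K1 \<Longrightarrow> b \<in> carrier K2 \<Longrightarrow>
      \<phi> (g1 r \<otimes>\<^bsub>K1\<^esub> a) b = \<phi> a (g2 r \<otimes>\<^bsub>K2\<^esub> b)"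
  shows "\<exists>\<rho>. (\<forall>u\<in>carrier T. \<rho> u \<in> carrier L) \<and>
    (\<forall>u\<in>carrier T. \<forall>v\<in>carrier T. \<rho> (u \<oplus>\<^bsub>T\<^esub> v) = \<rho> u \<oplus>\<^bsub>L\<^esub> \<rho> v) \<and>
    (\<forall>a\<in>carrier K1. \<forall>b\<in>carrier K2. \<rho> (pure a b) = \<phi> a b)"
proof -
  interpret L: abelian_group L by fact
  let ?S = "carrier K1 \<times> carrier K2"
  let ?F = "free_Abelian_group ?S"
  have "case_prod \<phi> ` ?S \<subseteq> carrier (add_monoid L)" using closed by auto
  then obtain h where h: "h \<in> hom ?F (add_monoid L)" "\<And>x. x \<in> ?S \<Longrightarrow> h (frag_of x) = case_prod \<phi> x"
    using comm_group.free_Abelian_group_universal[OF L.a_comm_group, of "case_prod \<phi>" ?S] by metis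
  have hc: "h c \<in> carrier L" if "c \<in> carrier A" for c
    using hom_in_carrier[OF h(1), of c] that by (simp add: A_carrier)
  have hadd: "h (c + d) = h c \<oplus>\<^bsub>L\<^esub> h d" if "c \<in> carrier A" "d \<in> carrier A" for c d
    using hom_mult[OF h(1), of c d] that by (simp add: A_carrier)
  have hdiff: "h (c - d) = h c \<ominus>\<^bsub>L\<^esub> h d" if cd: "c \<in> carrier A" "d \<in> carrier A" for c d
  proof -
    have e: "c - d \<in> carrier A" using A.minus_closed[OF cd] cd by (simp add: A_minus)
    have "h c = h (c - d) \<oplus>\<^bsub>L\<^esub> h d" using hadd[OF e cd(2)] by simp
    then show ?thesis using hc[OF e] hc[OF cd(2)] by (simp add: a_minus_def L.a_assoc L.r_neg)
  qed
  have h0: "h 0 = \<zero>\<^bsub>L\<^esub>"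
  proof -
    have z: "0 \<in> carrier A" by (simp add: A_carrier)
    show ?thesis using hdiff[OF z z] hc[OF z] by (simp add: a_minus_def L.r_neg)
  qed
  \<comment> \<open>The largest ideal contained in the kernel of \<open>h\<close>. It then suffices
    to find the relations in it.\<close>
  define N where "N = {c \<in> carrier A. \<forall>d\<in>carrier A. h (c \<otimes>\<^bsub>A\<^esub> d) = \<zero>\<^bsub>L\<^esub>}"
  have "ideal N A"
  proof (rule idealI)
    show "ring A" by (rule A.ring_axioms)
    show "subgroup N (add_monoid A)"
    proof (rule A.add.subgroupI)
      show "N \<subseteq> carrier A" unfolding N_def by auto
      have "0 \<in> N" unfolding N_def using h0 by (auto simp: A_carrier)
      then show "N \<noteq> {}" by auto
      fix c assume c: "c \<in> N"
      then have cA: "c \<in> carrier A" unfolding N_def by auto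
      have "h ((\<ominus>\<^bsub>A\<^esub> c) \<otimes>\<^bsub>A\<^esub> d) = \<zero>\<^bsub>L\<^esub>" if d: "d \<in> carrier A" for d
      proof -
        have "(\<ominus>\<^bsub>A\<^esub> c) \<otimes>\<^bsub>A\<^esub> d = 0 - c \<otimes>\<^bsub>A\<^esub> d"
          using M.monoid_ring_diff_left[of 0 c d] cA by (simp add: A_uminus)
        moreover have "0 \<in> carrier A" by (simp add: A_carrier)
        ultimately show ?thesis
          using c d hdiff[of 0 "c \<otimes>\<^bsub>A\<^esub> d"] A.m_closed[OF cA d] h0
          unfolding N_def by (simp add: a_minus_def)
      qed
      then show "\<ominus>\<^bsub>A\<^esub> c \<in> N" unfolding N_def using cA by auto
      fix d assume d: "d \<in> N"
      then have dA: "d \<in> carrier A" unfolding N_def by auto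
      have "h ((c \<oplus>\<^bsub>A\<^esub> d) \<otimes>\<^bsub>A\<^esub> e) = \<zero>\<^bsub>L\<^esub>" if e: "e \<in> carrier A" for e
      proof -
        have "(c \<oplus>\<^bsub>A\<^esub> d) \<otimes>\<^bsub>A\<^esub> e = c \<otimes>\<^bsub>A\<^esub> e + d \<otimes>\<^bsub>A\<^esub> e"
          using A.l_distr[OF cA dA e] by simp
        then show ?thesis
          using c d e hadd[OF A.m_closed[OF cA e] A.m_closed[OF dA e]] unfolding N_def by auto
      qed
      then show "c \<oplus>\<^bsub>A\<^esub> d \<in> N" unfolding N_def using A.a_closed[OF cA dA] by auto
    qed
    fix c x assume c: "c \<in> N" and x: "x \<in> carrier A"
    then have cA: "c \<in> carrier A" unfolding N_def by auto
    have "h ((c \<otimes>\<^bsub>A\<^esub> x) \<otimes>\<^bsub>A\<^esub> d) = \<zero>\<^bsub>L\<^esub>" if "d \<in> carrier A" for d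
      using c A.m_closed[OF x that] A.m_assoc[OF cA x that] unfolding N_def by auto
    then show "c \<otimes>\<^bsub>A\<^esub> x \<in> N" unfolding N_def using cA x by auto
    then show "x \<otimes>\<^bsub>A\<^esub> c \<in> N" using A.m_comm[OF cA x] by simp
  qed
  moreover have "tensor_relations K0 K1 K2 g1 g2 \<subseteq> N"
  proof
    fix q assume q: "q \<in> tensor_relations K0 K1 K2 g1 g2"
    then have qA: "q \<in> carrier A" using relations_carrier by auto
    \<comment> \<open>The product of a relation with a generator is the same type of relation for
      multiplied arguments, so the assumptions on \<open>\<phi>\<close> kill it.\<close>
    have gen: "h (q \<otimes>\<^bsub>A\<^esub> frag_of (x, y)) = \<zero>\<^bsub>L\<^esub>" if xy: "x \<in> carrier K1" "y \<in> carrier K2" for x y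
    proof -
      have fr: "frag_of (a, b) \<otimes>\<^bsub>A\<^esub> frag_of (x, y) = frag_of (a \<otimes>\<^bsub>K1\<^esub> x, b \<otimes>\<^bsub>K2\<^esub> y)" for a b
        using M.monoid_ring_frag_of by simp
      have hf: "h (frag_of (a, b)) = \<phi> a b" if "a \<in> carrier K1" "b \<in> carrier K2" for a b
        using h(2)[of "(a, b)"] that by simp
      consider a a' b where "q = frag_of (a \<oplus>\<^bsub>K1\<^esub> a', b) - frag_of (a, b) - frag_of (a', b)"
          "a \<in> carrier K1" "a' \<in> carrier K1" "b \<in> carrier K2"
        | a b b' where "q = frag_of (a, b \<oplus>\<^bsub>K2\<^esub> b') - frag_of (a, b) - frag_of (a, b')"
          "a \<in> carrier K1" "b \<in> carrier K2" "b' \<in> carrier K2"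
        | r a b where "q = frag_of (g1 r \<otimes>\<^bsub>K1\<^esub> a, b) - frag_of (a, g2 r \<otimes>\<^bsub>K2\<^esub> b)"
          "r \<in> carrier K0" "a \<in> carrier K1" "b \<in> carrier K2"
        using q unfolding tensor_relations_def by blast
      then show ?thesis
      proof cases
        case 1
        let ?a = "a \<otimes>\<^bsub>K1\<^esub> x" and ?a' = "a' \<otimes>\<^bsub>K1\<^esub> x" and ?b = "b \<otimes>\<^bsub>K2\<^esub> y"
        have c: "?a \<in> carrier K1" "?a' \<in> carrier K1" "?b \<in> carrier K2" using 1 xy by auto
        have "q \<otimes>\<^bsub>A\<^esub> frag_of (x, y) = frag_of (?a \<oplus>\<^bsub>K1\<^esub> ?a', ?b) - (frag_of (?a, ?b) + frag_of (?a', ?b))"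
          unfolding 1(1) M.monoid_ring_diff_left fr using 1 xy by (simp add: K1.l_distr diff_diff_add)
        also have "h \<dots> = h (frag_of (?a \<oplus>\<^bsub>K1\<^esub> ?a', ?b)) \<ominus>\<^bsub>L\<^esub> (h (frag_of (?a, ?b)) \<oplus>\<^bsub>L\<^esub> h (frag_of (?a', ?b)))"
          using c frag_of_A A.a_closed[of "frag_of (?a, ?b)" "frag_of (?a', ?b)"]
          by (subst hdiff) (auto simp: hadd)
        also have "\<dots> = \<zero>\<^bsub>L\<^esub>"
          using c by (simp add: hf add1 closed a_minus_def L.r_neg)
        finally show ?thesis .
      next
        case 2
        let ?a = "a \<otimes>\<^bsub>K1\<^esub> x" and ?b' = "b' \<otimes>\<^bsub>K2\<^esub> y" and ?b = "b \<otimes>\<^bsub>K2\<^esub> y"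
        have c: "?a \<in> carrier K1" "?b' \<in> carrier K2" "?b \<in> carrier K2" using 2 xy by auto
        have "q \<otimes>\<^bsub>A\<^esub> frag_of (x, y) = frag_of (?a, ?b \<oplus>\<^bsub>K2\<^esub> ?b') - (frag_of (?a, ?b) + frag_of (?a, ?b'))"
          unfolding 2(1) M.monoid_ring_diff_left fr using 2 xy by (simp add: K2.l_distr diff_diff_add)
        also have "h \<dots> = h (frag_of (?a, ?b \<oplus>\<^bsub>K2\<^esub> ?b')) \<ominus>\<^bsub>L\<^esub> (h (frag_of (?a, ?b)) \<oplus>\<^bsub>L\<^esub> h (frag_of (?a, ?b')))"
          using c frag_of_A A.a_closed[of "frag_of (?a, ?b)" "frag_of (?a, ?b')"]
          by (subst hdiff) (auto simp: hadd)
        also have "\<dots> = \<zero>\<^bsub>L\<^esub>"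
          using c by (simp add: hf add2 closed a_minus_def L.r_neg)
        finally show ?thesis .
      next
        case 3
        let ?a = "a \<otimes>\<^bsub>K1\<^esub> x" and ?b = "b \<otimes>\<^bsub>K2\<^esub> y"
        have c: "?a \<in> carrier K1" "?b \<in> carrier K2" "g1 r \<in> carrier K1" "g2 r \<in> carrier K2"
          using 3 xy hom1 hom2 by auto
        have "q \<otimes>\<^bsub>A\<^esub> frag_of (x, y) = frag_of (g1 r \<otimes>\<^bsub>K1\<^esub> ?a, ?b) - frag_of (?a, g2 r \<otimes>\<^bsub>K2\<^esub> ?b)"
          unfolding 3(1) M.monoid_ring_diff_left fr using 3 xy c by (simp add: K1.m_assoc K2.m_assoc)
        also have "h \<dots> = h (frag_of (g1 r \<otimes>\<^bsub>K1\<^esub> ?a, ?b)) \<ominus>\<^bsub>L\<^esub> h (frag_of (?a, g2 r \<otimes>\<^bsub>K2\<^esub> ?b))"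
          using c frag_of_A by (subst hdiff) auto
        also have "\<dots> = \<zero>\<^bsub>L\<^esub>"
          using c 3 by (simp add: hf bal closed a_minus_def L.r_neg)
        finally show ?thesis .
      qed
    qed
    have "h (q \<otimes>\<^bsub>A\<^esub> d) = \<zero>\<^bsub>L\<^esub>" if "d \<in> carrier A" for d
    proof -
      have "Poly_Mapping.keys d \<subseteq> carrier K1 \<times> carrier K2" using that A_carrier by auto
      then have "d \<in> carrier A \<and> h (q \<otimes>\<^bsub>A\<^esub> d) = \<zero>\<^bsub>L\<^esub>"
      proof (induction d rule: frag_induction)
        case zero
        then show ?case using h0 by (simp add: A_carrier)
      next
        case (one x)
        then show ?case using gen by (cases x) (auto simp: A_carrier)
      next
        case (diff a b)
        then have ab: "a \<in> carrier A" "b \<in> carrier A" by auto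
        have "a - b \<in> carrier A" using A.minus_closed[OF ab] ab by (simp add: A_minus)
        moreover have "h (q \<otimes>\<^bsub>A\<^esub> (a - b)) = \<zero>\<^bsub>L\<^esub>"
          unfolding M.monoid_ring_diff_right
          using hdiff[OF A.m_closed[OF qA ab(1)] A.m_closed[OF qA ab(2)]] diff
          by (simp add: a_minus_def)
        ultimately show ?case by auto
      qed
      then show ?thesis by auto
    qed
    then show "q \<in> N" unfolding N_def using qA by auto
  qed
  ultimately have "J \<subseteq> N" unfolding tensor_ideal_def by (rule A.genideal_minimal)
  have hJ: "h c = \<zero>\<^bsub>L\<^esub>" if "c \<in> J" for c
  proof -
    have c: "c \<in> N" using that \<open>J \<subseteq> N\<close> by auto
    then have "c \<in> carrier A" "h (c \<otimes>\<^bsub>A\<^esub> \<one>\<^bsub>A\<^esub>) = \<zero>\<^bsub>L\<^esub>"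
      using A.one_closed unfolding N_def by blast+
    then show ?thesis using A.r_one[of c] by (simp del: A_simps)
  qed
  \<comment> \<open>An arbitrary preimage is chosen; the value is independent of it because
    \<open>h\<close> vanishes on \<open>J\<close>.\<close>
  define \<rho> where "\<rho> u = h (SOME c. c \<in> carrier A \<and> u = proj c)" for u
  have \<rho>: "\<rho> (proj c) = h c" if c: "c \<in> carrier A" for c
  proof -
    define d where "d = (SOME d. d \<in> carrier A \<and> proj c = proj d)"
    have "d \<in> carrier A \<and> proj c = proj d" unfolding d_def by (rule someI[of _ c]) (use c in auto)
    then have d: "c - d \<in> J" "d \<in> carrier A" using proj_eq c by auto
    have "c - d \<in> carrier A" using d(1) J.a_subset by auto
    from hadd[OF this d(2)] have "h c = h d" using hJ[OF d(1)] hc[OF d(2)] by simp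
    then show ?thesis unfolding \<rho>_def d_def by simp
  qed
  have "\<rho> u \<in> carrier L" if "u \<in> carrier T" for u
    using proj_surj[OF that] \<rho> hc by auto
  moreover have "\<rho> (u \<oplus>\<^bsub>T\<^esub> v) = \<rho> u \<oplus>\<^bsub>L\<^esub> \<rho> v" if uv: "u \<in> carrier T" "v \<in> carrier T" for u v
  proof -
    obtain c d where cd: "c \<in> carrier A" "d \<in> carrier A" "u = proj c" "v = proj d"
      using proj_surj uv by metis
    have "u \<oplus>\<^bsub>T\<^esub> v = proj (c \<oplus>\<^bsub>A\<^esub> d)" using cd proj.hom_add by (simp del: A_simps)
    then show ?thesis using \<rho>[OF A.a_closed[OF cd(1,2)]] \<rho> cd hadd by simp
  qed
  moreover have "\<rho> (pure a b) = \<phi> a b" if "a \<in> carrier K1" "b \<in> carrier K2" for a b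
    using \<rho>[OF frag_of_A[OF that]] h(2)[of "(a, b)"] that unfolding pure_proj by simp
  ultimately show ?thesis by blast
qed

end

section \<open>Residue maps\<close>

text \<open>The values of \<open>r\<close> on \<open>U\<close> are the residues; a maximal subspace \<open>H\<close> through the maximal ideal of \<open>U\<close>
  and avoiding 1 is the kernel of the extension of the residue map to all of \<open>R\<close>.\<close>

lemma (in field) residue_functional:
  assumes k0: "subfield k0 R" "root_closed k0"
  shows "\<exists>U r. val_subring (carrier R) U \<and> (\<forall>x\<in>carrier R. r x \<in> k0) \<and>
    (\<forall>x\<in>carrier R. \<forall>y\<in>carrier R. r (x \<oplus> y) = r x \<oplus> r y) \<and>
    (\<forall>c\<in>k0. \<forall>x\<in>carrier R. r (c \<otimes> x) = c \<otimes> r x) \<and> r \<one> = \<one> \<and>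
    (\<forall>x\<in>U. \<forall>y\<in>U. r (x \<otimes> y) = r x \<otimes> r y)"
proof -
  have kc: "k0 \<subseteq> carrier R" by (rule subfieldE(3)[OF k0(1)])
  note k0s = subringE[OF subfieldE(1)[OF k0(1)]]
  \<comment> \<open>The refinement starts from the trivial valuation, so that \<open>U\<close>
    contains all of \<open>k0\<close> and has residue field \<open>k0\<close>.\<close>
  have "val_subring (carrier R) (carrier R)"
    using carrier_is_subring unfolding val_subring_def by auto
  then obtain U where U: "val_subring (carrier R) U" "U \<inter> k0 = carrier R \<inter> k0"
    and rat: "\<forall>x\<in>U. \<exists>c\<in>U \<inter> k0. x \<ominus> c \<in> nonunits U"
    using rational_refinement[OF k0 carrier_is_subfield kc] by blast
  note Us = val_subringD[OF U(1)]
  have kU: "k0 \<subseteq> U" using U(2) kc by auto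
  have nc: "x \<in> carrier R" if "x \<in> nonunits U" for x using nonunits_subset[OF that] Us(4) by auto
  define subsp where "subsp H \<longleftrightarrow> H \<subseteq> carrier R \<and> (\<forall>x\<in>H. \<forall>y\<in>H. x \<oplus> y \<in> H) \<and> (\<forall>c\<in>k0. \<forall>x\<in>H. c \<otimes> x \<in> H)" for H
  define \<A> where "\<A> = {H. subsp H \<and> nonunits U \<subseteq> H \<and> \<one> \<notin> H}"
  have "\<exists>M\<in>\<A>. \<forall>Y\<in>\<A>. M \<subseteq> Y \<longrightarrow> Y = M"
  proof (rule subset_Zorn_nonempty)
    have "nonunits U \<in> \<A>"
      using nonunits_add[OF U(1) carrier_is_subfield] nonunits_mult[OF Us(1)] one_not_nonunit[OF Us(1)] nc kU
      unfolding \<A>_def subsp_def by auto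
    then show "\<A> \<noteq> {}" by auto
    fix \<C> assume C: "\<C> \<noteq> {}" "subset.chain \<A> \<C>"
    have sub: "subsp H" "nonunits U \<subseteq> H" "\<one> \<notin> H" if "H \<in> \<C>" for H
      using C(2) that unfolding subset.chain_def \<A>_def by auto
    have lin: "\<And>S T. S \<in> \<C> \<Longrightarrow> T \<in> \<C> \<Longrightarrow> S \<subseteq> T \<or> T \<subseteq> S"
      using C(2) unfolding subset.chain_def by blast
    have "subsp (\<Union>\<C>)"
      unfolding subsp_def
    proof (intro conjI ballI)
      show "\<Union>\<C> \<subseteq> carrier R" using sub(1) unfolding subsp_def by blast
      fix x assume "x \<in> \<Union>\<C>"
      then obtain S where S: "S \<in> \<C>" "x \<in> S" by auto
      show "c \<otimes> x \<in> \<Union>\<C>" if "c \<in> k0" for c using sub(1)[OF S(1)] S that unfolding subsp_def by blast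
      fix y assume "y \<in> \<Union>\<C>"
      then obtain T where T: "T \<in> \<C>" "y \<in> T" by auto
      then obtain V where "V \<in> \<C>" "x \<in> V" "y \<in> V" using lin[OF S(1) T(1)] S T by auto
      then show "x \<oplus> y \<in> \<Union>\<C>" using sub(1) unfolding subsp_def by blast
    qed
    then show "\<Union>\<C> \<in> \<A>" using sub C(1) unfolding \<A>_def by blast
  qed
  then obtain H where HA: "H \<in> \<A>" and max: "\<And>Y. Y \<in> \<A> \<Longrightarrow> H \<subseteq> Y \<Longrightarrow> Y = H" by auto
  have Hc: "H \<subseteq> carrier R" and Ha: "\<And>x y. x \<in> H \<Longrightarrow> y \<in> H \<Longrightarrow> x \<oplus> y \<in> H"
    and Hm: "\<And>c x. c \<in> k0 \<Longrightarrow> x \<in> H \<Longrightarrow> c \<otimes> x \<in> H" and UH: "nonunits U \<subseteq> H" and H1: "\<one> \<notin> H"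
    using HA unfolding \<A>_def subsp_def by auto
  have H0: "\<zero> \<in> H" using UH nonunits_zero[OF Us(1)] by auto
  have Hn: "\<ominus> x \<in> H" if "x \<in> H" for x
    using Hm[OF k0s(5)[OF k0s(3)] that] Hc that by (auto simp: l_minus)
  \<comment> \<open>If \<open>x\<close> is not in \<open>H\<close>, maximality forces 1 into the
    span of \<open>H\<close> and \<open>x\<close>, say \<open>1 = h + c x\<close>; then
    \<open>x\<close> is congruent to the inverse of \<open>c\<close> modulo
    \<open>H\<close>.\<close>
  have ex: "\<exists>c\<in>k0. x \<ominus> c \<in> H" if x: "x \<in> carrier R" for x
  proof (cases "x \<in> H")
    case True
    then have "x \<ominus> \<zero> \<in> H" using x by (simp add: a_minus_def)
    then show ?thesis using k0s(2) by blast
  next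
    case False
    let ?Y = "{h \<oplus> c \<otimes> x | h c. h \<in> H \<and> c \<in> k0}"
    have HY: "H \<subseteq> ?Y"
    proof
      fix h assume "h \<in> H"
      then have "h = h \<oplus> \<zero> \<otimes> x" using Hc x by auto
      then show "h \<in> ?Y" using \<open>h \<in> H\<close> k0s(2) by blast
    qed
    have "subsp ?Y"
      unfolding subsp_def
    proof (intro conjI ballI)
      show "?Y \<subseteq> carrier R" using Hc kc x by auto
      fix y assume "y \<in> ?Y"
      then obtain h c where y: "y = h \<oplus> c \<otimes> x" "h \<in> H" "c \<in> k0" by auto
      have yc: "h \<in> carrier R" "c \<in> carrier R" using y Hc kc by auto
      show "d \<otimes> y \<in> ?Y" if d: "d \<in> k0" for d
      proof -
        have "d \<otimes> y = d \<otimes> h \<oplus> (d \<otimes> c) \<otimes> x" unfolding y(1) using yc d kc x by (auto simp: r_distr m_assoc)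
        then show ?thesis using Hm[OF d y(2)] k0s(6)[OF d y(3)] by blast
      qed
      fix z assume "z \<in> ?Y"
      then obtain h' c' where z: "z = h' \<oplus> c' \<otimes> x" "h' \<in> H" "c' \<in> k0" by auto
      have zc: "h' \<in> carrier R" "c' \<in> carrier R" using z Hc kc by auto
      have "y \<oplus> z = (h \<oplus> h') \<oplus> (c \<oplus> c') \<otimes> x" unfolding y(1) z(1) using yc zc x by algebra
      then show "y \<oplus> z \<in> ?Y" using Ha[OF y(2) z(2)] k0s(7)[OF y(3) z(3)] by blast
    qed
    moreover have "x \<in> ?Y"
    proof -
      have "x = \<zero> \<oplus> \<one> \<otimes> x" using x by simp
      then show ?thesis using H0 k0s(3) by blast
    qed
    ultimately have "\<one> \<in> ?Y" using max[OF _ HY] HY UH False unfolding \<A>_def by blast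
    then obtain h c where hc: "\<one> = h \<oplus> c \<otimes> x" "h \<in> H" "c \<in> k0" by auto
    have c: "h \<in> carrier R" "c \<in> carrier R" using hc Hc kc by auto
    have c0: "c \<noteq> \<zero>" using hc H1 c x by auto
    note ci = nonzero_inv[OF c(2) c0]
    have ck: "inv c \<in> k0" using subfield_m_inv(1)[OF k0(1), of c] hc c0 by auto
    have "x \<ominus> inv c = (inv c \<otimes> c) \<otimes> x \<ominus> inv c \<otimes> (h \<oplus> c \<otimes> x)"
      unfolding hc(1)[symmetric] ci(4) using ci(1) x by simp
    also have "\<dots> = \<ominus> (inv c \<otimes> h)" using ci(1) c x by algebra
    finally have "x \<ominus> inv c \<in> H" using Hn[OF Hm[OF ck hc(2)]] by simp
    then show ?thesis using ck by blast
  qed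
  \<comment> \<open>Two different scalars would put their nonzero difference, and after scaling 1
    itself, into \<open>H\<close>.\<close>
  have un: "c = d" if cd: "c \<in> k0" "d \<in> k0" "x \<in> carrier R" "x \<ominus> c \<in> H" "x \<ominus> d \<in> H" for c d x
  proof (rule ccontr)
    assume "c \<noteq> d"
    have c: "c \<in> carrier R" "d \<in> carrier R" using cd kc by auto
    have "(x \<ominus> c) \<oplus> \<ominus> (x \<ominus> d) = d \<ominus> c" using c cd(3) by algebra
    then have dc: "d \<ominus> c \<in> H" using Ha[OF cd(4) Hn[OF cd(5)]] by simp
    have "d \<ominus> c \<noteq> \<zero>" using c \<open>c \<noteq> d\<close> by auto
    moreover have "d \<ominus> c \<in> k0" unfolding a_minus_def using k0s(5,7) cd by auto
    ultimately have "inv (d \<ominus> c) \<in> k0" "inv (d \<ominus> c) \<otimes> (d \<ominus> c) = \<one>"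
      using subfield_m_inv[OF k0(1), of "d \<ominus> c"] by auto
    then show False using Hm[OF _ dc] H1 by metis
  qed
  define r where "r x = (THE c. c \<in> k0 \<and> x \<ominus> c \<in> H)" for x
  have r: "r x \<in> k0" "x \<ominus> r x \<in> H" if "x \<in> carrier R" for x
  proof -
    have "\<exists>!c. c \<in> k0 \<and> x \<ominus> c \<in> H" using ex[OF that] un[OF _ _ that] by blast
    from theI'[OF this] show "r x \<in> k0" "x \<ominus> r x \<in> H" unfolding r_def by auto
  qed
  have rI: "r x = c" if "c \<in> k0" "x \<in> carrier R" "x \<ominus> c \<in> H" for x c
    using un[OF r(1)[OF that(2)] that(1,2) r(2)[OF that(2)] that(3)] .
  have rc: "r x \<in> carrier R" if "x \<in> carrier R" for x using r(1)[OF that] kc by auto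
  have "r (x \<oplus> y) = r x \<oplus> r y" if xy: "x \<in> carrier R" "y \<in> carrier R" for x y
  proof (rule rI)
    show "r x \<oplus> r y \<in> k0" using k0s(7) r xy by auto
    have "(x \<oplus> y) \<ominus> (r x \<oplus> r y) = (x \<ominus> r x) \<oplus> (y \<ominus> r y)" using xy rc[OF xy(1)] rc[OF xy(2)] by algebra
    then show "(x \<oplus> y) \<ominus> (r x \<oplus> r y) \<in> H" using Ha r xy by auto
  qed (use xy in auto)
  moreover have "r (c \<otimes> x) = c \<otimes> r x" if c: "c \<in> k0" and x: "x \<in> carrier R" for c x
  proof (rule rI)
    show "c \<otimes> r x \<in> k0" using k0s(6) r c x by auto
    have cc: "c \<in> carrier R" using c kc by auto
    have "c \<otimes> x \<ominus> c \<otimes> r x = c \<otimes> (x \<ominus> r x)" using cc x rc[OF x] by algebra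
    then show "c \<otimes> x \<ominus> c \<otimes> r x \<in> H" using Hm r c x by auto
    show "c \<otimes> x \<in> carrier R" using cc x by simp
  qed
  moreover have "r \<one> = \<one>" using k0s(3) H0 by (intro rI) (auto simp: a_minus_def r_neg)
  moreover have "r (x \<otimes> y) = r x \<otimes> r y" if xy: "x \<in> U" "y \<in> U" for x y
  proof -
    \<comment> \<open>On \<open>U\<close> the scalar singled out by \<open>H\<close> is the actual
      residue, because \<open>H\<close> contains the nonunits of \<open>U\<close>. This makes
      \<open>r\<close> multiplicative there, while elsewhere it is only linear.\<close>
    have res: "x \<ominus> r x \<in> nonunits U" if x: "x \<in> U" for x
    proof -
      obtain c where c: "c \<in> U \<inter> k0" "x \<ominus> c \<in> nonunits U" using rat x by blast
      then have "r x = c" using UH Us(4) x by (intro rI) auto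
      then show ?thesis using c by simp
    qed
    have c: "x \<in> carrier R" "y \<in> carrier R" using xy Us(4) by auto
    note rx = rc[OF c(1)] and ry = rc[OF c(2)]
    have rxU: "r x \<in> U" using r(1)[OF c(1)] kU by auto
    have "x \<otimes> y \<ominus> r x \<otimes> r y = y \<otimes> (x \<ominus> r x) \<oplus> r x \<otimes> (y \<ominus> r y)" using c rx ry by algebra
    then have "x \<otimes> y \<ominus> r x \<otimes> r y \<in> nonunits U"
      using nonunits_add[OF U(1) carrier_is_subfield nonunits_mult[OF Us(1) xy(2) res[OF xy(1)]]
          nonunits_mult[OF Us(1) rxU res[OF xy(2)]]] by simp
    then show ?thesis using UH k0s(6) r c by (intro rI) auto
  qed
  ultimately show ?thesis using U(1) r(1) by blast
qed

locale field_pair = algebra_pair K0 K1 K2 g1 g2 + K0: field K0 + K1: field K1 + K2: field K2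
  for K0 :: "('a, 'k) ring_scheme" and K1 :: "('b, 'm) ring_scheme" and K2 :: "('c, 'n) ring_scheme"
    and g1 g2 +
  assumes inj1: "inj_on g1 (carrier K0)" and closed0: "K1.root_closed (g1 ` carrier K0)"
begin

lemma hom_add1: "x \<in> carrier K0 \<Longrightarrow> y \<in> carrier K0 \<Longrightarrow> g1 (x \<oplus>\<^bsub>K0\<^esub> y) = g1 x \<oplus>\<^bsub>K1\<^esub> g1 y"
  and hom_mult1: "x \<in> carrier K0 \<Longrightarrow> y \<in> carrier K0 \<Longrightarrow> g1 (x \<otimes>\<^bsub>K0\<^esub> y) = g1 x \<otimes>\<^bsub>K1\<^esub> g1 y"
  and hom_add2: "x \<in> carrier K0 \<Longrightarrow> y \<in> carrier K0 \<Longrightarrow> g2 (x \<oplus>\<^bsub>K0\<^esub> y) = g2 x \<oplus>\<^bsub>K2\<^esub> g2 y"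
  and hom_mult2: "x \<in> carrier K0 \<Longrightarrow> y \<in> carrier K0 \<Longrightarrow> g2 (x \<otimes>\<^bsub>K0\<^esub> y) = g2 x \<otimes>\<^bsub>K2\<^esub> g2 y"
  and hom_one1: "g1 \<one>\<^bsub>K0\<^esub> = \<one>\<^bsub>K1\<^esub>" and hom_one2: "g2 \<one>\<^bsub>K0\<^esub> = \<one>\<^bsub>K2\<^esub>"
  using ring_hom_add[OF g1] ring_hom_mult[OF g1] ring_hom_add[OF g2] ring_hom_mult[OF g2]
    ring_hom_one[OF g1] ring_hom_one[OF g2] by auto

text \<open>The residues are pulled back along \<open>g1\<close> from the image of \<open>K0\<close>
  to \<open>K0\<close> itself, from where \<open>g2\<close> can carry them to
  \<open>K2\<close>.\<close>

lemma residue_map: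
  "\<exists>U r. K1.val_subring (carrier K1) U \<and> (\<forall>x\<in>carrier K1. r x \<in> carrier K0) \<and>
    (\<forall>x\<in>carrier K1. \<forall>y\<in>carrier K1. r (x \<oplus>\<^bsub>K1\<^esub> y) = r x \<oplus>\<^bsub>K0\<^esub> r y) \<and>
    (\<forall>c\<in>carrier K0. \<forall>x\<in>carrier K1. r (g1 c \<otimes>\<^bsub>K1\<^esub> x) = c \<otimes>\<^bsub>K0\<^esub> r x) \<and> r \<one>\<^bsub>K1\<^esub> = \<one>\<^bsub>K0\<^esub> \<and>
    (\<forall>x\<in>U. \<forall>y\<in>U. r (x \<otimes>\<^bsub>K1\<^esub> y) = r x \<otimes>\<^bsub>K0\<^esub> r y)"
proof -
  interpret g: ring_hom_ring K0 K1 g1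
    by (rule ring_hom_ringI2[OF K0.ring_axioms K1.ring_axioms g1])
  have "subfield (g1 ` carrier K0) K1"
    by (rule g.img_is_subfield[OF K0.carrier_is_subfield K1.one_not_zero])
  from K1.residue_functional[OF this closed0]
  obtain U r where U: "K1.val_subring (carrier K1) U" and r': "\<forall>x\<in>carrier K1. r x \<in> g1 ` carrier K0"
    "\<forall>x\<in>carrier K1. \<forall>y\<in>carrier K1. r (x \<oplus>\<^bsub>K1\<^esub> y) = r x \<oplus>\<^bsub>K1\<^esub> r y"
    "\<forall>c\<in>g1 ` carrier K0. \<forall>x\<in>carrier K1. r (c \<otimes>\<^bsub>K1\<^esub> x) = c \<otimes>\<^bsub>K1\<^esub> r x"
    "r \<one>\<^bsub>K1\<^esub> = \<one>\<^bsub>K1\<^esub>" "\<forall>x\<in>U. \<forall>y\<in>U. r (x \<otimes>\<^bsub>K1\<^esub> y) = r x \<otimes>\<^bsub>K1\<^esub> r y"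
    by (elim exE conjE)
  note r = r'(1)[THEN bspec] r'(2)[THEN bspec, THEN bspec] r'(3)[THEN bspec, THEN bspec] r'(4)
    r'(5)[THEN bspec, THEN bspec]
  define s where "s x = inv_into (carrier K0) g1 (r x)" for x
  have s: "s x \<in> carrier K0" "g1 (s x) = r x" if "x \<in> carrier K1" for x
    unfolding s_def using inv_into_into[OF r(1)[OF that]] f_inv_into_f[OF r(1)[OF that]] by auto
  have sI: "s x = c" if "x \<in> carrier K1" "c \<in> carrier K0" "r x = g1 c" for x c
    using s[OF that(1)] that inj_onD[OF inj1, of "s x" c] by auto
  have "s (x \<oplus>\<^bsub>K1\<^esub> y) = s x \<oplus>\<^bsub>K0\<^esub> s y" if "x \<in> carrier K1" "y \<in> carrier K1" for x y
    using that s r(2) hom_add1 by (intro sI) auto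
  moreover have "s (g1 c \<otimes>\<^bsub>K1\<^esub> x) = c \<otimes>\<^bsub>K0\<^esub> s x" if "c \<in> carrier K0" "x \<in> carrier K1" for c x
    using that s r(3) hom_mult1 hom1 by (intro sI) auto
  moreover have "s \<one>\<^bsub>K1\<^esub> = \<one>\<^bsub>K0\<^esub>" using r(4) hom_one1 by (intro sI) auto
  moreover have "s (x \<otimes>\<^bsub>K1\<^esub> y) = s x \<otimes>\<^bsub>K0\<^esub> s y" if "x \<in> U" "y \<in> U" for x y
  proof -
    have "x \<in> carrier K1" "y \<in> carrier K1" using that K1.val_subringD(4)[OF U] by auto
    then show ?thesis using that s r(5) hom_mult1 by (intro sI) auto
  qed
  ultimately show ?thesis using U s(1) by (intro exI[of _ U] exI[of _ s]) simp
qed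

text \<open>\<open>\<rho>\<close> is the base change of \<open>r\<close>: on the tensor product it
  is \<open>r\<close> on the left factor and the identity on the right, after identifying
  \<open>K0\<close> tensor \<open>K2\<close> with \<open>K2\<close>. Linearity of \<open>r\<close>
  has been used up in its construction and is not part of the record.\<close>

definition residue_data :: "'b set \<Rightarrow> ('b \<Rightarrow> 'a) \<Rightarrow> (('b \<times> 'c \<Rightarrow>\<^sub>0 int) set \<Rightarrow> 'c) \<Rightarrow> bool"
  where "residue_data U r \<rho> \<longleftrightarrow> K1.val_subring (carrier K1) U \<and> (\<forall>x\<in>carrier K1. r x \<in> carrier K0) \<and>
    r \<one>\<^bsub>K1\<^esub> = \<one>\<^bsub>K0\<^esub> \<and> (\<forall>x\<in>U. \<forall>y\<in>U. r (x \<otimes>\<^bsub>K1\<^esub> y) = r x \<otimes>\<^bsub>K0\<^esub> r y) \<and>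
    (\<forall>u\<in>carrier T. \<rho> u \<in> carrier K2) \<and>
    (\<forall>u\<in>carrier T. \<forall>v\<in>carrier T. \<rho> (u \<oplus>\<^bsub>T\<^esub> v) = \<rho> u \<oplus>\<^bsub>K2\<^esub> \<rho> v) \<and>
    (\<forall>a\<in>carrier K1. \<forall>b\<in>carrier K2. \<rho> (pure a b) = g2 (r a) \<otimes>\<^bsub>K2\<^esub> b)"

lemma residue_data_exists: "\<exists>U r \<rho>. residue_data U r \<rho>"
proof -
  obtain U r where U: "K1.val_subring (carrier K1) U" and r: "\<forall>x\<in>carrier K1. r x \<in> carrier K0"
    "\<forall>x\<in>carrier K1. \<forall>y\<in>carrier K1. r (x \<oplus>\<^bsub>K1\<^esub> y) = r x \<oplus>\<^bsub>K0\<^esub> r y"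
    "\<forall>c\<in>carrier K0. \<forall>x\<in>carrier K1. r (g1 c \<otimes>\<^bsub>K1\<^esub> x) = c \<otimes>\<^bsub>K0\<^esub> r x" "r \<one>\<^bsub>K1\<^esub> = \<one>\<^bsub>K0\<^esub>"
    "\<forall>x\<in>U. \<forall>y\<in>U. r (x \<otimes>\<^bsub>K1\<^esub> y) = r x \<otimes>\<^bsub>K0\<^esub> r y"
    using residue_map by (elim exE conjE)
  have "\<exists>\<rho>. (\<forall>u\<in>carrier T. \<rho> u \<in> carrier K2) \<and>
    (\<forall>u\<in>carrier T. \<forall>v\<in>carrier T. \<rho> (u \<oplus>\<^bsub>T\<^esub> v) = \<rho> u \<oplus>\<^bsub>K2\<^esub> \<rho> v) \<and>
    (\<forall>a\<in>carrier K1. \<forall>b\<in>carrier K2. \<rho> (pure a b) = g2 (r a) \<otimes>\<^bsub>K2\<^esub> b)" (is "\<exists>\<rho>. ?P \<rho>")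
  proof (rule bilinear_extension)
    show "abelian_group K2" by (rule K2.abelian_group_axioms)
  qed (use r hom2 hom_add2 hom_mult2 in \<open>auto simp: K2.l_distr K2.r_distr K2.m_ac\<close>)
  then obtain \<rho> where "?P \<rho>" ..
  then have "residue_data U r \<rho>" unfolding residue_data_def using U r by simp
  then show ?thesis by blast
qed

end

section \<open>The tensor product is a domain\<close>

locale residue_pair = field_pair K0 K1 K2 g1 g2
  for K0 :: "('a, 'k) ring_scheme" and K1 :: "('b, 'm) ring_scheme" and K2 :: "('c, 'n) ring_scheme"
    and g1 g2 +
  fixes U r \<rho>
  assumes data: "residue_data U r \<rho>"
begin

lemma U: "K1.val_subring (carrier K1) U"
  and r_closed: "a \<in> carrier K1 \<Longrightarrow> r a \<in> carrier K0"
  and r_one: "r \<one>\<^bsub>K1\<^esub> = \<one>\<^bsub>K0\<^esub>"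
  and r_mult: "a \<in> U \<Longrightarrow> a' \<in> U \<Longrightarrow> r (a \<otimes>\<^bsub>K1\<^esub> a') = r a \<otimes>\<^bsub>K0\<^esub> r a'"
  and rho_closed: "u \<in> carrier T \<Longrightarrow> \<rho> u \<in> carrier K2"
  and rho_add: "u \<in> carrier T \<Longrightarrow> v \<in> carrier T \<Longrightarrow> \<rho> (u \<oplus>\<^bsub>T\<^esub> v) = \<rho> u \<oplus>\<^bsub>K2\<^esub> \<rho> v"
  and rho_pure: "a \<in> carrier K1 \<Longrightarrow> b \<in> carrier K2 \<Longrightarrow> \<rho> (pure a b) = g2 (r a) \<otimes>\<^bsub>K2\<^esub> b"
  using data unfolding residue_data_def by simp_all

lemmas Us = K1.val_subringD[OF U]

lemma g2r_closed: "a \<in> carrier K1 \<Longrightarrow> g2 (r a) \<in> carrier K2"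
  using r_closed hom2 by simp

lemma rho_zero: "\<rho> \<zero>\<^bsub>T\<^esub> = \<zero>\<^bsub>K2\<^esub>"
  using rho_add[of "\<zero>\<^bsub>T\<^esub>" "\<zero>\<^bsub>T\<^esub>"] rho_closed[of "\<zero>\<^bsub>T\<^esub>"] K2.add.l_cancel_one'[of "\<rho> \<zero>\<^bsub>T\<^esub>" "\<rho> \<zero>\<^bsub>T\<^esub>"]
  by simp

lemma rho_finsum:
  "finite I \<Longrightarrow> f \<in> I \<rightarrow> carrier T \<Longrightarrow> \<rho> (\<Oplus>\<^bsub>T\<^esub>i\<in>I. f i) = (\<Oplus>\<^bsub>K2\<^esub>i\<in>I. \<rho> (f i))"
  by (rule finsum_hom[OF T.abelian_monoid_axioms K2.abelian_monoid_axioms])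
    (auto simp: rho_closed rho_add rho_zero)

text \<open>The image of \<open>U\<close> tensor \<open>K2\<close>. Multiplicativity of
  \<open>\<rho>\<close> is available only here, since \<open>r\<close> is multiplicative only on
  \<open>U\<close>.\<close>

abbreviation "lat \<equiv> T.add_span {pure a b | a b. a \<in> U \<and> b \<in> carrier K2}"

lemma lattice_gens: "{pure a b | a b. a \<in> U \<and> b \<in> carrier K2} \<subseteq> carrier T"
  using Us(4) by auto

lemma lattice_carrier: "lat \<subseteq> carrier T"
  by (rule T.add_span_carrier[OF lattice_gens])

lemma rho_mult:
  assumes "x \<in> lat" "y \<in> lat"
  shows "\<rho> (x \<otimes>\<^bsub>T\<^esub> y) = \<rho> x \<otimes>\<^bsub>K2\<^esub> \<rho> y"
  using assms(2)
proof induction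
  case zero
  then show ?case using assms(1) lattice_carrier rho_closed by (auto simp: rho_zero subset_iff)
next
  case (add y g)
  have xc: "x \<in> carrier T" and yc: "y \<in> carrier T" using assms(1) add(1) lattice_carrier by auto
  obtain a b where g: "g = pure a b" "a \<in> U" "b \<in> carrier K2" using add by auto
  have ac: "a \<in> carrier K1" using g Us(4) by auto
  have gc: "g \<in> carrier T" using g ac by simp
  have "\<rho> (x \<otimes>\<^bsub>T\<^esub> g) = \<rho> x \<otimes>\<^bsub>K2\<^esub> \<rho> g"
    using assms(1)
  proof induction
    case zero
    then show ?case using gc rho_closed by (simp add: rho_zero)
  next
    case (add x h)
    have xc: "x \<in> carrier T" using add(1) lattice_carrier by auto
    obtain a' b' where h: "h = pure a' b'" "a' \<in> U" "b' \<in> carrier K2" using add by auto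
    have ac': "a' \<in> carrier K1" using h Us(4) by auto
    have hc: "h \<in> carrier T" using h ac' by simp
    have "\<rho> (h \<otimes>\<^bsub>T\<^esub> g) = g2 (r a' \<otimes>\<^bsub>K0\<^esub> r a) \<otimes>\<^bsub>K2\<^esub> (b' \<otimes>\<^bsub>K2\<^esub> b)"
      unfolding h(1) g(1) using h g ac ac' by (simp add: pure_mult rho_pure r_mult)
    also have "\<dots> = \<rho> h \<otimes>\<^bsub>K2\<^esub> \<rho> g"
      unfolding h(1) g(1) using h g ac ac' r_closed g2r_closed
      by (simp add: rho_pure hom_mult2 K2.m_ac)
    finally have "\<rho> (h \<otimes>\<^bsub>T\<^esub> g) = \<rho> h \<otimes>\<^bsub>K2\<^esub> \<rho> g" .
    then show ?case
      using add.IH xc hc gc rho_closed by (simp add: T.l_distr K2.l_distr rho_add)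
  qed
  then show ?case
    using add.IH xc yc gc rho_closed by (simp add: T.r_distr K2.r_distr rho_add)
qed

lemma pure_scale:
  assumes "finite I" "a \<in> carrier K1" "f \<in> I \<rightarrow> carrier K1" "b \<in> I \<rightarrow> carrier K2"
  shows "pure a \<one>\<^bsub>K2\<^esub> \<otimes>\<^bsub>T\<^esub> (\<Oplus>\<^bsub>T\<^esub>i\<in>I. pure (f i) (b i)) = (\<Oplus>\<^bsub>T\<^esub>i\<in>I. pure (a \<otimes>\<^bsub>K1\<^esub> f i) (b i))"
proof -
  have "pure a \<one>\<^bsub>K2\<^esub> \<otimes>\<^bsub>T\<^esub> (\<Oplus>\<^bsub>T\<^esub>i\<in>I. pure (f i) (b i))
      = (\<Oplus>\<^bsub>T\<^esub>i\<in>I. pure a \<one>\<^bsub>K2\<^esub> \<otimes>\<^bsub>T\<^esub> pure (f i) (b i))"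
    using assms by (intro T.finsum_rdistr) (auto simp: Pi_def)
  also have "\<dots> = (\<Oplus>\<^bsub>T\<^esub>i\<in>I. pure (a \<otimes>\<^bsub>K1\<^esub> f i) (b i))"
    using assms by (intro T.finsum_cong') (auto simp: pure_mult Pi_def)
  finally show ?thesis .
qed

text \<open>Dividing by a coefficient of least value brings the sum into \<open>lat\<close>; in the
  residue the coefficient at \<open>l\<close> becomes 1, so the residue is a nontrivial combination
  of the \<open>b i\<close>.\<close>

lemma scaled_residue:
  assumes I: "finite I" "a \<in> I \<rightarrow> carrier K1" "b \<in> I \<rightarrow> carrier K2" "i0 \<in> I" "a i0 \<noteq> \<zero>\<^bsub>K1\<^esub>"
  shows "\<exists>l\<in>I. a l \<noteq> \<zero>\<^bsub>K1\<^esub> \<and>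
    pure (inv\<^bsub>K1\<^esub> (a l)) \<one>\<^bsub>K2\<^esub> \<otimes>\<^bsub>T\<^esub> (\<Oplus>\<^bsub>T\<^esub>i\<in>I. pure (a i) (b i)) \<in> lat \<and>
    \<rho> (pure (inv\<^bsub>K1\<^esub> (a l)) \<one>\<^bsub>K2\<^esub> \<otimes>\<^bsub>T\<^esub> (\<Oplus>\<^bsub>T\<^esub>i\<in>I. pure (a i) (b i))) =
      (\<Oplus>\<^bsub>K2\<^esub>i\<in>I. g2 (r (inv\<^bsub>K1\<^esub> (a l) \<otimes>\<^bsub>K1\<^esub> a i)) \<otimes>\<^bsub>K2\<^esub> b i)"
proof -
  have ac: "a i \<in> carrier K1" if "i \<in> I" for i using I(2) that by auto
  obtain l where l: "l \<in> I" "a l \<noteq> \<zero>\<^bsub>K1\<^esub>" "\<forall>i\<in>I. inv\<^bsub>K1\<^esub> (a l) \<otimes>\<^bsub>K1\<^esub> a i \<in> U"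
    using K1.exists_dominant[of "carrier K1" U I a i0, OF U K1.carrier_is_subfield I(1) ac I(4,5)] by blast
  have il: "inv\<^bsub>K1\<^esub> (a l) \<in> carrier K1" using K1.nonzero_inv(1) ac l by auto
  let ?v = "\<Oplus>\<^bsub>T\<^esub>i\<in>I. pure (inv\<^bsub>K1\<^esub> (a l) \<otimes>\<^bsub>K1\<^esub> a i) (b i)"
  have v: "pure (inv\<^bsub>K1\<^esub> (a l)) \<one>\<^bsub>K2\<^esub> \<otimes>\<^bsub>T\<^esub> (\<Oplus>\<^bsub>T\<^esub>i\<in>I. pure (a i) (b i)) = ?v"
    by (rule pure_scale[OF I(1) il I(2,3)])
  have "?v \<in> lat"
  proof (rule T.finsum_mem)
    show "\<zero>\<^bsub>T\<^esub> \<in> lat" by (rule T.add_span.zero)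
    show "x \<oplus>\<^bsub>T\<^esub> y \<in> lat" if "x \<in> lat" "y \<in> lat" for x y
      using T.add_span_add[OF lattice_gens that] .
    show "pure (inv\<^bsub>K1\<^esub> (a l) \<otimes>\<^bsub>K1\<^esub> a i) (b i) \<in> lat" if "i \<in> I" for i
      using T.add_span_incl[OF lattice_gens, THEN subsetD] l(3) I(3) that by blast
  qed (rule lattice_carrier)
  moreover have "\<rho> ?v = (\<Oplus>\<^bsub>K2\<^esub>i\<in>I. \<rho> (pure (inv\<^bsub>K1\<^esub> (a l) \<otimes>\<^bsub>K1\<^esub> a i) (b i)))"
    using il ac I by (intro rho_finsum) (auto simp: Pi_def)
  then have "\<rho> ?v = (\<Oplus>\<^bsub>K2\<^esub>i\<in>I. g2 (r (inv\<^bsub>K1\<^esub> (a l) \<otimes>\<^bsub>K1\<^esub> a i)) \<otimes>\<^bsub>K2\<^esub> b i)"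
    using il ac I g2r_closed by (subst (asm) K2.finsum_cong') (auto simp: rho_pure Pi_def)
  ultimately show ?thesis unfolding v[symmetric] using l(1,2) by blast
qed

text \<open>Applying \<open>\<rho>\<close> to the normalised relation turns its coefficients into
  scalars of \<open>K0\<close>, one of which is 1. This is linear disjointness in its usual form,
  and it starts the construction along the tree.\<close>

lemma relation_coefficients:
  assumes I: "finite I" "a \<in> I \<rightarrow> carrier K1" "b \<in> I \<rightarrow> carrier K2" "i0 \<in> I" "a i0 \<noteq> \<zero>\<^bsub>K1\<^esub>"
    and z: "(\<Oplus>\<^bsub>T\<^esub>i\<in>I. pure (a i) (b i)) = \<zero>\<^bsub>T\<^esub>"
  shows "\<exists>c. c \<in> I \<rightarrow> carrier K0 \<and> (\<exists>i\<in>I. c i = \<one>\<^bsub>K0\<^esub>) \<and> (\<Oplus>\<^bsub>K2\<^esub>i\<in>I. g2 (c i) \<otimes>\<^bsub>K2\<^esub> b i) = \<zero>\<^bsub>K2\<^esub>"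
proof -
  have ac: "a i \<in> carrier K1" if "i \<in> I" for i using I(2) that by auto
  obtain l where l: "l \<in> I" "a l \<noteq> \<zero>\<^bsub>K1\<^esub>"
    "\<rho> (pure (inv\<^bsub>K1\<^esub> (a l)) \<one>\<^bsub>K2\<^esub> \<otimes>\<^bsub>T\<^esub> (\<Oplus>\<^bsub>T\<^esub>i\<in>I. pure (a i) (b i))) =
      (\<Oplus>\<^bsub>K2\<^esub>i\<in>I. g2 (r (inv\<^bsub>K1\<^esub> (a l) \<otimes>\<^bsub>K1\<^esub> a i)) \<otimes>\<^bsub>K2\<^esub> b i)"
    using scaled_residue[OF I] by blast
  note il = K1.nonzero_inv[OF ac[OF l(1)] l(2)]
  have "(\<Oplus>\<^bsub>K2\<^esub>i\<in>I. g2 (r (inv\<^bsub>K1\<^esub> (a l) \<otimes>\<^bsub>K1\<^esub> a i)) \<otimes>\<^bsub>K2\<^esub> b i) = \<zero>\<^bsub>K2\<^esub>"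
    using l(3) il(1) unfolding z by (simp add: rho_zero)
  moreover have "r (inv\<^bsub>K1\<^esub> (a l) \<otimes>\<^bsub>K1\<^esub> a l) = \<one>\<^bsub>K0\<^esub>" using il(4) r_one by simp
  moreover have "(\<lambda>i. r (inv\<^bsub>K1\<^esub> (a l) \<otimes>\<^bsub>K1\<^esub> a i)) \<in> I \<rightarrow> carrier K0"
    using il(1) ac r_closed by auto
  ultimately show ?thesis
    using l(1) by (intro exI[of _ "\<lambda>i. r (inv\<^bsub>K1\<^esub> (a l) \<otimes>\<^bsub>K1\<^esub> a i)"]) auto
qed

text \<open>A vanishing residue is itself a relation among the \<open>b i\<close> with coefficients
  in \<open>K0\<close> and coefficient 1 at \<open>l\<close>. It expresses \<open>b l\<close> by the
  others, so the same tensor has a shorter representation, and induction on the number of terms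
  applies.\<close>

lemma nonzero_residue_sum:
  "finite I \<Longrightarrow> a \<in> I \<rightarrow> carrier K1 \<Longrightarrow> b \<in> I \<rightarrow> carrier K2 \<Longrightarrow>
    (\<Oplus>\<^bsub>T\<^esub>i\<in>I. pure (a i) (b i)) \<noteq> \<zero>\<^bsub>T\<^esub> \<Longrightarrow>
    \<exists>c\<in>carrier K1. pure c \<one>\<^bsub>K2\<^esub> \<otimes>\<^bsub>T\<^esub> (\<Oplus>\<^bsub>T\<^esub>i\<in>I. pure (a i) (b i)) \<in> lat \<and>
      \<rho> (pure c \<one>\<^bsub>K2\<^esub> \<otimes>\<^bsub>T\<^esub> (\<Oplus>\<^bsub>T\<^esub>i\<in>I. pure (a i) (b i))) \<noteq> \<zero>\<^bsub>K2\<^esub>" for I :: "nat set"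
proof (induction "card I" arbitrary: I a rule: less_induct)
  case less
  note I = less.prems(1-3) and nz = less.prems(4)
  have ac: "a i \<in> carrier K1" and bc: "b i \<in> carrier K2" if "i \<in> I" for i using I that by auto
  let ?u = "\<Oplus>\<^bsub>T\<^esub>i\<in>I. pure (a i) (b i)"
  have uc: "?u \<in> carrier T" using ac bc by (intro T.finsum_closed) auto
  have "\<exists>i\<in>I. a i \<noteq> \<zero>\<^bsub>K1\<^esub>"
  proof (rule ccontr)
    assume "\<not> ?thesis"
    then have "?u = (\<Oplus>\<^bsub>T\<^esub>i\<in>I. \<zero>\<^bsub>T\<^esub>)" using bc by (intro T.finsum_cong') (auto simp: pure_zero)
    then show False using nz by simp
  qed
  then obtain i0 where "i0 \<in> I" "a i0 \<noteq> \<zero>\<^bsub>K1\<^esub>" by auto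
  from scaled_residue[OF I this]
  obtain l where l: "l \<in> I" "a l \<noteq> \<zero>\<^bsub>K1\<^esub>"
    "pure (inv\<^bsub>K1\<^esub> (a l)) \<one>\<^bsub>K2\<^esub> \<otimes>\<^bsub>T\<^esub> ?u \<in> lat"
    "\<rho> (pure (inv\<^bsub>K1\<^esub> (a l)) \<one>\<^bsub>K2\<^esub> \<otimes>\<^bsub>T\<^esub> ?u) =
      (\<Oplus>\<^bsub>K2\<^esub>i\<in>I. g2 (r (inv\<^bsub>K1\<^esub> (a l) \<otimes>\<^bsub>K1\<^esub> a i)) \<otimes>\<^bsub>K2\<^esub> b i)"
    by blast
  note alc = ac[OF l(1)]
  note il = K1.nonzero_inv[OF alc l(2)]
  show ?case
  proof (cases "\<rho> (pure (inv\<^bsub>K1\<^esub> (a l)) \<one>\<^bsub>K2\<^esub> \<otimes>\<^bsub>T\<^esub> ?u) = \<zero>\<^bsub>K2\<^esub>")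
    case False
    then show ?thesis using il(1) l(3) by blast
  next
    case True
    define c where "c i = r (inv\<^bsub>K1\<^esub> (a l) \<otimes>\<^bsub>K1\<^esub> a i)" for i
    have c: "c i \<in> carrier K0" if "i \<in> I" for i unfolding c_def using il(1) ac[OF that] r_closed by simp
    have cl: "c l = \<one>\<^bsub>K0\<^esub>" unfolding c_def using il(4) r_one by simp
    have sum0: "(\<Oplus>\<^bsub>K2\<^esub>i\<in>I. g2 (c i) \<otimes>\<^bsub>K2\<^esub> b i) = \<zero>\<^bsub>K2\<^esub>" using True l(4) unfolding c_def by simp
    \<comment> \<open>The coefficients after substituting for \<open>b l\<close>: the scalars
      \<open>c i\<close> are moved across the tensor sign, and the part with left factor
      \<open>a l\<close> sums to zero.\<close>
    define a' where "a' i = a i \<ominus>\<^bsub>K1\<^esub> g1 (c i) \<otimes>\<^bsub>K1\<^esub> a l" for i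
    have a'c: "a' i \<in> carrier K1" if "i \<in> I" for i
      unfolding a'_def using ac[OF that] alc hom1[OF c[OF that]] by simp
    have split: "pure (a i) (b i) = pure (a' i) (b i) \<oplus>\<^bsub>T\<^esub> pure (a l) (g2 (c i) \<otimes>\<^bsub>K2\<^esub> b i)" if i: "i \<in> I" for i
    proof -
      note h = ac[OF i] alc hom1[OF c[OF i]]
      have "a i = a' i \<oplus>\<^bsub>K1\<^esub> g1 (c i) \<otimes>\<^bsub>K1\<^esub> a l" unfolding a'_def using h by algebra
      then have "pure (a i) (b i) = pure (a' i) (b i) \<oplus>\<^bsub>T\<^esub> pure (g1 (c i) \<otimes>\<^bsub>K1\<^esub> a l) (b i)"
        using pure_add_left[OF a'c[OF i] _ bc[OF i], of "g1 (c i) \<otimes>\<^bsub>K1\<^esub> a l"] h by simp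
      then show ?thesis using pure_balanced[OF c[OF i] alc bc[OF i]] by simp
    qed
    have pf: "pure (a l) (\<Oplus>\<^bsub>K2\<^esub>i\<in>I. f i) = (\<Oplus>\<^bsub>T\<^esub>i\<in>I. pure (a l) (f i))"
      if "f \<in> I \<rightarrow> carrier K2" for f
      by (rule finsum_hom[OF K2.abelian_monoid_axioms T.abelian_monoid_axioms that I(1)])
        (use alc in \<open>auto simp: pure_add_right pure_zero\<close>)
    have "?u = (\<Oplus>\<^bsub>T\<^esub>i\<in>I. pure (a' i) (b i) \<oplus>\<^bsub>T\<^esub> pure (a l) (g2 (c i) \<otimes>\<^bsub>K2\<^esub> b i))"
      using split a'c bc alc hom2 c by (intro T.finsum_cong') auto
    also have "\<dots> = (\<Oplus>\<^bsub>T\<^esub>i\<in>I. pure (a' i) (b i)) \<oplus>\<^bsub>T\<^esub> (\<Oplus>\<^bsub>T\<^esub>i\<in>I. pure (a l) (g2 (c i) \<otimes>\<^bsub>K2\<^esub> b i))"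
      using a'c bc alc hom2 c by (intro T.finsum_addf) auto
    also have "(\<Oplus>\<^bsub>T\<^esub>i\<in>I. pure (a l) (g2 (c i) \<otimes>\<^bsub>K2\<^esub> b i)) = \<zero>\<^bsub>T\<^esub>"
      using pf[of "\<lambda>i. g2 (c i) \<otimes>\<^bsub>K2\<^esub> b i"] bc hom2 c sum0 pure_zero(2)[OF alc] by simp
    finally have u': "?u = (\<Oplus>\<^bsub>T\<^esub>i\<in>I. pure (a' i) (b i))"
      using T.finsum_closed[of "\<lambda>i. pure (a' i) (b i)" I] a'c bc by simp
    have "a' l = \<zero>\<^bsub>K1\<^esub>" unfolding a'_def using cl hom_one1 alc by (simp add: a_minus_def K1.r_neg)
    then have "pure (a' l) (b l) = \<zero>\<^bsub>T\<^esub>" using pure_zero(1) bc l(1) by simp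
    moreover have "(\<Oplus>\<^bsub>T\<^esub>i\<in>insert l (I - {l}). pure (a' i) (b i)) =
        pure (a' l) (b l) \<oplus>\<^bsub>T\<^esub> (\<Oplus>\<^bsub>T\<^esub>i\<in>I - {l}. pure (a' i) (b i))"
      using I(1) a'c bc l(1) by (intro T.finsum_insert) auto
    moreover have "(\<Oplus>\<^bsub>T\<^esub>i\<in>I - {l}. pure (a' i) (b i)) \<in> carrier T"
      using a'c bc by (intro T.finsum_closed) auto
    ultimately have u'': "?u = (\<Oplus>\<^bsub>T\<^esub>i\<in>I - {l}. pure (a' i) (b i))"
      unfolding u' using l(1) by (simp add: insert_absorb)
    have "card (I - {l}) < card I" using I(1) l(1) by (rule card_Diff1_less)
    from less.hyps[OF this, of a'] show ?thesis
      unfolding u'' using I a'c bc nz unfolding u'' by auto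
  qed
qed

lemma nonzero_residue:
  assumes "u \<in> carrier T" "u \<noteq> \<zero>\<^bsub>T\<^esub>"
  shows "\<exists>c\<in>carrier K1. pure c \<one>\<^bsub>K2\<^esub> \<otimes>\<^bsub>T\<^esub> u \<in> lat \<and> \<rho> (pure c \<one>\<^bsub>K2\<^esub> \<otimes>\<^bsub>T\<^esub> u) \<noteq> \<zero>\<^bsub>K2\<^esub>"
proof -
  have G: "{pure a b | a b. a \<in> carrier K1 \<and> b \<in> carrier K2} \<subseteq> carrier T" by auto
  obtain n :: nat and g where g: "\<And>i. i < n \<Longrightarrow> g i \<in> {pure a b | a b. a \<in> carrier K1 \<and> b \<in> carrier K2}"
    "u = (\<Oplus>\<^bsub>T\<^esub>i\<in>{..<n}. g i)"
    using T.add_span_finsum[OF G] pure_span assms(1) by blast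
  have "\<forall>i\<in>{..<n}. \<exists>p. g i = pure (fst p) (snd p) \<and> fst p \<in> carrier K1 \<and> snd p \<in> carrier K2"
    using g(1) by fastforce
  then obtain p where p: "\<And>i. i < n \<Longrightarrow> g i = pure (fst (p i)) (snd (p i))"
    "\<And>i. i < n \<Longrightarrow> fst (p i) \<in> carrier K1" "\<And>i. i < n \<Longrightarrow> snd (p i) \<in> carrier K2"
    by (metis lessThan_iff)
  have "u = (\<Oplus>\<^bsub>T\<^esub>i\<in>{..<n}. pure ((fst \<circ> p) i) ((snd \<circ> p) i))"
    unfolding g(2) using p by (intro T.finsum_cong') auto
  then show ?thesis
    using nonzero_residue_sum[of "{..<n}" "fst \<circ> p" "snd \<circ> p"] p(2,3) assms(2) by auto
qed

lemma domain_T: "domain T"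
proof (rule domainI[OF T.cring_axioms])
  show one: "\<one>\<^bsub>T\<^esub> \<noteq> \<zero>\<^bsub>T\<^esub>"
  proof
    assume "\<one>\<^bsub>T\<^esub> = \<zero>\<^bsub>T\<^esub>"
    then have "\<rho> (pure \<one>\<^bsub>K1\<^esub> \<one>\<^bsub>K2\<^esub>) = \<zero>\<^bsub>K2\<^esub>" using rho_zero pure_one by simp
    then show False using rho_pure[of "\<one>\<^bsub>K1\<^esub>" "\<one>\<^bsub>K2\<^esub>"] r_one hom_one2 by simp
  qed
  fix u v assume uv: "u \<otimes>\<^bsub>T\<^esub> v = \<zero>\<^bsub>T\<^esub>" "u \<in> carrier T" "v \<in> carrier T"
  show "u = \<zero>\<^bsub>T\<^esub> \<or> v = \<zero>\<^bsub>T\<^esub>"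
  proof (rule ccontr)
    assume "\<not> ?thesis"
    then obtain c d where c: "c \<in> carrier K1" "pure c \<one>\<^bsub>K2\<^esub> \<otimes>\<^bsub>T\<^esub> u \<in> lat"
        "\<rho> (pure c \<one>\<^bsub>K2\<^esub> \<otimes>\<^bsub>T\<^esub> u) \<noteq> \<zero>\<^bsub>K2\<^esub>"
      and d: "d \<in> carrier K1" "pure d \<one>\<^bsub>K2\<^esub> \<otimes>\<^bsub>T\<^esub> v \<in> lat"
        "\<rho> (pure d \<one>\<^bsub>K2\<^esub> \<otimes>\<^bsub>T\<^esub> v) \<noteq> \<zero>\<^bsub>K2\<^esub>"
      using nonzero_residue[OF uv(2)] nonzero_residue[OF uv(3)] by blast
    let ?c = "pure c \<one>\<^bsub>K2\<^esub>" and ?d = "pure d \<one>\<^bsub>K2\<^esub>"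
    have cd: "?c \<in> carrier T" "?d \<in> carrier T" using c d by auto
    have "(?c \<otimes>\<^bsub>T\<^esub> u) \<otimes>\<^bsub>T\<^esub> (?d \<otimes>\<^bsub>T\<^esub> v) = (?c \<otimes>\<^bsub>T\<^esub> ?d) \<otimes>\<^bsub>T\<^esub> (u \<otimes>\<^bsub>T\<^esub> v)"
      using cd uv(2,3) by (simp add: T.m_ac)
    then have "(?c \<otimes>\<^bsub>T\<^esub> u) \<otimes>\<^bsub>T\<^esub> (?d \<otimes>\<^bsub>T\<^esub> v) = \<zero>\<^bsub>T\<^esub>" using uv(1) cd by simp
    then have "\<rho> (?c \<otimes>\<^bsub>T\<^esub> u) \<otimes>\<^bsub>K2\<^esub> \<rho> (?d \<otimes>\<^bsub>T\<^esub> v) = \<zero>\<^bsub>K2\<^esub>"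
      using rho_mult[OF c(2) d(2)] rho_zero by simp
    then show False using c(3) d(3) cd uv(2,3) rho_closed K2.integral_iff by auto
  qed
qed

end

section \<open>Fractions\<close>

context domain
begin

definition fraction_pairs :: "('a \<times> 'a) set"
  where "fraction_pairs = carrier R \<times> (carrier R - {\<zero>})"

text \<open>The full equivalence class, so that equal fractions are equal sets.\<close>

definition fraction :: "'a \<Rightarrow> 'a \<Rightarrow> ('a \<times> 'a) set"
  where "fraction a b = {(c, d) \<in> fraction_pairs. a \<otimes> d = c \<otimes> b}"

text \<open>An arbitrary choice; that the operations do not depend on it is the content of
  \<open>fraction_mult\<close> and \<open>fraction_add\<close>.\<close>

definition representative :: "('a \<times> 'a) set \<Rightarrow> 'a \<times> 'a"
  where "representative x = (SOME p. p \<in> x)"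

definition fraction_field :: "('a \<times> 'a) set ring"
  where "fraction_field =
    \<lparr>carrier = (\<lambda>(a, b). fraction a b) ` fraction_pairs,
     monoid.mult = (\<lambda>x y. case (representative x, representative y) of
       ((a, b), (c, d)) \<Rightarrow> fraction (a \<otimes> c) (b \<otimes> d)),
     one = fraction \<one> \<one>,
     ring.zero = fraction \<zero> \<one>,
     ring.add = (\<lambda>x y. case (representative x, representative y) of
       ((a, b), (c, d)) \<Rightarrow> fraction (a \<otimes> d \<oplus> c \<otimes> b) (b \<otimes> d))\<rparr>"

lemma pairsD: "(a, b) \<in> fraction_pairs \<Longrightarrow> a \<in> carrier R \<and> b \<in> carrier R \<and> b \<noteq> \<zero>"
  unfolding fraction_pairs_def by auto

lemma pairsI: "a \<in> carrier R \<Longrightarrow> b \<in> carrier R \<Longrightarrow> b \<noteq> \<zero> \<Longrightarrow> (a, b) \<in> fraction_pairs"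
  unfolding fraction_pairs_def by auto

lemma pairs_mult:
  assumes "(a, b) \<in> fraction_pairs" "(c, d) \<in> fraction_pairs"
  shows "(a \<otimes> c, b \<otimes> d) \<in> fraction_pairs" "(a \<otimes> d \<oplus> c \<otimes> b, b \<otimes> d) \<in> fraction_pairs"
  using pairsD[OF assms(1)] pairsD[OF assms(2)] by (auto intro!: pairsI simp: integral_iff)

lemma fraction_eq:
  assumes p: "(a, b) \<in> fraction_pairs" and q: "(c, d) \<in> fraction_pairs"
  shows "fraction a b = fraction c d \<longleftrightarrow> a \<otimes> d = c \<otimes> b"
proof
  note cr = pairsD[OF p] pairsD[OF q]
  assume "fraction a b = fraction c d"
  moreover have "(c, d) \<in> fraction c d" using q unfolding fraction_def by auto
  ultimately have "(c, d) \<in> fraction a b" by simp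
  then show "a \<otimes> d = c \<otimes> b" unfolding fraction_def by auto
next
  note cr = pairsD[OF p] pairsD[OF q]
  assume eq: "a \<otimes> d = c \<otimes> b"
  have "a \<otimes> f = e \<otimes> b \<longleftrightarrow> c \<otimes> f = e \<otimes> d" if ef: "(e, f) \<in> fraction_pairs" for e f
  proof -
    note cef = pairsD[OF ef]
    \<comment> \<open>Transitivity of cross-multiplication: the equation is multiplied by
      \<open>d\<close>, rewritten by the hypothesis, and then \<open>b\<close> is cancelled.\<close>
    have "a \<otimes> f = e \<otimes> b \<longleftrightarrow> d \<otimes> (a \<otimes> f) = d \<otimes> (e \<otimes> b)"
      using cr cef by (subst m_lcancel) auto
    also have "d \<otimes> (a \<otimes> f) = b \<otimes> (c \<otimes> f)"
    proof -
      have "d \<otimes> (a \<otimes> f) = (a \<otimes> d) \<otimes> f" using cr cef by (simp add: m_ac)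
      also have "\<dots> = b \<otimes> (c \<otimes> f)" unfolding eq using cr cef by (simp add: m_ac)
      finally show ?thesis .
    qed
    also have "d \<otimes> (e \<otimes> b) = b \<otimes> (e \<otimes> d)" using cr cef by (simp add: m_ac)
    also have "b \<otimes> (c \<otimes> f) = b \<otimes> (e \<otimes> d) \<longleftrightarrow> c \<otimes> f = e \<otimes> d"
      using cr cef by (subst m_lcancel) auto
    finally show ?thesis .
  qed
  then show "fraction a b = fraction c d" unfolding fraction_def by auto
qed

lemma representative_fraction:
  assumes p: "(a, b) \<in> fraction_pairs"
  obtains c d where "representative (fraction a b) = (c, d)" "(c, d) \<in> fraction_pairs" "a \<otimes> d = c \<otimes> b"
proof -
  have "(a, b) \<in> fraction a b" using p unfolding fraction_def by auto
  then have "representative (fraction a b) \<in> fraction a b" unfolding representative_def by (rule someI)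
  then show ?thesis using that unfolding fraction_def by (cases "representative (fraction a b)") auto
qed

lemma fraction_mult:
  assumes p: "(a, b) \<in> fraction_pairs" and q: "(c, d) \<in> fraction_pairs"
  shows "fraction a b \<otimes>\<^bsub>fraction_field\<^esub> fraction c d = fraction (a \<otimes> c) (b \<otimes> d)"
proof -
  obtain a' b' where p': "representative (fraction a b) = (a', b')" "(a', b') \<in> fraction_pairs" "a \<otimes> b' = a' \<otimes> b"
    using representative_fraction[OF p] .
  obtain c' d' where q': "representative (fraction c d) = (c', d')" "(c', d') \<in> fraction_pairs" "c \<otimes> d' = c' \<otimes> d"
    using representative_fraction[OF q] .
  note cr = pairsD[OF p] pairsD[OF q] pairsD[OF p'(2)] pairsD[OF q'(2)]
  have "(a' \<otimes> c') \<otimes> (b \<otimes> d) = (a' \<otimes> b) \<otimes> (c' \<otimes> d)" using cr by (simp add: m_ac)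
  also have "\<dots> = (a \<otimes> c) \<otimes> (b' \<otimes> d')"
    unfolding p'(3)[symmetric] q'(3)[symmetric] using cr by (simp add: m_ac)
  finally have "fraction (a' \<otimes> c') (b' \<otimes> d') = fraction (a \<otimes> c) (b \<otimes> d)"
    unfolding fraction_eq[OF pairs_mult(1)[OF p'(2) q'(2)] pairs_mult(1)[OF p q]] .
  then show ?thesis unfolding fraction_field_def using p'(1) q'(1) by simp
qed

lemma fraction_add:
  assumes p: "(a, b) \<in> fraction_pairs" and q: "(c, d) \<in> fraction_pairs"
  shows "fraction a b \<oplus>\<^bsub>fraction_field\<^esub> fraction c d = fraction (a \<otimes> d \<oplus> c \<otimes> b) (b \<otimes> d)"
proof -
  obtain a' b' where p': "representative (fraction a b) = (a', b')" "(a', b') \<in> fraction_pairs" "a \<otimes> b' = a' \<otimes> b"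
    using representative_fraction[OF p] .
  obtain c' d' where q': "representative (fraction c d) = (c', d')" "(c', d') \<in> fraction_pairs" "c \<otimes> d' = c' \<otimes> d"
    using representative_fraction[OF q] .
  note cr = pairsD[OF p] pairsD[OF q] pairsD[OF p'(2)] pairsD[OF q'(2)]
  have "(a' \<otimes> d' \<oplus> c' \<otimes> b') \<otimes> (b \<otimes> d) = (a' \<otimes> b) \<otimes> (d \<otimes> d') \<oplus> (c' \<otimes> d) \<otimes> (b \<otimes> b')"
    using cr by (simp add: l_distr r_distr m_ac)
  also have "\<dots> = (a \<otimes> d \<oplus> c \<otimes> b) \<otimes> (b' \<otimes> d')"
    unfolding p'(3)[symmetric] q'(3)[symmetric] using cr by (simp add: l_distr r_distr m_ac)
  finally have "fraction (a' \<otimes> d' \<oplus> c' \<otimes> b') (b' \<otimes> d') = fraction (a \<otimes> d \<oplus> c \<otimes> b) (b \<otimes> d)"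
    unfolding fraction_eq[OF pairs_mult(2)[OF p'(2) q'(2)] pairs_mult(2)[OF p q]] .
  then show ?thesis unfolding fraction_field_def using p'(1) q'(1) by simp
qed

lemma fraction_carrier:
  "x \<in> carrier fraction_field \<longleftrightarrow> (\<exists>a b. (a, b) \<in> fraction_pairs \<and> x = fraction a b)"
  unfolding fraction_field_def by auto

lemma field_fraction_field: "field fraction_field"
proof -
  let ?F = "fraction_field"
  have [simp]: "\<one>\<^bsub>?F\<^esub> = fraction \<one> \<one>" "\<zero>\<^bsub>?F\<^esub> = fraction \<zero> \<one>" by (simp_all add: fraction_field_def)
  have one: "(\<one>, \<one>) \<in> fraction_pairs" and zero: "(\<zero>, \<one>) \<in> fraction_pairs" by (auto intro: pairsI)
  note mp = pairs_mult(1) and ap = pairs_mult(2)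
  have "cring ?F"
  proof (rule cringI)
    show "abelian_group ?F"
    proof (rule abelian_groupI)
      show "\<zero>\<^bsub>?F\<^esub> \<in> carrier ?F" using zero fraction_carrier by auto
      fix x assume "x \<in> carrier ?F"
      then obtain a b where x: "(a, b) \<in> fraction_pairs" "x = fraction a b" using fraction_carrier by auto
      note cx = pairsD[OF x(1)]
      show "\<zero>\<^bsub>?F\<^esub> \<oplus>\<^bsub>?F\<^esub> x = x" using fraction_add[OF zero x(1)] cx x(2) by simp
      have n: "(\<ominus> a, b) \<in> fraction_pairs" using cx by (auto intro: pairsI)
      have "fraction (\<ominus> a) b \<oplus>\<^bsub>?F\<^esub> x = fraction (\<ominus> a \<otimes> b \<oplus> a \<otimes> b) (b \<otimes> b)"
        unfolding x(2) by (rule fraction_add[OF n x(1)])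
      also have "\<dots> = fraction \<zero> \<one>"
        using cx by (subst fraction_eq) (auto intro!: pairsI simp: integral_iff l_minus l_neg)
      finally have "fraction (\<ominus> a) b \<oplus>\<^bsub>?F\<^esub> x = \<zero>\<^bsub>?F\<^esub>" by simp
      then show "\<exists>y\<in>carrier ?F. y \<oplus>\<^bsub>?F\<^esub> x = \<zero>\<^bsub>?F\<^esub>" using n fraction_carrier by blast
      fix y assume "y \<in> carrier ?F"
      then obtain c d where y: "(c, d) \<in> fraction_pairs" "y = fraction c d" using fraction_carrier by auto
      note cy = pairsD[OF y(1)]
      show "x \<oplus>\<^bsub>?F\<^esub> y \<in> carrier ?F"
        using fraction_add[OF x(1) y(1)] ap[OF x(1) y(1)] x(2) y(2) fraction_carrier by auto
      show "x \<oplus>\<^bsub>?F\<^esub> y = y \<oplus>\<^bsub>?F\<^esub> x"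
        using fraction_add[OF x(1) y(1)] fraction_add[OF y(1) x(1)] cx cy x(2) y(2)
        by (simp add: m_comm a_comm)
      fix z assume "z \<in> carrier ?F"
      then obtain e f where z: "(e, f) \<in> fraction_pairs" "z = fraction e f" using fraction_carrier by auto
      note cz = pairsD[OF z(1)]
      have "(a \<otimes> d \<oplus> c \<otimes> b) \<otimes> f \<oplus> e \<otimes> (b \<otimes> d) = a \<otimes> (d \<otimes> f) \<oplus> (c \<otimes> f \<oplus> e \<otimes> d) \<otimes> b"
        using cx cy cz by (simp add: l_distr r_distr m_ac a_ac)
      then show "x \<oplus>\<^bsub>?F\<^esub> y \<oplus>\<^bsub>?F\<^esub> z = x \<oplus>\<^bsub>?F\<^esub> (y \<oplus>\<^bsub>?F\<^esub> z)"
        unfolding x(2) y(2) z(2) fraction_add[OF x(1) y(1)] fraction_add[OF y(1) z(1)]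
          fraction_add[OF ap[OF x(1) y(1)] z(1)] fraction_add[OF x(1) ap[OF y(1) z(1)]]
        using cx cy cz by (simp add: m_assoc)
    qed
    show "comm_monoid ?F"
    proof (rule comm_monoidI)
      show "\<one>\<^bsub>?F\<^esub> \<in> carrier ?F" using one fraction_carrier by auto
      fix x assume "x \<in> carrier ?F"
      then obtain a b where x: "(a, b) \<in> fraction_pairs" "x = fraction a b" using fraction_carrier by auto
      note cx = pairsD[OF x(1)]
      show "\<one>\<^bsub>?F\<^esub> \<otimes>\<^bsub>?F\<^esub> x = x" using fraction_mult[OF one x(1)] cx x(2) by simp
      fix y assume "y \<in> carrier ?F"
      then obtain c d where y: "(c, d) \<in> fraction_pairs" "y = fraction c d" using fraction_carrier by auto
      note cy = pairsD[OF y(1)]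
      show "x \<otimes>\<^bsub>?F\<^esub> y \<in> carrier ?F"
        using fraction_mult[OF x(1) y(1)] mp[OF x(1) y(1)] x(2) y(2) fraction_carrier by auto
      show "x \<otimes>\<^bsub>?F\<^esub> y = y \<otimes>\<^bsub>?F\<^esub> x"
        using fraction_mult[OF x(1) y(1)] fraction_mult[OF y(1) x(1)] cx cy x(2) y(2)
        by (simp add: m_comm)
      fix z assume "z \<in> carrier ?F"
      then obtain e f where z: "(e, f) \<in> fraction_pairs" "z = fraction e f" using fraction_carrier by auto
      note cz = pairsD[OF z(1)]
      show "x \<otimes>\<^bsub>?F\<^esub> y \<otimes>\<^bsub>?F\<^esub> z = x \<otimes>\<^bsub>?F\<^esub> (y \<otimes>\<^bsub>?F\<^esub> z)"
        unfolding x(2) y(2) z(2) fraction_mult[OF x(1) y(1)] fraction_mult[OF y(1) z(1)]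
          fraction_mult[OF mp[OF x(1) y(1)] z(1)] fraction_mult[OF x(1) mp[OF y(1) z(1)]]
        using cx cy cz by (simp add: m_assoc)
    qed
    fix x y z assume "x \<in> carrier ?F" "y \<in> carrier ?F" "z \<in> carrier ?F"
    then obtain a b c d e f where x: "(a, b) \<in> fraction_pairs" "x = fraction a b"
      and y: "(c, d) \<in> fraction_pairs" "y = fraction c d"
      and z: "(e, f) \<in> fraction_pairs" "z = fraction e f" using fraction_carrier by metis
    note cr = pairsD[OF x(1)] pairsD[OF y(1)] pairsD[OF z(1)]
    have "((a \<otimes> d \<oplus> c \<otimes> b) \<otimes> e) \<otimes> ((b \<otimes> f) \<otimes> (d \<otimes> f)) =
        ((a \<otimes> e) \<otimes> (d \<otimes> f) \<oplus> (c \<otimes> e) \<otimes> (b \<otimes> f)) \<otimes> ((b \<otimes> d) \<otimes> f)"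
      using cr by (simp add: l_distr r_distr m_ac)
    then show "(x \<oplus>\<^bsub>?F\<^esub> y) \<otimes>\<^bsub>?F\<^esub> z = x \<otimes>\<^bsub>?F\<^esub> z \<oplus>\<^bsub>?F\<^esub> y \<otimes>\<^bsub>?F\<^esub> z"
      unfolding x(2) y(2) z(2) fraction_add[OF x(1) y(1)] fraction_mult[OF x(1) z(1)]
        fraction_mult[OF y(1) z(1)] fraction_mult[OF ap[OF x(1) y(1)] z(1)]
        fraction_add[OF mp[OF x(1) z(1)] mp[OF y(1) z(1)]]
      by (subst fraction_eq) (use mp ap x y z in blast)+
  qed
  then interpret F: cring ?F .
  show ?thesis
  proof (rule F.cring_fieldI2)
    show "\<zero>\<^bsub>?F\<^esub> \<noteq> \<one>\<^bsub>?F\<^esub>" using fraction_eq[OF zero one] by simp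
    fix x assume "x \<in> carrier ?F" "x \<noteq> \<zero>\<^bsub>?F\<^esub>"
    then obtain a b where x: "(a, b) \<in> fraction_pairs" "x = fraction a b" "x \<noteq> fraction \<zero> \<one>"
      using fraction_carrier by auto
    note cx = pairsD[OF x(1)]
    have a0: "a \<noteq> \<zero>" using x(3) fraction_eq[OF x(1) zero] cx unfolding x(2) by auto
    have i: "(b, a) \<in> fraction_pairs" using cx a0 by (auto intro: pairsI)
    have "x \<otimes>\<^bsub>?F\<^esub> fraction b a = fraction (a \<otimes> b) (b \<otimes> a)"
      unfolding x(2) by (rule fraction_mult[OF x(1) i])
    also have "\<dots> = \<one>\<^bsub>?F\<^esub>"
      using cx by (simp, subst fraction_eq) (use mp[OF x(1) i] one in \<open>auto simp: m_comm\<close>)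
    finally show "\<exists>y\<in>carrier ?F. x \<otimes>\<^bsub>?F\<^esub> y = \<one>\<^bsub>?F\<^esub>" using i fraction_carrier by blast
  qed
qed

lemma fraction_embedding:
  "(\<lambda>a. fraction a \<one>) \<in> ring_hom R fraction_field" "inj_on (\<lambda>a. fraction a \<one>) (carrier R)"
proof -
  have p: "(a, \<one>) \<in> fraction_pairs" if "a \<in> carrier R" for a using that by (auto intro: pairsI)
  show "(\<lambda>a. fraction a \<one>) \<in> ring_hom R fraction_field"
  proof (rule ring_hom_memI)
    show "fraction x \<one> \<in> carrier fraction_field" if "x \<in> carrier R" for x
      using p[OF that] fraction_carrier by auto
    show "fraction \<one> \<one> = \<one>\<^bsub>fraction_field\<^esub>" by (simp add: fraction_field_def)
  qed (use p in \<open>simp_all add: fraction_mult fraction_add\<close>)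
  show "inj_on (\<lambda>a. fraction a \<one>) (carrier R)"
    using p by (intro inj_onI) (simp add: fraction_eq)
qed

end

section \<open>Amalgamation\<close>

lemma root_closed_image:
  fixes K :: "('a, 'k) ring_scheme" and L :: "('b, 'm) ring_scheme"
  assumes K: "algebraically_closed K" and L: "field L" and h: "h \<in> ring_hom K L"
  shows "field.root_closed L (h ` carrier K)"
proof -
  interpret K: algebraically_closed K by fact
  interpret L: field L by fact
  interpret h: ring_hom_ring K L h by (rule ring_hom_ringI2[OF K.ring_axioms L.ring_axioms h])
  show ?thesis
    unfolding L.root_closed_def
  proof (intro allI impI, elim conjE)
    fix p assume p: "p \<noteq> []" "set p \<subseteq> h ` carrier K"
    define q where "q = map (inv_into (carrier K) h) p"
    have q: "p = map h q" "set q \<subseteq> carrier K"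
      using p(2) unfolding q_def by (auto simp: f_inv_into_f inv_into_into subset_iff intro!: map_idI[symmetric])
    let ?P = "\<one>\<^bsub>K\<^esub> # q"
    have P: "?P \<in> carrier (poly_ring K)"
      unfolding univ_poly_carrier[symmetric] polynomial_def using q(2) by auto
    \<comment> \<open>Algebraic closedness is available as splitting, so the number of roots counted
      with multiplicity is the degree, which is positive.\<close>
    have "size (K.roots ?P) = length q" using K.roots_over_carrier[OF P] unfolding K.splitted_def by simp
    then have "K.roots ?P \<noteq> {#}" using p q by auto
    then obtain x where "x \<in># K.roots ?P" by auto
    then have x: "x \<in> carrier K" "K.eval ?P x = \<zero>\<^bsub>K\<^esub>"
      using K.roots_mem_iff_is_root[OF P] unfolding K.is_root_def by auto
    have "h (K.eval ?P x) = L.eval (map h ?P) (h x)"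
      using q(2) x(1) by (intro h.eval_hom') auto
    moreover have "map h ?P = \<one>\<^bsub>L\<^esub> # p" using q(1) by simp
    ultimately have "L.eval (\<one>\<^bsub>L\<^esub> # p) (h x) = \<zero>\<^bsub>L\<^esub>" unfolding x(2) h.hom_zero by metis
    then show "\<exists>\<alpha>\<in>h ` carrier K. L.eval (\<one>\<^bsub>L\<^esub> # p) \<alpha> = \<zero>\<^bsub>L\<^esub>" using x(1) by (intro bexI[of _ "h x"]) auto
  qed
qed

lemma valuation_ring_image:
  fixes K :: "('a, 'k) ring_scheme" and L :: "('b, 'm) ring_scheme"
  assumes K: "field K" and L: "field L" and h: "h \<in> ring_hom K L" and V: "valuation_ring V K"
  shows "field.val_subring L (h ` carrier K) (h ` V)"
proof -
  interpret K: field K by fact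
  interpret L: field L by fact
  interpret h: ring_hom_ring K L h by (rule ring_hom_ringI2[OF K.ring_axioms L.ring_axioms h])
  have V': "subring V K" "\<And>x. x \<in> carrier K \<Longrightarrow> x \<noteq> \<zero>\<^bsub>K\<^esub> \<Longrightarrow> x \<in> V \<or> inv\<^bsub>K\<^esub> x \<in> V"
    using V unfolding valuation_ring_def by auto
  have "h x \<in> h ` V \<or> inv\<^bsub>L\<^esub> (h x) \<in> h ` V" if x: "x \<in> carrier K" "h x \<noteq> \<zero>\<^bsub>L\<^esub>" for x
  proof -
    have x0: "x \<noteq> \<zero>\<^bsub>K\<^esub>" using x(2) h.hom_zero by auto
    note i = K.nonzero_inv[OF x(1) x0]
    have "h x \<otimes>\<^bsub>L\<^esub> h (inv\<^bsub>K\<^esub> x) = \<one>\<^bsub>L\<^esub>"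
      using i x(1) by (simp flip: h.hom_mult)
    then have "inv\<^bsub>L\<^esub> (h x) = h (inv\<^bsub>K\<^esub> x)" using x(1) i(1) by (intro L.comm_inv_char) auto
    then show ?thesis using V'(2)[OF x(1) x0] by auto
  qed
  moreover have "h ` V \<subseteq> h ` carrier K" using subringE(1)[OF V'(1)] by auto
  ultimately show ?thesis
    unfolding L.val_subring_def
    by (intro conjI ballI) (rule h.img_is_subring[OF V'(1)], assumption, blast)
qed

text \<open>Induction over downward closed sets of nodes, removing a maximal one. The ring at the
  removed node is chosen last, below the ring of its immediate predecessor.\<close>

lemma finite_tree_extension:
  fixes good :: "'p::finite_tree \<Rightarrow> 's set \<Rightarrow> bool"
  assumes base: "good bot B"
    and step: "\<And>p q V. p < q \<Longrightarrow> good p V \<Longrightarrow> \<exists>V'. V' \<subseteq> V \<and> good q V'"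
  shows "\<exists>F. (\<forall>p. good p (F p)) \<and> (\<forall>p q. p < q \<longrightarrow> F q \<subseteq> F p)"
proof -
  have "\<exists>F. (\<forall>p\<in>S. good p (F p)) \<and> (\<forall>p\<in>S. \<forall>q\<in>S. p < q \<longrightarrow> F q \<subseteq> F p)"
    if "\<forall>p\<in>S. \<forall>q\<le>p. q \<in> S" for S :: "'p set"
    using that
  proof (induction "card S" arbitrary: S rule: less_induct)
    case less
    show ?case
    proof (cases "S = {}")
      case True
      then show ?thesis by auto
    next
      case False
      then obtain q where q: "q \<in> S" "\<And>p. p \<in> S \<Longrightarrow> q \<le> p \<Longrightarrow> p = q"
        using finite_has_maximal[of S] by auto
      have down: "\<forall>p\<in>S - {q}. \<forall>r\<le>p. r \<in> S - {q}" using less.prems q(2) by blast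
      have card: "card (S - {q}) < card S" using q(1) by (intro card_Diff1_less) auto
      from less.hyps[OF card down]
      obtain F where F': "\<forall>p\<in>S - {q}. good p (F p)"
        "\<forall>p\<in>S - {q}. \<forall>r\<in>S - {q}. p < r \<longrightarrow> F r \<subseteq> F p"
        by (elim exE conjE)
      note F = F'(1)[THEN bspec] F'(2)[THEN bspec, THEN bspec, THEN mp]
      have "\<exists>V. good q V \<and> (\<forall>p<q. V \<subseteq> F p)"
      proof (cases "q = bot")
        case True
        then show ?thesis using base by auto
      next
        case False
        have "{p. p < q} \<noteq> {}" using False bot.not_eq_extremum by blast
        then obtain m where m: "m < q" "\<And>p. p < q \<Longrightarrow> m \<le> p \<Longrightarrow> p = m"
          using finite_has_maximal[of "{p. p < q}"] by auto
        \<comment> \<open>By totality of the interval below \<open>q\<close>, the maximal strict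
          predecessor \<open>m\<close> is the greatest one; a ring inside \<open>F m\<close> is then
          inside \<open>F p\<close> for every \<open>p < q\<close>.\<close>
        have le: "p \<le> m" if "p < q" for p
          using below_total[of p q m] m that by (metis less_imp_le)
        have mS: "p \<in> S - {q}" if "p < q" for p using less.prems q(1) that by auto
        obtain V where V: "V \<subseteq> F m" "good q V" using step[OF m(1) F(1)[OF mS[OF m(1)]]] by blast
        have "V \<subseteq> F p" if "p < q" for p
          using V(1) F(2)[OF mS[OF that] mS[OF m(1)]] le[OF that] unfolding le_less by auto
        then show ?thesis using V(2) by blast
      qed
      then obtain V where V: "good q V" "\<And>p. p < q \<Longrightarrow> V \<subseteq> F p" by blast
      have "\<not> q < p" if "p \<in> S" for p using q(2)[OF that] by (auto simp: less_le)
      then show ?thesis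
        using F V by (intro exI[of _ "F(q := V)"]) auto
    qed
  qed
  from this[of UNIV] show ?thesis by auto
qed

lemma inj_on_preimage_eq:
  assumes "inj_on f A" "B \<subseteq> A" "C \<inter> f ` A = f ` B"
  shows "{x \<in> A. f x \<in> C} = B"
proof (intro equalityI subsetI)
  fix x assume "x \<in> {x \<in> A. f x \<in> C}"
  then have "x \<in> A" "f x \<in> f ` B" using assms(3) by auto
  then show "x \<in> B" using inj_on_image_mem_iff[OF assms(1)] assms(2) by simp
next
  fix x assume "x \<in> B"
  then have "x \<in> A" "f x \<in> C" using assms(2,3) by auto
  then show "x \<in> {x \<in> A. f x \<in> C}" by simp
qed

section \<open>Assembling the amalgam in the field of fractions\<close>

theorem proposition5p1:
  fixes K0 :: "'a ring" and K1 :: "'b ring" and K2 :: "'c ring"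
    and V0 :: "'p::finite_tree \<Rightarrow> 'a set" and V1 :: "'p \<Rightarrow> 'b set" and V2 :: "'p \<Rightarrow> 'c set"
    and g1 :: "'a \<Rightarrow> 'b" and g2 :: "'a \<Rightarrow> 'c"
  assumes "tree_valued_field K0 V0" and "tree_valued_field K1 V1" and "tree_valued_field K2 V2"
    and "algebraically_closed K0"
    and "tree_valued_embedding K0 V0 K1 V1 g1"
    and "tree_valued_embedding K0 V0 K2 V2 g2"
  shows "\<exists>(K3 :: ('b, 'c) tensor_fraction ring) (V3 :: 'p \<Rightarrow> ('b, 'c) tensor_fraction set) f1 f2.
    tree_valued_field K3 V3 \<and>
    tree_valued_embedding K1 V1 K3 V3 f1 \<and>
    tree_valued_embedding K2 V2 K3 V3 f2 \<and>
    (\<forall>x \<in> carrier K0. f1 (g1 x) = f2 (g2 x)) \<and>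
    independent_amalgamation K0 K1 K2 g1 g2 K3 f1 f2"
proof -
  have fields: "field K0" "field K1" "field K2" using assms(1-3) unfolding tree_valued_field_def by auto
  have hg1: "g1 \<in> ring_hom K0 K1" "inj_on g1 (carrier K0)" "\<And>p. {x \<in> carrier K0. g1 x \<in> V1 p} = V0 p"
    and hg2: "g2 \<in> ring_hom K0 K2" "inj_on g2 (carrier K0)" "\<And>p. {x \<in> carrier K0. g2 x \<in> V2 p} = V0 p"
    using assms(5,6) unfolding tree_valued_embedding_def by auto
  interpret K0: field K0 by fact
  interpret K1: field K1 by fact
  interpret K2: field K2 by fact
  have "field_pair K0 K1 K2 g1 g2"
    by (intro field_pair.intro algebra_pair.intro algebra_pair_axioms.intro field_pair_axioms.intro
        K0.cring_axioms K1.cring_axioms K2.cring_axioms fields hg1 hg2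
        root_closed_image[OF assms(4) fields(2) hg1(1)])
  then interpret field_pair K0 K1 K2 g1 g2 .
  obtain U r \<rho> where "residue_data U r \<rho>" using residue_data_exists by blast
  then have "residue_pair K0 K1 K2 g1 g2 U r \<rho>"
    by (intro residue_pair.intro field_pair_axioms residue_pair_axioms.intro)
  then interpret residue_pair K0 K1 K2 g1 g2 U r \<rho> .
  interpret T: domain T by (rule domain_T)
  define L where "L = T.fraction_field"
  define \<iota> where "\<iota> u = T.fraction u \<one>\<^bsub>T\<^esub>" for u
  have fL: "field L" unfolding L_def by (rule T.field_fraction_field)
  interpret L: field L by (rule fL)
  have \<iota>: "\<iota> \<in> ring_hom T L" "inj_on \<iota> (carrier T)"
    unfolding \<iota>_def L_def by (rule T.fraction_embedding)+
  interpret \<iota>: ring_hom_ring T L \<iota> by (rule ring_hom_ringI2[OF T.ring_axioms L.ring_axioms \<iota>(1)])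
  define f1 where "f1 = \<iota> \<circ> (\<lambda>a. pure a \<one>\<^bsub>K2\<^esub>)"
  define f2 where "f2 = \<iota> \<circ> (\<lambda>b. pure \<one>\<^bsub>K1\<^esub> b)"
  have f1: "f1 \<in> ring_hom K1 L" unfolding f1_def by (rule ring_hom_trans[OF pure_hom_left \<iota>(1)])
  have f2: "f2 \<in> ring_hom K2 L" unfolding f2_def by (rule ring_hom_trans[OF pure_hom_right \<iota>(1)])
  interpret f1: ring_hom_ring K1 L f1 by (rule ring_hom_ringI2[OF K1.ring_axioms L.ring_axioms f1])
  interpret f2: ring_hom_ring K2 L f2 by (rule ring_hom_ringI2[OF K2.ring_axioms L.ring_axioms f2])
  \<comment> \<open>Both values are the image of the scalar \<open>x\<close> times the unit tensor,
    moved from the left factor to the right.\<close>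
  have agree: "f1 (g1 x) = f2 (g2 x)" if "x \<in> carrier K0" for x
    using pure_balanced[OF that, of "\<one>\<^bsub>K1\<^esub>" "\<one>\<^bsub>K2\<^esub>"] hom1[OF that] hom2[OF that]
    unfolding f1_def f2_def by simp
  have pure_f: "\<iota> (pure a b) = f1 a \<otimes>\<^bsub>L\<^esub> f2 b" if "a \<in> carrier K1" "b \<in> carrier K2" for a b
    using that pure_mult[of a "\<one>\<^bsub>K2\<^esub>" "\<one>\<^bsub>K1\<^esub>" b] unfolding f1_def f2_def
    by (simp flip: \<iota>.hom_mult)
  define k1 k2 k0 where "k1 = f1 ` carrier K1" and "k2 = f2 ` carrier K2" and "k0 = (f1 \<circ> g1) ` carrier K0"
  have k0': "k0 = (f2 \<circ> g2) ` carrier K0" unfolding k0_def using agree by auto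
  have sub: "subfield k1 L" "subfield k2 L" and inj: "inj_on f1 (carrier K1)" "inj_on f2 (carrier K2)"
    unfolding k1_def k2_def
    using f1.img_is_subfield[OF K1.carrier_is_subfield L.one_not_zero]
      f2.img_is_subfield[OF K2.carrier_is_subfield L.one_not_zero] by auto
  have fg: "f1 \<circ> g1 \<in> ring_hom K0 L" by (rule ring_hom_trans[OF hg1(1) f1])
  interpret fg: ring_hom_ring K0 L "f1 \<circ> g1" by (rule ring_hom_ringI2[OF K0.ring_axioms L.ring_axioms fg])
  have sub0: "subfield k0 L"
    unfolding k0_def by (rule fg.img_is_subfield[OF K0.carrier_is_subfield L.one_not_zero])
  have k01: "k0 \<subseteq> k1" using hom1 unfolding k0_def k1_def by auto
  have k02: "k0 \<subseteq> k2" using hom2 unfolding k0' k2_def by auto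
  have rc: "L.root_closed k0" unfolding k0_def by (rule root_closed_image[OF assms(4) fL fg])
  have Vr: "valuation_ring (V1 p) K1" "valuation_ring (V2 p) K2" for p
    using assms(2,3) unfolding tree_valued_field_def by simp_all
  have Vc: "V1 p \<subseteq> carrier K1" "V2 p \<subseteq> carrier K2" for p
    using Vr[of p] subringE(1)[of "V1 p" K1] subringE(1)[of "V2 p" K2]
    unfolding valuation_ring_def by simp_all
  have W1: "L.val_subring k1 (f1 ` V1 p)" and W2: "L.val_subring k2 (f2 ` V2 p)" for p
    unfolding k1_def k2_def
    by (rule valuation_ring_image[OF fields(2) fL f1 Vr(1)], rule valuation_ring_image[OF fields(3) fL f2 Vr(2)])
  have W10: "f1 ` V1 p \<inter> k0 = (f1 \<circ> g1) ` V0 p" for p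
  proof -
    have "f1 ` V1 p \<inter> f1 ` (g1 ` carrier K0) = f1 ` (V1 p \<inter> g1 ` carrier K0)"
      using hom1 Vc(1)[of p] by (intro inj_on_image_Int[OF inj(1), symmetric]) auto
    also have "V1 p \<inter> g1 ` carrier K0 = g1 ` V0 p" unfolding hg1(3)[symmetric] by auto
    finally show ?thesis unfolding k0_def by (simp add: image_comp)
  qed
  have W20: "f2 ` V2 p \<inter> k0 = (f2 \<circ> g2) ` V0 p" for p
  proof -
    have "f2 ` V2 p \<inter> f2 ` (g2 ` carrier K0) = f2 ` (V2 p \<inter> g2 ` carrier K0)"
      using hom2 Vc(2)[of p] by (intro inj_on_image_Int[OF inj(2), symmetric]) auto
    also have "V2 p \<inter> g2 ` carrier K0 = g2 ` V0 p" unfolding hg2(3)[symmetric] by auto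
    finally show ?thesis unfolding k0' by (simp add: image_comp)
  qed
  \<comment> \<open>Compatibility on \<open>k0\<close> holds because both families restrict to the
    same family \<open>V0\<close>.\<close>
  have W12: "f1 ` V1 p \<inter> k0 = f2 ` V2 p \<inter> k0" for p
    unfolding W10 W20 using agree hg1(3)[of p] by (auto simp: image_iff)
  \<comment> \<open>The last clause pins the ring at the root to the whole field, as being a model
    requires.\<close>
  define good where "good p V \<longleftrightarrow> L.val_subring (carrier L) V \<and> V \<inter> k1 = f1 ` V1 p \<and>
    V \<inter> k2 = f2 ` V2 p \<and> L.residually_disjoint k0 k1 k2 V \<and> (p = bot \<longrightarrow> V = carrier L)" for p :: 'p and V
  have nu: "L.nonunits (carrier L) = {\<zero>\<^bsub>L\<^esub>}"
    using L.nonzero_inv(1) unfolding L.nonunits_def by auto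
  \<comment> \<open>For the trivial valuation the only nonunit is zero, so the invariant is ordinary
    linear disjointness; the relation is pulled back to the tensor product, where
    \<open>relation_coefficients\<close> applies.\<close>
  have disj: "L.residually_disjoint k0 k1 k2 (carrier L)"
    unfolding L.residually_disjoint_def
  proof (intro allI impI, elim conjE)
    fix I :: "nat set" and a b
    assume fin: "finite I" and a: "a ` I \<subseteq> carrier L \<inter> k1" and b: "b ` I \<subseteq> carrier L \<inter> k2"
      and sum: "(\<Oplus>\<^bsub>L\<^esub>i\<in>I. a i \<otimes>\<^bsub>L\<^esub> b i) \<in> L.nonunits (carrier L)"
      and ex: "\<exists>i\<in>I. a i \<notin> L.nonunits (carrier L)"
    define \<alpha> \<beta> where "\<alpha> i = inv_into (carrier K1) f1 (a i)" and "\<beta> i = inv_into (carrier K2) f2 (b i)" for i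
    have \<alpha>: "\<alpha> i \<in> carrier K1" "f1 (\<alpha> i) = a i" and \<beta>: "\<beta> i \<in> carrier K2" "f2 (\<beta> i) = b i" if "i \<in> I" for i
      using a b that inv_into_into[of "a i" f1 "carrier K1"] f_inv_into_f[of "a i" f1 "carrier K1"]
        inv_into_into[of "b i" f2 "carrier K2"] f_inv_into_f[of "b i" f2 "carrier K2"]
      unfolding \<alpha>_def \<beta>_def k1_def k2_def by auto
    have "\<iota> (\<Oplus>\<^bsub>T\<^esub>i\<in>I. pure (\<alpha> i) (\<beta> i)) = (\<Oplus>\<^bsub>L\<^esub>i\<in>I. \<iota> (pure (\<alpha> i) (\<beta> i)))"
      by (rule finsum_hom[OF T.abelian_monoid_axioms L.abelian_monoid_axioms _ fin])
        (use \<alpha>(1) \<beta>(1) in auto)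
    also have "\<dots> = (\<Oplus>\<^bsub>L\<^esub>i\<in>I. a i \<otimes>\<^bsub>L\<^esub> b i)"
    proof (rule L.finsum_cong')
      show "(\<lambda>i. a i \<otimes>\<^bsub>L\<^esub> b i) \<in> I \<rightarrow> carrier L" using a b by (auto simp: image_subset_iff)
    qed (simp_all add: pure_f \<alpha> \<beta>)
    finally have hs: "\<iota> (\<Oplus>\<^bsub>T\<^esub>i\<in>I. pure (\<alpha> i) (\<beta> i)) = (\<Oplus>\<^bsub>L\<^esub>i\<in>I. a i \<otimes>\<^bsub>L\<^esub> b i)" .
    have \<alpha>c: "\<alpha> \<in> I \<rightarrow> carrier K1" and \<beta>c: "\<beta> \<in> I \<rightarrow> carrier K2" using \<alpha> \<beta> by auto
    have "(\<Oplus>\<^bsub>T\<^esub>i\<in>I. pure (\<alpha> i) (\<beta> i)) \<in> carrier T" using \<alpha> \<beta> by (intro T.finsum_closed) auto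
    moreover have "\<iota> (\<Oplus>\<^bsub>T\<^esub>i\<in>I. pure (\<alpha> i) (\<beta> i)) = \<iota> \<zero>\<^bsub>T\<^esub>"
      using hs sum \<iota>.hom_zero unfolding nu by simp
    ultimately have z: "(\<Oplus>\<^bsub>T\<^esub>i\<in>I. pure (\<alpha> i) (\<beta> i)) = \<zero>\<^bsub>T\<^esub>" using inj_onD[OF \<iota>(2)] by blast
    obtain i0 where i0: "i0 \<in> I" "a i0 \<noteq> \<zero>\<^bsub>L\<^esub>" using ex unfolding nu by auto
    have \<alpha>0: "\<alpha> i0 \<noteq> \<zero>\<^bsub>K1\<^esub>"
    proof
      assume "\<alpha> i0 = \<zero>\<^bsub>K1\<^esub>"
      then have "f1 (\<alpha> i0) = \<zero>\<^bsub>L\<^esub>" by simp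
      then show False using \<alpha>(2)[OF i0(1)] i0(2) by simp
    qed
    from relation_coefficients[OF fin \<alpha>c \<beta>c i0(1) \<alpha>0 z]
    obtain c where c: "c \<in> I \<rightarrow> carrier K0" "\<exists>i\<in>I. c i = \<one>\<^bsub>K0\<^esub>"
      "(\<Oplus>\<^bsub>K2\<^esub>i\<in>I. g2 (c i) \<otimes>\<^bsub>K2\<^esub> \<beta> i) = \<zero>\<^bsub>K2\<^esub>" by blast
    have cc: "g2 (c i) \<in> carrier K2" if "i \<in> I" for i using c(1) that hom2 by auto
    have "f2 (\<Oplus>\<^bsub>K2\<^esub>i\<in>I. g2 (c i) \<otimes>\<^bsub>K2\<^esub> \<beta> i) = (\<Oplus>\<^bsub>L\<^esub>i\<in>I. f2 (g2 (c i) \<otimes>\<^bsub>K2\<^esub> \<beta> i))"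
      by (rule finsum_hom[OF K2.abelian_monoid_axioms L.abelian_monoid_axioms _ fin])
        (use cc \<beta>(1) in auto)
    also have "\<dots> = (\<Oplus>\<^bsub>L\<^esub>i\<in>I. f2 (g2 (c i)) \<otimes>\<^bsub>L\<^esub> b i)"
    proof (rule L.finsum_cong')
      show "(\<lambda>i. f2 (g2 (c i)) \<otimes>\<^bsub>L\<^esub> b i) \<in> I \<rightarrow> carrier L"
        using cc b by (auto simp: image_subset_iff)
    qed (simp_all add: cc \<beta>)
    finally have hs2: "f2 (\<Oplus>\<^bsub>K2\<^esub>i\<in>I. g2 (c i) \<otimes>\<^bsub>K2\<^esub> \<beta> i) = (\<Oplus>\<^bsub>L\<^esub>i\<in>I. f2 (g2 (c i)) \<otimes>\<^bsub>L\<^esub> b i)" .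
    have "(\<lambda>i. f2 (g2 (c i))) ` I \<subseteq> carrier L \<inter> k0"
      using c(1) cc unfolding k0' by auto
    moreover have "\<exists>i\<in>I. f2 (g2 (c i)) \<notin> L.nonunits (carrier L)"
      using c(2) hom_one2 f2.hom_one L.one_not_zero unfolding nu by fastforce
    moreover have "(\<Oplus>\<^bsub>L\<^esub>i\<in>I. f2 (g2 (c i)) \<otimes>\<^bsub>L\<^esub> b i) \<in> L.nonunits (carrier L)"
      using hs2 c(3) f2.hom_zero unfolding nu by simp
    ultimately show "\<exists>c. c ` I \<subseteq> carrier L \<inter> k0 \<and> (\<exists>i\<in>I. c i \<notin> L.nonunits (carrier L)) \<and>
        (\<Oplus>\<^bsub>L\<^esub>i\<in>I. c i \<otimes>\<^bsub>L\<^esub> b i) \<in> L.nonunits (carrier L)"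
      by (intro exI[of _ "\<lambda>i. f2 (g2 (c i))"] conjI)
  qed
  have kc: "k1 \<subseteq> carrier L" "k2 \<subseteq> carrier L" using subfieldE(3) sub by auto
  have bots: "V1 bot = carrier K1" "V2 bot = carrier K2"
    using assms(2,3) unfolding tree_valued_field_def by auto
  have "good bot (carrier L)"
    unfolding good_def bots k1_def[symmetric] k2_def[symmetric]
    using disj kc L.carrier_is_subring unfolding L.val_subring_def by auto
  moreover have "\<exists>V'. V' \<subseteq> V \<and> good q V'" if pq: "p < q" and V: "good p V" for p q V
  proof -
    have m: "V1 q \<subseteq> V1 p" "V2 q \<subseteq> V2 p"
      using assms(2,3) pq unfolding tree_valued_field_def by auto
    have V': "L.val_subring (carrier L) V" "L.residually_disjoint k0 k1 k2 V"
      "f1 ` V1 q \<subseteq> V" "f2 ` V2 q \<subseteq> V"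
      using V m unfolding good_def by blast+
    have "q \<noteq> bot" using pq by auto
    then show ?thesis
      using L.residually_disjoint_extension[OF sub0 sub k01 k02 rc V'(1,2) W1 V'(3) W2 V'(4) W12]
      unfolding good_def by blast
  qed
  ultimately obtain V3 where V3: "\<And>p. good p (V3 p)" "\<And>p q. p < q \<Longrightarrow> V3 q \<subseteq> V3 p"
    using finite_tree_extension[of good "carrier L"] by blast
  note V3g = V3(1)[unfolded good_def]
  have "valuation_ring (V3 p) L" for p
    using V3g[of p] unfolding L.val_subring_def valuation_ring_def by auto
  moreover have "V3 bot = carrier L" using V3g[of bot] by simp
  ultimately have tvf: "tree_valued_field L V3" using V3(2) fL unfolding tree_valued_field_def by simp
  \<comment> \<open>Prescribed traces become preimages by injectivity of the embedding.\<close>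
  have "{x \<in> carrier K1. f1 x \<in> V3 p} = V1 p" for p
    by (rule inj_on_preimage_eq[OF inj(1) Vc(1)]) (use V3g[of p] in \<open>simp add: k1_def\<close>)
  then have e1: "tree_valued_embedding K1 V1 L V3 f1"
    using f1 inj(1) unfolding tree_valued_embedding_def by simp
  have "{x \<in> carrier K2. f2 x \<in> V3 p} = V2 p" for p
    by (rule inj_on_preimage_eq[OF inj(2) Vc(2)]) (use V3g[of p] in \<open>simp add: k2_def\<close>)
  then have e2: "tree_valued_embedding K2 V2 L V3 f2"
    using f2 inj(2) unfolding tree_valued_embedding_def by simp
  \<comment> \<open>The induced map is \<open>\<iota>\<close>, the inclusion of the domain
    \<open>T\<close> into its field of fractions.\<close>
  have "independent_amalgamation K0 K1 K2 g1 g2 L f1 f2"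
    unfolding independent_amalgamation_def tensor_induced_hom_def
    using \<iota> pure_f by (intro exI[of _ \<iota>]) simp
  then show ?thesis
    using tvf e1 e2 agree by (intro exI[of _ L] exI[of _ V3] exI[of _ f1] exI[of _ f2]) simp
qed

end
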